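(* Let $t>1$ and $R>0$. (a) There exists a global minimizer $h^*$ of the functional $I$ in the class $\mathcal{A}_h$. Such a global minimizer $h^*$ is a solution of the singular nonlinear ordinary differential equation $$\frac{d^2 h}{dr^2}+\frac{2}{r}\frac{dh}{dr}-\frac{6h}{r^2}=-h+h^3+\frac{3h_+}{t}\left(h^3-h^2\right)\quad\text{on }(0,R)$$ subject to the boundary conditions $h(0)=0$ and $h(R)=1$. Moreover, $h^*$ is analytic for all $0\le r\le R$. (b) Define the radial-hedgehog solution by $$\mathbf{Q}^*(\mathbf{r})=\sqrt{\tfrac32}\,h^*(r)\left(\frac{\mathbf{r}\otimes\mathbf{r}}{r^2}-\frac13\mathbf{I}\right),\qquad r=|\mathbf{r}|,$$ where $h^*$ is a global minimizer of $I$ in $\mathcal{A}_h$. Then $\mathbf{Q}^*$ is a solution in $B(0,R)$ of the Landau-de Gennes Euler-Lagrange equations $$\Delta \mathbf{Q}_{ij}=-\mathbf{Q}_{ij}-\frac{3\sqrt6\,h_+}{t}\left(\mathbf{Q}_{ik}\mathbf{Q}_{kj}-\frac{\delta_{ij}}{3}\mathrm{tr}(\mathbf{Q}^2)\right)+\frac{2h_+^2}{t}\mathbf{Q}_{ij}\,\mathrm{tr}(\mathbf{Q}^2),\quad i,j=1,2,3,$$ i.e. it is a stationary point of the Landau-de Gennes energy functional $\tilde{\mathcal I}_{LG}$. Moreover, it satisfies the energy bound $$\tilde{\mathcal I}_{LG}[\mathbf{Q}^*]\le 12\pi R .$$ (c) The function $h^*$ satisfies $0\le h^*(r)\le 1$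 for all $r\in[0,R]$.
   Context: $t>1$ is a dimensionless reduced temperature, $h_+=\frac{3+\sqrt{9+8t}}{4}$, and $B(0,R)=\{\mathbf{r}\in\mathbb{R}^3:|\mathbf{r}|\le R\}$. $\bar S$ is the space of symmetric, traceless real $3\times3$ matrices; repeated indices are summed; $\mathbf I$ is the identity matrix. The class is $\mathcal{A}_h=\{h\in W^{1,2}([0,R],\mathbb{R}):h(R)=1\}$ and $$I[h]=\int_0^R r^2\left(\frac12\left(\frac{dh}{dr}\right)^2+\frac{3h^2}{r^2}+f(h)\right)dr,\qquad f(h)=-\frac{h^2}{2}-\frac{h_+}{t}h^3+\frac{h_+^2}{2t}h^4+C(t),$$ where the constant $C(t)$ is chosen so that $f\ge0$ and $f(1)=0$. For $\mathbf{Q}\in W^{1,2}(B(0,R);\bar S)$ the (dimensionless) Landau-de Gennes energy is $$\tilde{\mathcal I}_{LG}[\mathbf{Q}]=\int_{B(0,R)}\frac12|\nabla\mathbf{Q}|^2-\frac12\mathrm{tr}\,\mathbf{Q}^2-\frac{\sqrt6h_+}{t}\mathrm{tr}\,\mathbf{Q}^3+\frac{h_+^2}{2t}(\mathrm{tr}\,\mathbf{Q}^2)^2+C(t)\,dV,\qquad |\nabla\mathbf{Q}|^2=\sum_{i,j,k}\left(\frac{\partial \mathbf{Q}_{ij}}{\partial x_k}\right)^2 .$$ *)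

theory Defs
  imports "HOL-Analysis.Analysis"
begin

section \<open>Smoothness and weak derivatives\<close>

primrec Ck_on :: "nat \<Rightarrow> 'a::euclidean_space set \<Rightarrow> ('a \<Rightarrow> real) \<Rightarrow> bool" where
  "Ck_on 0 U f \<longleftrightarrow> continuous_on U f"
| "Ck_on (Suc n) U f \<longleftrightarrow> (\<exists>f'. (\<forall>x\<in>U. (f has_derivative f' x) (at x)) \<and>
                                 (\<forall>v. Ck_on n U (\<lambda>x. f' x v)))"

text \<open>The space of smooth functions with compact support in \<open>U\<close>.\<close>

definition test_functions :: "'a::euclidean_space set \<Rightarrow> ('a \<Rightarrow> real) set" where
  "test_functions U =
     {\<phi>. (\<forall>n. Ck_on n UNIV \<phi>) \<and> (\<exists>K. compact K \<and> K \<subseteq> U \<and> (\<forall>x. x \<notin> K \<longrightarrow> \<phi> x = 0))}"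

definition locally_integrable_on :: "('a::euclidean_space \<Rightarrow> real) \<Rightarrow> 'a set \<Rightarrow> bool" where
  "locally_integrable_on u U \<longleftrightarrow>
     (\<forall>K. compact K \<and> K \<subseteq> U \<longrightarrow> integrable (lebesgue_on K) u)"

definition has_weak_deriv ::
  "'a::euclidean_space set \<Rightarrow> ('a \<Rightarrow> real) \<Rightarrow> 'a \<Rightarrow> ('a \<Rightarrow> real) \<Rightarrow> bool" where
  "has_weak_deriv U u v w \<longleftrightarrow>
     locally_integrable_on u U \<and> locally_integrable_on w U \<and>
     (\<forall>\<phi>\<in>test_functions U.
        (LINT x|lebesgue_on U. u x * frechet_derivative \<phi> (at x) v) =
        - (LINT x|lebesgue_on U. w x * \<phi> x))"

text \<open>
  A weak derivative is determined only up to a null set; the function below picks some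
  representative, and it is used only under integrals, whose values do not depend on the choice.
\<close>

definition weak_deriv ::
  "'a::euclidean_space set \<Rightarrow> ('a \<Rightarrow> real) \<Rightarrow> 'a \<Rightarrow> 'a \<Rightarrow> real" where
  "weak_deriv U u v = (SOME w. has_weak_deriv U u v w)"

definition L2_on :: "'a::euclidean_space set \<Rightarrow> ('a \<Rightarrow> real) set" where
  "L2_on U = {u. u \<in> borel_measurable (lebesgue_on U) \<and> integrable (lebesgue_on U) (\<lambda>x. (u x)\<^sup>2)}"

definition W12 :: "'a::euclidean_space set \<Rightarrow> ('a \<Rightarrow> real) set" where
  "W12 U = {u \<in> L2_on U. \<forall>b\<in>Basis. \<exists>w\<in>L2_on U. has_weak_deriv U u b w}"

text \<open>Real analyticity on an arbitrary subset of the line; at an endpoint of a closed interval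
  this says that a power series converging in a full neighbourhood represents the function on
  the part of that neighbourhood inside the interval.\<close>

definition real_analytic_on :: "(real \<Rightarrow> real) \<Rightarrow> real set \<Rightarrow> bool" where
  "real_analytic_on f S \<longleftrightarrow>
     (\<forall>x\<^sub>0\<in>S. \<exists>a. \<exists>\<delta>>0. \<forall>x\<in>S. \<bar>x - x\<^sub>0\<bar> < \<delta> \<longrightarrow> (\<lambda>n. a n * (x - x\<^sub>0) ^ n) sums f x)"

section \<open>The bulk potential\<close>

definition h_plus :: "real \<Rightarrow> real" where
  "h_plus t = (3 + sqrt (9 + 8 * t)) / 4"

definition bulk :: "real \<Rightarrow> real \<Rightarrow> real \<Rightarrow> real" where
  "bulk t c h = - h\<^sup>2 / 2 - h_plus t / t * h ^ 3 + (h_plus t)\<^sup>2 / (2 * t) * h ^ 4 + c"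

definition C_const :: "real \<Rightarrow> real" where
  "C_const t = (THE c. (\<forall>h. 0 \<le> bulk t c h) \<and> bulk t c 1 = 0)"

definition f_bulk :: "real \<Rightarrow> real \<Rightarrow> real" where
  "f_bulk t h = bulk t (C_const t) h"

text \<open>The constant exists and is unique, so the description above is proper.\<close>

lemma h_plus_root:
  assumes "t > 1"
  shows "2 * (h_plus t)\<^sup>2 = 3 * h_plus t + t" and "h_plus t > 3 / 2"
proof -
  have s: "(sqrt (9 + 8 * t))\<^sup>2 = 9 + 8 * t" using assms by simp
  then show "2 * (h_plus t)\<^sup>2 = 3 * h_plus t + t"
    unfolding h_plus_def by (simp add: power2_eq_square field_simps)
  have "sqrt (9 + 8 * t) > 3" using assms by (intro real_less_rsqrt) auto
  then show "h_plus t > 3 / 2" unfolding h_plus_def by simp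
qed

lemma C_const_eq:
  assumes "t > 1"
  shows "C_const t = 1 / 2 + h_plus t / t - (h_plus t)\<^sup>2 / (2 * t)"
    and "0 \<le> f_bulk t h" and "f_bulk t 1 = 0"
proof -
  define p where "p = h_plus t"
  define c where "c = 1 / 2 + p / t - p\<^sup>2 / (2 * t)"
  have t: "t = 2 * p\<^sup>2 - 3 * p" and p: "p > 3 / 2"
    using h_plus_root[OF assms] unfolding p_def by linarith+
  have fact: "bulk t c h = (h - 1)\<^sup>2 * ((p\<^sup>2 - p) * (h + 1)\<^sup>2 + p * h\<^sup>2) / (2 * t)" for h
  proof -
    have "2 * t * bulk t c h =
        - t * h\<^sup>2 - 2 * p * h ^ 3 + p\<^sup>2 * h ^ 4 + (t + 2 * p - p\<^sup>2)"
      using assms unfolding bulk_def c_def p_def[symmetric] by (simp add: field_simps)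
    also have "\<dots> = (h - 1)\<^sup>2 * ((p\<^sup>2 - p) * (h + 1)\<^sup>2 + p * h\<^sup>2)"
      unfolding t by algebra
    finally show ?thesis using assms by (simp add: field_simps)
  qed
  have "p * 1 \<le> p * p" using p by (intro mult_left_mono) auto
  then have "p\<^sup>2 - p \<ge> 0" by (simp add: power2_eq_square)
  then have pos: "0 \<le> bulk t c h" for h
    unfolding fact using assms p by (intro divide_nonneg_pos mult_nonneg_nonneg add_nonneg_nonneg) auto
  have one: "bulk t c 1 = 0" unfolding fact by simp
  have C: "C_const t = c"
    unfolding C_const_def
  proof (rule the_equality)
    show "c' = c" if "(\<forall>h. 0 \<le> bulk t c' h) \<and> bulk t c' 1 = 0" for c'
      using that one by (simp add: bulk_def)
  qed (use pos one in blast)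
  then show "C_const t = 1 / 2 + h_plus t / t - (h_plus t)\<^sup>2 / (2 * t)"
    by (simp add: c_def p_def)
  show "0 \<le> f_bulk t h" "f_bulk t 1 = 0"
    using pos one by (simp_all add: f_bulk_def C)
qed

section \<open>The radial functional\<close>

text \<open>Elements of the Sobolev space of an interval are identified with their continuous
  representatives on the closed interval, which gives the endpoint condition its meaning.\<close>

definition A_h :: "real \<Rightarrow> (real \<Rightarrow> real) set" where
  "A_h R = {h \<in> W12 {0<..<R}. continuous_on {0..R} h \<and> h R = 1}"

definition I_radial :: "real \<Rightarrow> real \<Rightarrow> (real \<Rightarrow> real) \<Rightarrow> real" where
  "I_radial t R h =
     (LINT r|lebesgue_on {0..R}.
        r\<^sup>2 * (1 / 2 * (weak_deriv {0<..<R} h 1 r)\<^sup>2 + 3 * (h r)\<^sup>2 / r\<^sup>2 + f_bulk t (h r)))"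

definition global_minimizer :: "real \<Rightarrow> real \<Rightarrow> (real \<Rightarrow> real) \<Rightarrow> bool" where
  "global_minimizer t R h \<longleftrightarrow> h \<in> A_h R \<and> (\<forall>g\<in>A_h R. I_radial t R h \<le> I_radial t R g)"

definition radial_ODE_solution :: "real \<Rightarrow> real \<Rightarrow> (real \<Rightarrow> real) \<Rightarrow> bool" where
  "radial_ODE_solution t R h \<longleftrightarrow>
     (\<forall>r\<in>{0<..<R}. h field_differentiable (at r) \<and> deriv h field_differentiable (at r) \<and>
        deriv (deriv h) r + 2 / r * deriv h r - 6 * h r / r\<^sup>2 =
        - h r + h r ^ 3 + 3 * h_plus t / t * (h r ^ 3 - (h r)\<^sup>2))"

section \<open>The Landau-de Gennes energy\<close>

definition S_bar :: "(real^3^3) set" where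
  "S_bar = {A. transpose A = A \<and> trace A = 0}"

definition W12_S_bar :: "(real^3) set \<Rightarrow> (real^3 \<Rightarrow> real^3^3) set" where
  "W12_S_bar U = {Q. (\<forall>x\<in>U. Q x \<in> S_bar) \<and> (\<forall>i j. (\<lambda>x. Q x $ i $ j) \<in> W12 U)}"

definition LdG_energy :: "real \<Rightarrow> real \<Rightarrow> (real^3 \<Rightarrow> real^3^3) \<Rightarrow> real" where
  "LdG_energy t R Q =
     (LINT x|lebesgue_on (cball 0 R).
        1 / 2 * (\<Sum>i\<in>UNIV. \<Sum>j\<in>UNIV. \<Sum>k\<in>UNIV.
                   (weak_deriv (ball 0 R) (\<lambda>y. Q y $ i $ j) (axis k 1) x)\<^sup>2)
        - 1 / 2 * trace (Q x ** Q x)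
        - sqrt 6 * h_plus t / t * trace (Q x ** Q x ** Q x)
        + (h_plus t)\<^sup>2 / (2 * t) * (trace (Q x ** Q x))\<^sup>2
        + C_const t)"

definition LdG_stationary :: "real \<Rightarrow> real \<Rightarrow> (real^3 \<Rightarrow> real^3^3) \<Rightarrow> bool" where
  "LdG_stationary t R Q \<longleftrightarrow>
     Q \<in> W12_S_bar (ball 0 R) \<and>
     (\<forall>P. (\<forall>x. P x \<in> S_bar) \<and> (\<forall>i j. (\<lambda>x. P x $ i $ j) \<in> test_functions (ball 0 R)) \<longrightarrow>
        ((\<lambda>\<epsilon>. LdG_energy t R (\<lambda>x. Q x + \<epsilon> *\<^sub>R P x)) has_real_derivative 0) (at 0))"

definition partial_deriv :: "3 \<Rightarrow> (real^3 \<Rightarrow> real) \<Rightarrow> real^3 \<Rightarrow> real" where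
  "partial_deriv k u x = frechet_derivative u (at x) (axis k 1)"

definition laplacian :: "(real^3 \<Rightarrow> real) \<Rightarrow> real^3 \<Rightarrow> real" where
  "laplacian u x = (\<Sum>k\<in>UNIV. partial_deriv k (partial_deriv k u) x)"

definition LdG_EL_solution :: "real \<Rightarrow> real \<Rightarrow> (real^3 \<Rightarrow> real^3^3) \<Rightarrow> bool" where
  "LdG_EL_solution t R Q \<longleftrightarrow>
     (\<forall>i j. Ck_on 2 (ball 0 R) (\<lambda>x. Q x $ i $ j)) \<and>
     (\<forall>x\<in>ball 0 R. \<forall>i j.
        laplacian (\<lambda>y. Q y $ i $ j) x =
        - Q x $ i $ j
        - 3 * sqrt 6 * h_plus t / t *
            ((\<Sum>k\<in>UNIV. Q x $ i $ k * Q x $ k $ j)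
             - (if i = j then 1 else 0) / 3 * trace (Q x ** Q x))
        + 2 * (h_plus t)\<^sup>2 / t * Q x $ i $ j * trace (Q x ** Q x))"

text \<open>At the origin division by zero makes the value \<open>- sqrt (3/2) * h 0 / 3\<close> times the
  identity, which is zero, the continuous value, when \<open>h 0 = 0\<close>.\<close>

definition hedgehog :: "(real \<Rightarrow> real) \<Rightarrow> real^3 \<Rightarrow> real^3^3" where
  "hedgehog h x =
     (sqrt (3 / 2) * h (norm x)) *\<^sub>R
       ((1 / (norm x)\<^sup>2) *\<^sub>R (\<chi> i j. x $ i * x $ j) - (1 / 3) *\<^sub>R mat 1)"

end

theory Submission
  imports Defs "HOL-Complex_Analysis.Great_Picard"
begin

text \<open>
  Put \<open>u = r h\<close> and \<open>w = u'\<close>. Integrating \<open>(r h\<^sup>2)'\<close> turns \<open>I\<close>, up to the constant \<open>R / 2\<close>, into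
  \<open>J(w) = \<integral> w\<^sup>2 / 2 + 3 (u / r)\<^sup>2 + r\<^sup>2 f(u / r)\<close>, whose derivative part has no weight.
  A minimizing sequence has bounded \<open>w\<close> in \<open>L\<^sup>2\<close>, so the \<open>u\<close> converge uniformly along a subsequence
  (Arzela-Ascoli) and the potential terms converge; the parallelogram law then makes \<open>w\<close> Cauchy
  in \<open>L\<^sup>2\<close>.

  Write a minimizer as \<open>u = r\<^sup>3 e\<close>. Its Euler-Lagrange equation reads \<open>(r\<^sup>6 e')' = r\<^sup>6 P(r, e)\<close> with a
  polynomial \<open>P\<close>. Boundedness of \<open>e\<close> near the origin gives \<open>e'(r) = r T\<^sub>6 P(r)\<close> on all of \<open>[0, R]\<close>, where
  \<open>T\<^sub>k f(r) = \<integral>\<^sub>0\<^sup>1 s\<^sup>k f(r s) ds\<close>. The algebra generated by \<open>e\<close>, \<open>r\<close> and all \<open>T\<^sub>k\<close> is closed under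
  differentiation, with factorial bounds on the derivatives, so \<open>h = r\<^sup>2 e\<close> is analytic up to both
  endpoints, and the hedgehog \<open>sqrt (3/2) e(|x|) (x \<otimes> x - |x|\<^sup>2 I / 3)\<close> is \<open>C\<^sup>2\<close> across the origin.
  Stationarity then follows by integrating by parts, and the energy is \<open>4 \<pi> I[h] \<le> 4 \<pi> I[1] = 12 \<pi> R\<close>.

  If \<open>h\<close> were negative between two zeros, changing its sign there would lower \<open>I\<close> through the cubic
  term; an interior maximum above 1 contradicts the equation.
\<close>

section \<open>Integration by parts for absolutely continuous functions\<close>

text \<open>Near the origin \<open>I\<close> controls only \<open>r h'\<close>, so it gives no bound
  on \<open>h'\<close> in L2 along a minimizing sequence. The problem is therefore solved for
  \<open>w = (r h)'\<close> in a larger class, where \<open>r h\<close> is in W12 and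
  \<open>h\<close> is merely square integrable. Regularity then returns the minimizer to
  \<open>A_h\<close>. Hence both problems have the same minimum up to the constant, and every
  minimizer of \<open>I\<close> inherits the regularity of minimizers of \<open>J\<close>.

  The factor \<open>r^3\<close> comes from the indicial equation \<open>s (s + 1) = 6\<close> of the
  linear part: \<open>h\<close> behaves like \<open>r^2\<close> or \<open>r^(-3)\<close>, and the
  growth bound \<open>\<bar>r h\<bar> \<le> sqrt (B r)\<close> excludes the latter. With
  \<open>h = r^2 e\<close> the term \<open>6 h / r^2\<close> disappears. The remaining division by
  \<open>r^6\<close>, after one integration, is absorbed by the averages, which make sense at 0 too.
  As \<open>e' / r\<close> is again such an average, the divisibility by \<open>r\<close> that
  differentiability across the origin demands comes for free.

  Until regularity is known, derivatives exist only in the integrated sense. This is why weak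
  derivatives are first identified with densities of absolutely continuous functions.\<close>

lemma Fubini_by_parts:
  fixes f g :: "real \<Rightarrow> real"
  assumes f: "integrable lborel f" and g: "integrable lborel g"
  shows "(\<integral>x. f x \<partial>lborel) * (\<integral>x. g x \<partial>lborel) =
    (\<integral>s. f s * (\<integral>y. indicator {..s} y * g y \<partial>lborel) \<partial>lborel) +
    (\<integral>y. g y * (\<integral>s. indicator {..<y} s * f s \<partial>lborel) \<partial>lborel)"
proof -
  have [measurable]: "f \<in> borel_measurable borel" "g \<in> borel_measurable borel"
    using f g by (auto dest: borel_measurable_integrable)
  have int_le: "integrable lborel (\<lambda>y. indicator A y * g y)" if "A \<in> sets borel" for A
    using integrable_mult_indicator[OF _ g, of A] that by simp
  \<comment> \<open>The part of the product strictly above the diagonal. Integrated over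
    \<open>s\<close> first it gives the second summand of the claim; integrated over
    \<open>y\<close> first it is what the first summand lacks to the full product.\<close>
  define K where "K = (\<lambda>(s::real, y::real). indicator {s<..} y * (f s * g y) :: real)"
  have Kint: "integrable (lborel \<Otimes>\<^sub>M lborel) K"
  proof (rule lborel_pair.Fubini_integrable)
    have "K = (\<lambda>p. indicator {p. fst p < snd p} p * (f (fst p) * g (snd p)))"
      by (auto simp: K_def indicator_def)
    moreover have "(\<lambda>p. indicator {p. fst p < snd p} p * (f (fst p) * g (snd p))) \<in> borel_measurable (lborel \<Otimes>\<^sub>M lborel)"
      by measurable
    ultimately show "K \<in> borel_measurable (lborel \<Otimes>\<^sub>M lborel)" by simp
    then have [measurable]: "K \<in> borel_measurable (lborel \<Otimes>\<^sub>M lborel)" .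
    have eq: "(\<integral>y. norm (K (x, y)) \<partial>lborel) = \<bar>f x\<bar> * (\<integral>y. indicator {x<..} y * \<bar>g y\<bar> \<partial>lborel)" for x
      unfolding integral_mult_right_zero[symmetric]
      by (rule Bochner_Integration.integral_cong) (auto simp: K_def abs_mult indicator_def)
    show "integrable lborel (\<lambda>x. \<integral>y. norm (K (x, y)) \<partial>lborel)"
    proof (rule Bochner_Integration.integrable_bound)
      show "integrable lborel (\<lambda>x. f x * (\<integral>y. \<bar>g y\<bar> \<partial>lborel))" using f by simp
      show "(\<lambda>x. \<integral>y. norm (K (x, y)) \<partial>lborel) \<in> borel_measurable lborel"
        by measurable
      show "AE x in lborel. norm (\<integral>y. norm (K (x, y)) \<partial>lborel) \<le> norm (f x * (\<integral>y. \<bar>g y\<bar> \<partial>lborel))"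
      proof (rule AE_I2)
        fix x
        have "(\<integral>y. indicator {x<..} y * \<bar>g y\<bar> \<partial>lborel) \<le> (\<integral>y. \<bar>g y\<bar> \<partial>lborel)"
          using integrable_mult_indicator[of "{x<..}" lborel "\<lambda>y. \<bar>g y\<bar>"] g
          by (intro integral_mono) (auto simp: indicator_def)
        moreover have "(\<integral>y. indicator {x<..} y * \<bar>g y\<bar> \<partial>lborel) \<ge> 0"
          by (intro Bochner_Integration.integral_nonneg) auto
        ultimately show "norm (\<integral>y. norm (K (x, y)) \<partial>lborel) \<le> norm (f x * (\<integral>y. \<bar>g y\<bar> \<partial>lborel))"
          unfolding eq by (auto simp: abs_mult intro!: mult_left_mono)
      qed
    qed
    show "AE x in lborel. integrable lborel (\<lambda>y. K (x, y))"
    proof (rule AE_I2)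
      fix x
      have "integrable lborel (\<lambda>y. f x * (indicator {x<..} y * g y))"
        using int_le[of "{x<..}"] by (intro integrable_mult_right) auto
      then show "integrable lborel (\<lambda>y. K (x, y))"
        by (simp add: K_def mult_ac)
    qed
  qed
  have I1: "(\<integral>y. K (s, y) \<partial>lborel) = f s * (\<integral>y. indicator {s<..} y * g y \<partial>lborel)" for s
    unfolding integral_mult_right_zero[symmetric]
    by (rule Bochner_Integration.integral_cong) (auto simp: K_def indicator_def)
  have I2: "(\<integral>s. K (s, y) \<partial>lborel) = g y * (\<integral>s. indicator {..<y} s * f s \<partial>lborel)" for y
    unfolding integral_mult_right_zero[symmetric]
    by (rule Bochner_Integration.integral_cong) (auto simp: K_def indicator_def)
  have Fub: "(\<integral>y. \<integral>s. K (s, y) \<partial>lborel \<partial>lborel) = (\<integral>s. \<integral>y. K (s, y) \<partial>lborel \<partial>lborel)"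
    using lborel_pair.Fubini_integral[of "\<lambda>s y. K (s, y)"] Kint by simp
  have Ki: "integrable lborel (\<lambda>s. \<integral>y. K (s, y) \<partial>lborel)"
    using lborel_pair.integrable_fst'[OF Kint] by simp
  have split: "f s * (\<integral>y. g y \<partial>lborel) - (\<integral>y. K (s, y) \<partial>lborel) = f s * (\<integral>y. indicator {..s} y * g y \<partial>lborel)" for s
  proof -
    have "(\<integral>y. g y \<partial>lborel) = (\<integral>y. indicator {..s} y * g y + indicator {s<..} y * g y \<partial>lborel)"
      by (rule Bochner_Integration.integral_cong) (auto simp: indicator_def)
    also have "\<dots> = (\<integral>y. indicator {..s} y * g y \<partial>lborel) + (\<integral>y. indicator {s<..} y * g y \<partial>lborel)"
      by (intro Bochner_Integration.integral_add int_le) auto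
    finally show ?thesis unfolding I1 by (simp add: algebra_simps)
  qed
  have "(\<integral>s. f s * (\<integral>y. indicator {..s} y * g y \<partial>lborel) \<partial>lborel) =
      (\<integral>s. f s * (\<integral>y. g y \<partial>lborel) \<partial>lborel) - (\<integral>s. \<integral>y. K (s, y) \<partial>lborel \<partial>lborel)"
    unfolding split[symmetric] using f Ki by (intro Bochner_Integration.integral_diff) auto
  then show ?thesis using Fub unfolding I2 by simp
qed

text \<open>Absolute continuity on the interval, with \<open>w\<close> as density. Integrability is
  in the sense of Lebesgue, while increments use the gauge integral, so that its theorems on
  indefinite integrals apply; \<open>integral_lebesgue_on_ivl\<close> passes between the
  two.\<close>

definition primitive :: "real \<Rightarrow> (real \<Rightarrow> real) \<Rightarrow> (real \<Rightarrow> real) \<Rightarrow> bool" where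
  "primitive R f w \<longleftrightarrow>
     integrable (lebesgue_on {0..R}) w \<and> (\<forall>x\<in>{0..R}. f x = f 0 + integral {0..x} w)"

section \<open>Calculus of primitives of integrable functions\<close>

lemma integrable_lebesgue_on_iff_ivl:
  fixes w :: "real \<Rightarrow> real"
  shows "integrable (lebesgue_on {a..b}) w \<longleftrightarrow> w absolutely_integrable_on {a..b}"
  by (simp add: set_integrable_def integrable_restrict_space)

lemma integrable_lebesgue_on_subset_ivl:
  fixes w :: "real \<Rightarrow> real"
  assumes "integrable (lebesgue_on {a..b}) w" "{c..d} \<subseteq> {a..b}"
  shows "integrable (lebesgue_on {c..d}) w"
  using assms unfolding integrable_lebesgue_on_iff_ivl
  by (meson set_integrable_subset sets_completionI_sets sets_lborel atLeastAtMost_borel lborelD lmeasurable_interval(1) fmeasurableD)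

lemma integral_lebesgue_on_ivl:
  fixes w :: "real \<Rightarrow> real"
  assumes "integrable (lebesgue_on {a..b}) w"
  shows "(LINT x|lebesgue_on {a..b}. w x) = integral {a..b} w"
  using assms by (intro lebesgue_integral_eq_integral) auto

lemma integrable_on_of_lebesgue_ivl:
  fixes w :: "real \<Rightarrow> real"
  assumes "integrable (lebesgue_on {a..b}) w"
  shows "w integrable_on {a..b}"
  using assms by (intro integrable_on_lebesgue_on) auto

lemma integrable_continuous_times:
  fixes f w :: "real \<Rightarrow> real"
  assumes "continuous_on {a..b} f" "integrable (lebesgue_on {a..b}) w"
  shows "integrable (lebesgue_on {a..b}) (\<lambda>x. f x * w x)"
proof -
  have "bounded (f ` {a..b})"
    using assms(1) compact_continuous_image compact_imp_bounded by blast
  then obtain B where B: "\<And>x. x \<in> {a..b} \<Longrightarrow> \<bar>f x\<bar> \<le> B"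
    by (force simp: bounded_iff)
  have [measurable]: "f \<in> borel_measurable (lebesgue_on {a..b})"
    using assms(1) by (intro continuous_imp_measurable_on_sets_lebesgue) auto
  have [measurable]: "w \<in> borel_measurable (lebesgue_on {a..b})"
    using assms(2) by auto
  show ?thesis
  proof (rule Bochner_Integration.integrable_bound)
    show "integrable (lebesgue_on {a..b}) (\<lambda>x. B * w x)" using assms(2) by simp
    show "AE x in lebesgue_on {a..b}. norm (f x * w x) \<le> norm (B * w x)"
    proof (rule AE_I2)
      fix x assume "x \<in> space (lebesgue_on {a..b})"
      then have "\<bar>f x\<bar> \<le> \<bar>B\<bar>" using B[of x] by auto
      then show "norm (f x * w x) \<le> norm (B * w x)"
        by (simp add: abs_mult mult_right_mono)
    qed
  qed measurable
qed

text \<open>Integration by parts without pointwise derivatives: after extension by zero and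
  replacement by Borel functions that agree almost everywhere, the claim is Fubini on the two
  triangles of a square.\<close>

lemma integral_parts_primitives:
  fixes w v :: "real \<Rightarrow> real"
  assumes w: "integrable (lebesgue_on {0..x}) w" and v: "integrable (lebesgue_on {0..x}) v"
  shows "integral {0..x} w * integral {0..x} v =
    integral {0..x} (\<lambda>s. w s * integral {0..s} v + v s * integral {0..s} w)"
proof -
  have borel: "\<exists>w'. integrable lborel w' \<and> (AE x in lborel. indicator {0..x0} x * w x = w' x)"
    if w: "integrable (lebesgue_on {0..x0}) w" for x0 and w :: "real \<Rightarrow> real"
  proof -
    have i: "integrable lebesgue (\<lambda>x. indicator {0..x0} x * w x)"
      using w by (simp add: integrable_restrict_space)
    then obtain w' where w': "w' \<in> borel_measurable lborel" "AE x in lborel. indicator {0..x0} x * w x = w' x"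
      using completion_ex_borel_measurable_real[of "\<lambda>x. indicator {0..x0} x * w x" lborel] by auto
    have "AE x in lebesgue. indicator {0..x0} x * w x = w' x"
      using w'(2) by (rule AE_completion)
    then have "integrable lebesgue w'"
      using i w'(1) integrable_cong_AE_imp measurable_completion by metis
    then show ?thesis using w' integrable_completion[of w' lborel] by auto
  qed
  have int: "(\<integral>y. indicator A y * w' y \<partial>lborel) = integral {0..s} w"
    if w: "integrable (lebesgue_on {0..x0}) w" and w': "integrable lborel w'"
      "AE x in lborel. indicator {0..x0} x * w x = w' x" and A: "A \<inter> {0..x0} = {0..s} \<or> A \<inter> {0..x0} = {0..<s}"
      "A \<in> sets borel" "s \<le> x0"
    for w w' :: "real \<Rightarrow> real" and s x0 A
  proof -
    have wi: "integrable (lebesgue_on {0..s}) w"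
      by (rule integrable_lebesgue_on_subset_ivl[OF w]) (use A in auto)
    have [measurable]: "w' \<in> borel_measurable borel" using w' by auto
    have [measurable]: "(\<lambda>y. indicator {0..s} y * w y) \<in> borel_measurable lebesgue"
      using wi by (auto simp: integrable_restrict_space dest: borel_measurable_integrable)
    have ne: "AE x in lborel. x \<noteq> s" by (rule AE_lborel_singleton)
    have ae: "AE y in lborel. indicator A y * w' y = indicator {0..s} y * w y"
      using w'(2) ne
    proof eventually_elim
      case (elim y)
      have "indicator A y * indicator {0..x0} y = (indicator (A \<inter> {0..x0}) y :: real)"
        by (auto simp: indicator_def)
      also have "\<dots> = indicator {0..s} y"
      proof -
        have "y \<in> A \<inter> {0..x0} \<longleftrightarrow> y \<in> {0..s}"
          using A(1)
        proof
          assume "A \<inter> {0..x0} = {0..<s}"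
          then show ?thesis using elim(2) by (simp only:) auto
        qed simp
        then show ?thesis by (auto simp: indicator_def)
      qed
      finally show ?case using elim(1)[symmetric] by (metis mult.assoc)
    qed
    have "(\<integral>y. indicator A y * w' y \<partial>lborel) = (\<integral>y. indicator A y * w' y \<partial>lebesgue)"
      using A(2) by (intro integral_completion[symmetric]) auto
    also have "\<dots> = (\<integral>y. indicator {0..s} y * w y \<partial>lebesgue)"
    proof (rule integral_cong_AE)
      show "(\<lambda>y. indicator A y * w' y) \<in> borel_measurable lebesgue"
        using A(2) by (intro measurable_completion) auto
      show "AE y in lebesgue. indicator A y * w' y = indicator {0..s} y * w y"
        by (rule AE_completion[OF ae])
    qed measurable
    also have "\<dots> = (LINT y|lebesgue_on {0..s}. w y)"
      by (simp add: integral_restrict_space)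
    finally show ?thesis using integral_lebesgue_on_ivl[OF wi] by simp
  qed
  obtain w' where w': "integrable lborel w'" "AE s in lborel. indicator {0..x} s * w s = w' s"
    using borel[OF w] by blast
  obtain v' where v': "integrable lborel v'" "AE s in lborel. indicator {0..x} s * v s = v' s"
    using borel[OF v] by blast
  have [measurable]: "w' \<in> borel_measurable borel" "v' \<in> borel_measurable borel" using w' v' by auto
  have cont: "continuous_on {0..x} (\<lambda>s. integral {0..s} w)" "continuous_on {0..x} (\<lambda>s. integral {0..s} v)"
    using w v by (auto intro!: indefinite_integral_continuous_1 integrable_on_of_lebesgue_ivl)
  \<comment> \<open>Both summands of the Fubini formula have this shape. Closed and half-open
    sections are treated together because the formula produces one of each.\<close>
  have half: "(\<integral>s. w' s * (\<integral>y. indicator (A s) y * v' y \<partial>lborel) \<partial>lborel) =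
      integral {0..x} (\<lambda>s. w s * integral {0..s} v)"
    if w: "integrable (lebesgue_on {0..x}) w" and w': "integrable lborel w'" "AE s in lborel. indicator {0..x} s * w s = w' s"
    and v: "integrable (lebesgue_on {0..x}) v" and v': "integrable lborel v'" "AE s in lborel. indicator {0..x} s * v s = v' s"
    and A: "A = (\<lambda>s. {..s}) \<or> A = (\<lambda>s. {..<s})"
    and m: "(\<lambda>s. w' s * (\<integral>y. indicator (A s) y * v' y \<partial>lborel)) \<in> borel_measurable lborel"
    for w v w' v' :: "real \<Rightarrow> real" and A
  proof -
    have c: "continuous_on {0..x} (\<lambda>s. integral {0..s} v)"
      using v by (auto intro!: indefinite_integral_continuous_1 integrable_on_of_lebesgue_ivl)
    have ii: "integrable (lebesgue_on {0..x}) (\<lambda>s. integral {0..s} v * w s)"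
      by (rule integrable_continuous_times[OF c w])
    then have i: "integrable lebesgue (\<lambda>s. indicator {0..x} s * (integral {0..s} v * w s))"
      by (simp add: integrable_restrict_space)
    have ae: "AE s in lborel. w' s * (\<integral>y. indicator (A s) y * v' y \<partial>lborel) =
      indicator {0..x} s * (integral {0..s} v * w s)" using w'(2)
    proof eventually_elim
      case (elim s)
      show ?case
      proof (cases "s \<in> {0..x}")
        case True
        then have "A s \<inter> {0..x} = {0..s} \<or> A s \<inter> {0..x} = {0..<s}" "A s \<in> sets borel" "s \<le> x"
          using A by auto
        from int[OF v v' this] True elim[symmetric] show ?thesis by simp
      next
        case False
        then show ?thesis using elim[symmetric] by simp
      qed
    qed
    have "(\<integral>s. w' s * (\<integral>y. indicator (A s) y * v' y \<partial>lborel) \<partial>lborel) =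
       (\<integral>s. w' s * (\<integral>y. indicator (A s) y * v' y \<partial>lborel) \<partial>lebesgue)"
      using m by (intro integral_completion[symmetric]) auto
    also have "\<dots> = (\<integral>s. indicator {0..x} s * (integral {0..s} v * w s) \<partial>lebesgue)"
    proof (rule integral_cong_AE)
      show "(\<lambda>s. w' s * (\<integral>y. indicator (A s) y * v' y \<partial>lborel)) \<in> borel_measurable lebesgue"
        using m by (rule measurable_completion)
      show "AE s in lebesgue. w' s * (\<integral>y. indicator (A s) y * v' y \<partial>lborel) =
        indicator {0..x} s * (integral {0..s} v * w s)"
        by (rule AE_completion[OF ae])
    qed (use i in auto)
    also have "\<dots> = (LINT s|lebesgue_on {0..x}. integral {0..s} v * w s)"
      by (simp add: integral_restrict_space)
    finally show ?thesis using integral_lebesgue_on_ivl[OF ii] by (simp add: mult.commute)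
  qed
  have m1: "(\<lambda>s. w' s * (\<integral>y. indicator {..s} y * v' y \<partial>lborel)) \<in> borel_measurable lborel"
  proof -
    have "(\<lambda>(s::real, y::real). indicator {..s} y * v' y :: real) = (\<lambda>p. indicator {p. snd p \<le> fst p} p * v' (snd p))"
      by (auto simp: indicator_def)
    moreover have "(\<lambda>p. indicator {p. snd p \<le> fst p} p * v' (snd p)) \<in> borel_measurable (borel \<Otimes>\<^sub>M (lborel :: real measure))"
      by measurable
    ultimately have [measurable]: "(\<lambda>(s::real, y::real). indicator {..s} y * v' y :: real) \<in> borel_measurable (borel \<Otimes>\<^sub>M lborel)"
      by simp
    show ?thesis by measurable
  qed
  have m2: "(\<lambda>s. v' s * (\<integral>y. indicator {..<s} y * w' y \<partial>lborel)) \<in> borel_measurable lborel"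
  proof -
    have "(\<lambda>(s::real, y::real). indicator {..<s} y * w' y :: real) = (\<lambda>p. indicator {p. snd p < fst p} p * w' (snd p))"
      by (auto simp: indicator_def)
    moreover have "(\<lambda>p. indicator {p. snd p < fst p} p * w' (snd p)) \<in> borel_measurable (borel \<Otimes>\<^sub>M (lborel :: real measure))"
      by measurable
    ultimately have [measurable]: "(\<lambda>(s::real, y::real). indicator {..<s} y * w' y :: real) \<in> borel_measurable (borel \<Otimes>\<^sub>M lborel)"
      by simp
    show ?thesis by measurable
  qed
  have t: "(\<integral>s. w' s \<partial>lborel) = integral {0..x} w" "(\<integral>s. v' s \<partial>lborel) = integral {0..x} v"
    using int[OF w w', of UNIV x] int[OF v v', of UNIV x] by auto
  have "integral {0..x} w * integral {0..x} v =
      integral {0..x} (\<lambda>s. w s * integral {0..s} v) + integral {0..x} (\<lambda>s. v s * integral {0..s} w)"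
    using Fubini_by_parts[OF w'(1) v'(1)] half[OF w w' v v' _ m1] half[OF v v' w w' _ m2]
    unfolding t by simp
  also have "\<dots> = integral {0..x} (\<lambda>s. w s * integral {0..s} v + v s * integral {0..s} w)"
    using integrable_continuous_times[OF cont(1) v] integrable_continuous_times[OF cont(2) w]
    by (intro Henstock_Kurzweil_Integration.integral_add[symmetric] integrable_on_of_lebesgue_ivl) (auto simp: mult.commute)
  finally show ?thesis .
qed

lemma primitive_eq:
  assumes "primitive R f w" "x \<in> {0..R}"
  shows "f x = f 0 + integral {0..x} w"
  using assms unfolding primitive_def by blast

lemma primitive_integrable:
  assumes "primitive R f w"
  shows "integrable (lebesgue_on {0..R}) w"
  using assms unfolding primitive_def by blast

lemma primitive_continuous:
  assumes "primitive R f w"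
  shows "continuous_on {0..R} f"
proof -
  have "continuous_on {0..R} (\<lambda>x. f 0 + integral {0..x} w)"
    using assms unfolding primitive_def
    by (intro continuous_intros indefinite_integral_continuous_1 integrable_on_of_lebesgue_ivl) auto
  then show ?thesis using assms unfolding primitive_def by (metis (no_types, lifting) continuous_on_cong)
qed

lemma primitive_increment:
  assumes "primitive R f w" "0 \<le> x" "x \<le> y" "y \<le> R"
  shows "f y - f x = integral {x..y} w"
proof -
  have "w integrable_on {0..y}"
    using assms integrable_lebesgue_on_subset_ivl[of 0 R w 0 y]
    by (auto simp: primitive_def intro: integrable_on_of_lebesgue_ivl)
  then have "integral {0..x} w + integral {x..y} w = integral {0..y} w"
    using assms by (intro Henstock_Kurzweil_Integration.integral_combine) auto
  moreover have "f x = f 0 + integral {0..x} w" "f y = f 0 + integral {0..y} w"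
    using primitive_eq[OF assms(1), of x] primitive_eq[OF assms(1), of y] assms(2-) by auto
  ultimately show ?thesis by linarith
qed

text \<open>The initial values contribute terms linear in the densities; what remains is a product
  of two primitives vanishing at 0, which \<open>integral_parts_primitives\<close> covers.\<close>

lemma primitive_mult:
  assumes f: "primitive R f w" and g: "primitive R g v"
  shows "primitive R (\<lambda>x. f x * g x) (\<lambda>x. w x * g x + v x * f x)"
  unfolding primitive_def
proof (intro conjI ballI)
  have w: "integrable (lebesgue_on {0..R}) w" and v: "integrable (lebesgue_on {0..R}) v"
    using f g by (auto simp: primitive_def)
  show "integrable (lebesgue_on {0..R}) (\<lambda>x. w x * g x + v x * f x)"
    using integrable_continuous_times[OF primitive_continuous[OF g] w]
      integrable_continuous_times[OF primitive_continuous[OF f] v]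
    by (intro Bochner_Integration.integrable_add) (auto simp: mult.commute)
  fix x assume x: "x \<in> {0..R}"
  have wx: "integrable (lebesgue_on {0..x}) w" and vx: "integrable (lebesgue_on {0..x}) v"
    using integrable_lebesgue_on_subset_ivl[OF w] integrable_lebesgue_on_subset_ivl[OF v] x by auto
  define W V where "W = (\<lambda>s. integral {0..s} w)" and "V = (\<lambda>s. integral {0..s} v)"
  have c: "continuous_on {0..x} W" "continuous_on {0..x} V"
    unfolding W_def V_def using wx vx
    by (auto intro!: indefinite_integral_continuous_1 integrable_on_of_lebesgue_ivl)
  have fg: "f s = f 0 + W s" "g s = g 0 + V s" if "s \<in> {0..x}" for s
    unfolding W_def V_def using that x
    by (intro primitive_eq[OF f] primitive_eq[OF g]; simp)+
  have i: "(\<lambda>s. w s * V s + v s * W s) integrable_on {0..x}"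
    using integrable_continuous_times[OF c(1) vx] integrable_continuous_times[OF c(2) wx]
    by (intro integrable_on_of_lebesgue_ivl Bochner_Integration.integrable_add) (auto simp: mult.commute)
  have wi: "w integrable_on {0..x}" "v integrable_on {0..x}"
    using wx vx by (auto intro: integrable_on_of_lebesgue_ivl)
  have "integral {0..x} (\<lambda>s. w s * g s + v s * f s) =
      integral {0..x} (\<lambda>s. (g 0 * w s + f 0 * v s) + (w s * V s + v s * W s))"
  proof (intro Henstock_Kurzweil_Integration.integral_cong)
    fix s assume "s \<in> {0..x}"
    from fg(1)[OF this] fg(2)[OF this]
    show "w s * g s + v s * f s = (g 0 * w s + f 0 * v s) + (w s * V s + v s * W s)"
      by algebra
  qed
  also have "\<dots> = g 0 * W x + f 0 * V x + W x * V x"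
    unfolding W_def V_def integral_parts_primitives[OF wx vx]
  proof -
    have gw: "(\<lambda>s. g 0 * w s) integrable_on {0..x}" "(\<lambda>s. f 0 * v s) integrable_on {0..x}"
      using wi by (auto intro!: integrable_on_mult_right)
    show "integral {0..x} (\<lambda>s. (g 0 * w s + f 0 * v s) +
        (w s * integral {0..s} v + v s * integral {0..s} w)) =
      g 0 * integral {0..x} w + f 0 * integral {0..x} v +
        integral {0..x} (\<lambda>s. w s * integral {0..s} v + v s * integral {0..s} w)"
      using i[unfolded W_def V_def] gw
      by (simp add: Henstock_Kurzweil_Integration.integral_add integrable_add)
  qed
  finally have eq: "integral {0..x} (\<lambda>s. w s * g s + v s * f s) = g 0 * W x + f 0 * V x + W x * V x" .
  have "f x * g x = (f 0 + W x) * (g 0 + V x)" using fg[of x] x by auto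
  then show "f x * g x = f 0 * g 0 + integral {0..x} (\<lambda>s. w s * g s + v s * f s)"
    unfolding eq by (simp add: algebra_simps)
qed

lemma primitive_add:
  assumes f: "primitive R f w" and g: "primitive R g v"
  shows "primitive R (\<lambda>x. f x + g x) (\<lambda>x. w x + v x)"
  unfolding primitive_def
proof (intro conjI ballI)
  have w: "integrable (lebesgue_on {0..R}) w" and v: "integrable (lebesgue_on {0..R}) v"
    using f g by (auto simp: primitive_integrable)
  then show "integrable (lebesgue_on {0..R}) (\<lambda>x. w x + v x)" by simp
  fix x assume x: "x \<in> {0..R}"
  have "w integrable_on {0..x}" "v integrable_on {0..x}"
    using integrable_lebesgue_on_subset_ivl[OF w] integrable_lebesgue_on_subset_ivl[OF v] x
    by (auto intro: integrable_on_of_lebesgue_ivl)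
  then have "integral {0..x} (\<lambda>s. w s + v s) = integral {0..x} w + integral {0..x} v"
    by (rule Henstock_Kurzweil_Integration.integral_add)
  then show "f x + g x = f 0 + g 0 + integral {0..x} (\<lambda>s. w s + v s)"
    using primitive_eq[OF f x] primitive_eq[OF g x] by linarith
qed

lemma primitive_cmult:
  assumes f: "primitive R f w"
  shows "primitive R (\<lambda>x. c * f x) (\<lambda>x. c * w x)"
  unfolding primitive_def
proof (intro conjI ballI)
  show "integrable (lebesgue_on {0..R}) (\<lambda>x. c * w x)"
    using primitive_integrable[OF f] by simp
  fix x assume "x \<in> {0..R}"
  from primitive_eq[OF f this] have "c * f x = c * (f 0 + integral {0..x} w)" by (rule arg_cong)
  then show "c * f x = c * f 0 + integral {0..x} (\<lambda>s. c * w s)" by (simp add: algebra_simps)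
qed

lemma primitive_C1:
  assumes "\<And>x. x \<in> {0..R} \<Longrightarrow> (f has_field_derivative f' x) (at x within {0..R})"
    and "continuous_on {0..R} f'"
  shows "primitive R f f'"
  unfolding primitive_def
proof (intro conjI ballI)
  show "integrable (lebesgue_on {0..R}) f'" by (rule continuous_imp_integrable_real[OF assms(2)])
  fix x assume x: "x \<in> {0..R}"
  have "(f' has_integral (f x - f 0)) {0..x}"
  proof (rule fundamental_theorem_of_calculus)
    show "0 \<le> x" using x by auto
    fix y assume "y \<in> {0..x}"
    then have "(f has_field_derivative f' y) (at y within {0..x})"
      using assms(1)[of y] x by (auto intro: DERIV_subset)
    then show "(f has_vector_derivative f' y) (at y within {0..x})"
      by (simp add: has_real_derivative_iff_has_vector_derivative)
  qed
  then show "f x = f 0 + integral {0..x} f'" by (simp add: integral_unique)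
qed

lemma primitive_integral:
  assumes "integrable (lebesgue_on {0..R}) w"
  shows "primitive R (\<lambda>x. integral {0..x} w) w"
  using assms by (simp add: primitive_def)

section \<open>Vanishing almost everywhere from vanishing integrals\<close>

lemma AE_zero_lborel_of_boxes:
  fixes f :: "'a::euclidean_space \<Rightarrow> real"
  assumes f: "integrable lborel f" and tot: "(\<integral>x. f x \<partial>lborel) = 0"
    and box: "\<And>c d. (LINT x:box c d|lborel. f x) = 0"
  shows "AE x in lborel. f x = 0"
proof (rule sigma_finite_measure.density_zero[OF sigma_finite_lborel f])
  let ?G = "range (\<lambda>(a, b). box a b :: 'a set)"
  have si: "set_integrable lborel A f" if "A \<in> sets borel" for A
    unfolding set_integrable_def using f that by (intro integrable_mult_indicator) auto
  fix A :: "'a set" assume "A \<in> sets lborel"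
  then have A: "A \<in> sigma_sets UNIV ?G"
    by (simp add: borel_eq_box)
  \<comment> \<open>Open boxes are an intersection-stable generator of the Borel sets, so vanishing
    integrals spread by Dynkin induction; the complement case is where the total integral
    enters.\<close>
  have "Int_stable ?G"
    by (auto simp: Int_stable_def box_Int_box)
  moreover have "?G \<subseteq> Pow UNIV" by simp
  ultimately show "(LINT x:A|lborel. f x) = 0" using A
  proof (induction rule: sigma_sets_induct_disjoint)
    case (basic A)
    then show ?case using box by auto
  next
    case (compl A)
    have A: "A \<in> sets borel" using compl(1) by (simp add: borel_eq_box)
    have "(LINT x:A \<union> (UNIV - A)|lborel. f x) = (LINT x:A|lborel. f x) + (LINT x:UNIV - A|lborel. f x)"
      using A by (intro set_integral_Un si) auto
    then show ?case using compl tot by (simp add: set_lebesgue_integral_def)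
  next
    case (union A)
    have A: "A i \<in> sets borel" for i using union(2) by (auto simp: borel_eq_box)
    have "(LINT x:(\<Union>i. A i)|lborel. f x) = (\<Sum>i. (LINT x:(A i)|lborel. f x))"
      using A union(1) by (intro lebesgue_integral_countable_add si) (auto simp: disjoint_family_on_def)
    then show ?case using union(3) by simp
  qed (auto simp: set_lebesgue_integral_def)
qed

lemma AE_zero_lebesgue_of_boxes:
  fixes f :: "'a::euclidean_space \<Rightarrow> real"
  assumes f: "integrable lebesgue f" and tot: "(\<integral>x. f x \<partial>lebesgue) = 0"
    and box: "\<And>c d. (LINT x:box c d|lebesgue. f x) = 0"
  shows "AE x in lebesgue. f x = 0"
proof -
  obtain g where g: "g \<in> borel_measurable lborel" "AE x in lborel. f x = g x"
    using completion_ex_borel_measurable_real[of f lborel] f by auto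
  have ae: "AE x in lebesgue. f x = g x" using g(2) by (rule AE_completion)
  have gm: "g \<in> borel_measurable lebesgue" using g(1) by (rule measurable_completion)
  have gi: "integrable lebesgue g" using f ae gm integrable_cong_AE_imp by metis
  have "AE x in lborel. g x = 0"
  proof (rule AE_zero_lborel_of_boxes)
    show "integrable lborel g" using gi g(1) integrable_completion by metis
    have "(\<integral>x. g x \<partial>lborel) = (\<integral>x. g x \<partial>lebesgue)" using g(1) by (rule integral_completion[symmetric])
    also have "\<dots> = (\<integral>x. f x \<partial>lebesgue)"
      using ae f gm by (intro integral_cong_AE) auto
    finally show "(\<integral>x. g x \<partial>lborel) = 0" using tot by simp
    fix c d
    have "(LINT x:box c d|lborel. g x) = (LINT x:box c d|lebesgue. g x)"
      unfolding set_lebesgue_integral_def using g(1) by (intro integral_completion[symmetric]) auto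
    also have "\<dots> = (LINT x:box c d|lebesgue. f x)"
      using ae f gm by (intro set_lebesgue_integral_cong_AE) auto
    finally show "(LINT x:box c d|lborel. g x) = 0" using box by simp
  qed
  then have "AE x in lebesgue. g x = 0" by (rule AE_completion)
  with ae show ?thesis by eventually_elim simp
qed

text \<open>Subtraction gives zero integrals over all subintervals, hence over all boxes. A density
  is thus determined almost everywhere by its primitive, which later identifies a lifted profile
  with the density it came from.\<close>

lemma AE_zero_of_primitive_zero:
  fixes w :: "real \<Rightarrow> real"
  assumes w: "integrable (lebesgue_on {0..R}) w"
    and z: "\<And>x. x \<in> {0..R} \<Longrightarrow> integral {0..x} w = 0"
  shows "AE x in lebesgue_on {0..R}. w x = 0"
proof (cases "R \<ge> 0")
  case True
  define f where "f = (\<lambda>x. indicator {0..R} x * w x)"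
  have f: "integrable lebesgue f"
    using w by (simp add: f_def integrable_restrict_space)
  then have [measurable]: "f \<in> borel_measurable lebesgue" by auto
  have zero: "integral {c..d} w = 0" if "0 \<le> c" "d \<le> R" for c d
  proof (cases "c \<le> d")
    case cd: True
    have "integral {0..d} w - integral {0..c} w = integral {c..d} w"
      using primitive_increment[OF primitive_integral[OF w], of c d] that cd by simp
    then show ?thesis using z[of c] z[of d] that cd by auto
  qed simp
  have "AE x in lebesgue. f x = 0"
  proof (rule AE_zero_lebesgue_of_boxes[OF f])
    have "(\<integral>x. f x \<partial>lebesgue) = (LINT x|lebesgue_on {0..R}. w x)"
      by (simp add: f_def integral_restrict_space)
    then show "(\<integral>x. f x \<partial>lebesgue) = 0"
      using integral_lebesgue_on_ivl[OF w] zero[of 0 R] by simp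
    fix c d :: real
    let ?c = "max c 0" and ?d = "min d R"
    have "AE x in lebesgue. x \<noteq> c" "AE x in lebesgue. x \<noteq> d"
      by (auto intro: AE_completion AE_lborel_singleton)
    then have "AE x in lebesgue. indicator (box c d) x *\<^sub>R f x = indicator {?c..?d} x * w x"
      by eventually_elim (auto simp: f_def indicator_def box_real)
    moreover have i: "integrable (lebesgue_on {?c..?d}) w"
      by (rule integrable_lebesgue_on_subset_ivl[OF w]) auto
    ultimately have "(LINT x:box c d|lebesgue. f x) = (\<integral>x. indicator {?c..?d} x * w x \<partial>lebesgue)"
      unfolding set_lebesgue_integral_def
    proof (intro integral_cong_AE)
      show "(\<lambda>x. indicator (box c d) x *\<^sub>R f x) \<in> borel_measurable lebesgue"
        by (intro borel_measurable_scaleR borel_measurable_indicator) auto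
    qed (use i in \<open>auto simp: integrable_restrict_space dest: borel_measurable_integrable\<close>)
    also have "\<dots> = (LINT x|lebesgue_on {?c..?d}. w x)"
      by (simp add: integral_restrict_space)
    also have "\<dots> = 0" using integral_lebesgue_on_ivl[OF i] zero[of ?c ?d] by simp
    finally show "(LINT x:box c d|lebesgue. f x) = 0" .
  qed
  then show ?thesis
    by (subst AE_restrict_space_iff) (auto simp: f_def indicator_def)
qed (auto intro!: AE_I2)

section \<open>Test functions\<close>

lemma Ck_on_imp_continuous: "Ck_on n U f \<Longrightarrow> continuous_on U f"
  by (cases n) (auto intro!: continuous_at_imp_continuous_on dest: has_derivative_continuous)

lemma Ck_on_SucD: "Ck_on (Suc n) U f \<Longrightarrow> Ck_on n U f"
proof (induction n arbitrary: f)
  case 0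
  then show ?case using Ck_on_imp_continuous[of "Suc 0" U f] by simp
next
  case (Suc n)
  from Suc.prems obtain f' where f': "\<forall>x\<in>U. (f has_derivative f' x) (at x)"
      "\<forall>v. Ck_on (Suc n) U (\<lambda>x. f' x v)"
    by (subst (asm) Ck_on.simps) blast
  have "\<forall>v. Ck_on n U (\<lambda>x. f' x v)" using f'(2) Suc.IH by blast
  then show ?case using f'(1) by auto
qed

lemma Ck_on_const: "Ck_on n U (\<lambda>x. c)"
proof (induction n arbitrary: c)
  case (Suc n)
  show ?case unfolding Ck_on.simps
    by (rule exI[of _ "\<lambda>x v. 0"]) (simp add: Suc)
qed simp

lemma Ck_on_inner: "Ck_on n U (\<lambda>x. x \<bullet> i)"
proof (cases n)
  case (Suc m)
  show ?thesis unfolding Suc Ck_on.simps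
    by (rule exI[of _ "\<lambda>x v. v \<bullet> i"]) (auto intro!: Ck_on_const derivative_eq_intros)
qed (auto intro!: continuous_intros)

lemma Ck_on_SucE:
  assumes "Ck_on (Suc n) U f"
  obtains f' where "\<And>x. x \<in> U \<Longrightarrow> (f has_derivative f' x) (at x)" "\<And>v. Ck_on n U (\<lambda>x. f' x v)"
  using assms by auto

lemma Ck_on_add: "Ck_on n U f \<Longrightarrow> Ck_on n U g \<Longrightarrow> Ck_on n U (\<lambda>x. f x + g x)"
proof (induction n arbitrary: f g)
  case (Suc n)
  obtain f' where f': "\<And>x. x \<in> U \<Longrightarrow> (f has_derivative f' x) (at x)" "\<And>v. Ck_on n U (\<lambda>x. f' x v)"
    using Ck_on_SucE[OF Suc.prems(1)] by blast
  obtain g' where g': "\<And>x. x \<in> U \<Longrightarrow> (g has_derivative g' x) (at x)" "\<And>v. Ck_on n U (\<lambda>x. g' x v)"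
    using Ck_on_SucE[OF Suc.prems(2)] by blast
  show ?case unfolding Ck_on.simps
    by (rule exI[of _ "\<lambda>x v. f' x v + g' x v"]) (auto intro!: Suc.IH f' g' derivative_intros)
qed (auto intro: continuous_intros)

lemma Ck_on_mult: "Ck_on n U f \<Longrightarrow> Ck_on n U g \<Longrightarrow> Ck_on n U (\<lambda>x. f x * g x)"
proof (induction n arbitrary: f g)
  case (Suc n)
  obtain f' where f': "\<And>x. x \<in> U \<Longrightarrow> (f has_derivative f' x) (at x)" "\<And>v. Ck_on n U (\<lambda>x. f' x v)"
    using Ck_on_SucE[OF Suc.prems(1)] by blast
  obtain g' where g': "\<And>x. x \<in> U \<Longrightarrow> (g has_derivative g' x) (at x)" "\<And>v. Ck_on n U (\<lambda>x. g' x v)"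
    using Ck_on_SucE[OF Suc.prems(2)] by blast
  have "Ck_on n U f" "Ck_on n U g"
    using Ck_on_SucD[OF Suc.prems(1)] Ck_on_SucD[OF Suc.prems(2)] .
  then show ?case unfolding Ck_on.simps
    by (intro exI[of _ "\<lambda>x v. f x * g' x v + f' x v * g x"])
      (auto intro!: Ck_on_add Suc.IH f' g' derivative_intros)
qed (auto intro: continuous_intros)

lemma Ck_on_prod: "(\<And>i. i \<in> I \<Longrightarrow> Ck_on n U (f i)) \<Longrightarrow> Ck_on n U (\<lambda>x. \<Prod>i\<in>I. f i x)"
  by (induction I rule: infinite_finite_induct) (auto intro: Ck_on_const Ck_on_mult)

lemma Ck_on_compose:
  fixes g :: "real \<Rightarrow> real"
  shows "Ck_on n UNIV g \<Longrightarrow> Ck_on n U f \<Longrightarrow> Ck_on n U (\<lambda>x. g (f x))"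
proof (induction n arbitrary: f g)
  case 0
  then show ?case by (auto intro: continuous_on_compose2)
next
  case (Suc n)
  obtain f' where f': "\<And>x. x \<in> U \<Longrightarrow> (f has_derivative f' x) (at x)" "\<And>v. Ck_on n U (\<lambda>x. f' x v)"
    using Ck_on_SucE[OF Suc.prems(2)] by blast
  obtain g' where g': "\<And>x. (g has_derivative g' x) (at x)" "\<And>v. Ck_on n UNIV (\<lambda>x. g' x v)"
    using Suc.prems(1) unfolding Ck_on.simps by (metis UNIV_I)
  \<comment> \<open>A linear map of the line is multiplication by its value at 1. This turns the
    chain rule into a product, the form that \<open>Ck_on_mult\<close> handles.\<close>
  have lin: "g' y s = s * g' y 1" for y s
    using linear_scale[OF has_derivative_linear[OF g'(1)[of y]], of s 1] by simp
  have "((\<lambda>x. g (f x)) has_derivative (\<lambda>v. f' x v * g' (f x) 1)) (at x)" if "x \<in> U" for x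
  proof -
    have "g' (f x) \<circ> f' x = (\<lambda>v. f' x v * g' (f x) 1)"
      unfolding o_def by (intro ext lin)
    then show ?thesis
      using diff_chain_at[OF f'(1)[OF that] g'(1)[of "f x"]] by (simp only: o_def)
  qed
  moreover have "Ck_on n U (\<lambda>x. f' x v * g' (f x) 1)" for v
    by (rule Ck_on_mult[OF f'(2) Suc.IH[OF g'(2) Ck_on_SucD[OF Suc.prems(2)]]])
  ultimately show ?case unfolding Ck_on.simps
    by (intro exI[of _ "\<lambda>x v. f' x v * g' (f x) 1"]) auto
qed

text \<open>For \<open>k = 0\<close> this is the classical smooth function
  \<open>exp (- 1 / x)\<close> glued to zero. The extra powers make the linear span of the family
  closed under differentiation, so one induction proves smoothness of all members.\<close>

definition flat :: "nat \<Rightarrow> real \<Rightarrow> real" where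
  "flat k x = (if x > 0 then inverse x ^ k * exp (- inverse x) else 0)"

lemma flat_tendsto_0: "(flat k \<longlongrightarrow> 0) (at 0)"
proof -
  have "((\<lambda>x. inverse x ^ k / exp (inverse x)) \<longlongrightarrow> (0::real)) (at_right 0)"
    by (rule filterlim_compose[OF tendsto_power_div_exp_0 filterlim_inverse_at_top_right])
  moreover have "\<forall>\<^sub>F x in at_right 0. inverse x ^ k / exp (inverse x) = flat k x"
    using eventually_at_right_less[of 0]
    by eventually_elim (simp add: flat_def exp_minus field_simps)
  ultimately have "(flat k \<longlongrightarrow> 0) (at_right 0)"
    by (rule Lim_transform_eventually)
  moreover have "(flat k \<longlongrightarrow> 0) (at_left 0)"
    by (rule tendsto_eventually) (auto simp: flat_def eventually_at_filter)
  ultimately show ?thesis by (simp add: filterlim_split_at)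
qed

lemma flat_has_derivative:
  "(flat k has_real_derivative (flat (Suc (Suc k)) x - real k * flat (Suc k) x)) (at x)"
proof (cases x "0::real" rule: linorder_cases)
  case less
  have "((\<lambda>x. 0) has_real_derivative 0) (at x)" by simp
  then have "(flat k has_real_derivative 0) (at x)"
    by (rule has_field_derivative_transform_within_open[of _ _ _ "{..<0}"]) (use less in \<open>auto simp: flat_def\<close>)
  then show ?thesis using less by (simp add: flat_def)
next
  case equal
  \<comment> \<open>At the origin the difference quotient of \<open>flat k\<close> is
    \<open>flat (Suc k)\<close>, which tends to 0.\<close>
  have "((\<lambda>y. (flat k y - flat k 0) / (y - 0)) \<longlongrightarrow> 0) (at 0)"
  proof (rule Lim_transform_eventually[OF flat_tendsto_0[of "Suc k"]])
    show "\<forall>\<^sub>F y in at 0. flat (Suc k) y = (flat k y - flat k 0) / (y - 0)"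
      by (rule eventually_at_filter[THEN iffD2]) (auto simp: flat_def field_simps)
  qed
  then show ?thesis using equal
    by (simp add: has_field_derivative_iff flat_def)
next
  case greater
  have "((\<lambda>x. inverse x ^ k * exp (- inverse x)) has_real_derivative
     (real k * inverse x ^ (k - 1) * (- ((inverse x)\<^sup>2)) * exp (- inverse x) +
       inverse x ^ k * (exp (- inverse x) * (inverse x)\<^sup>2))) (at x)"
    using greater by (auto intro!: derivative_eq_intros simp: power2_eq_square)
  moreover have "real k * inverse x ^ (k - 1) * (- ((inverse x)\<^sup>2)) * exp (- inverse x) +
       inverse x ^ k * (exp (- inverse x) * (inverse x)\<^sup>2) = flat (Suc (Suc k)) x - real k * flat (Suc k) x"
    using greater by (cases k) (simp_all add: flat_def power2_eq_square algebra_simps)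
  ultimately have "((\<lambda>x. inverse x ^ k * exp (- inverse x)) has_real_derivative
     (flat (Suc (Suc k)) x - real k * flat (Suc k) x)) (at x)" by simp
  then show ?thesis
    by (rule has_field_derivative_transform_within_open[of _ _ _ "{0<..}"]) (use greater in \<open>auto simp: flat_def\<close>)
qed

lemma Ck_on_flat: "Ck_on n UNIV (flat k)"
proof (induction n arbitrary: k)
  case 0
  then show ?case
    by (auto intro!: continuous_at_imp_continuous_on DERIV_isCont flat_has_derivative)
next
  case (Suc n)
  show ?case unfolding Ck_on.simps
  proof (intro exI conjI ballI allI)
    fix x v
    show "(flat k has_derivative (\<lambda>v. v * (flat (Suc (Suc k)) x + (- real k) * flat (Suc k) x))) (at x)"
      using flat_has_derivative[of k x] by (simp add: has_field_derivative_def mult_commute_abs)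
    show "Ck_on n UNIV (\<lambda>x. v * (flat (Suc (Suc k)) x + (- real k) * flat (Suc k) x))"
      by (intro Ck_on_mult Ck_on_add Ck_on_const Suc)
  qed
qed

text \<open>The parameter \<open>n\<close> does not move the support: it rescales the argument of
  \<open>flat 0\<close>, so that the values inside the box tend to 1 while the function stays zero
  outside. The limit is the indicator of the open box.\<close>

definition box_bump :: "nat \<Rightarrow> 'a::euclidean_space \<Rightarrow> 'a \<Rightarrow> 'a \<Rightarrow> real" where
  "box_bump n a b x =
     (\<Prod>i\<in>Basis. flat 0 (real n * (x \<bullet> i - a \<bullet> i)) * flat 0 (real n * (b \<bullet> i - x \<bullet> i)))"

lemma flat0_bounds: "0 \<le> flat 0 x" "flat 0 x \<le> 1"
  by (auto simp: flat_def)

lemma box_bump_bounds: "0 \<le> box_bump n a b x" "box_bump n a b x \<le> 1"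
  unfolding box_bump_def
  by (auto intro!: prod_nonneg prod_le_1 mult_nonneg_nonneg mult_le_one flat0_bounds)

lemma box_bump_outside: "x \<notin> box a b \<Longrightarrow> box_bump n a b x = 0"
  unfolding box_bump_def mem_box by (auto simp: flat_def mult_less_0_iff zero_less_mult_iff intro!: prod_zero)

lemma box_bump_test:
  assumes "cbox a b \<subseteq> U"
  shows "box_bump n a b \<in> test_functions U"
proof -
  have "Ck_on m UNIV (box_bump n a b)" for m
  proof -
    have "Ck_on m UNIV (\<lambda>x. \<Prod>i\<in>Basis. flat 0 (real n * (x \<bullet> i + (- (a \<bullet> i)))) * flat 0 (real n * (b \<bullet> i + (-1) * (x \<bullet> i))))"
      by (intro Ck_on_prod Ck_on_mult Ck_on_compose[OF Ck_on_flat] Ck_on_add Ck_on_const Ck_on_inner)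
    then show ?thesis by (simp add: box_bump_def[abs_def])
  qed
  moreover have "\<forall>x. x \<notin> cbox a b \<longrightarrow> box_bump n a b x = 0"
    using box_bump_outside box_subset_cbox by blast
  ultimately show ?thesis using assms unfolding test_functions_def
    by (intro CollectI conjI allI exI[of _ "cbox a b"]) auto
qed

lemma box_bump_pos: "x \<in> box a b \<Longrightarrow> n > 0 \<Longrightarrow> box_bump n a b x > 0"
  unfolding box_bump_def mem_box by (intro prod_pos) (auto simp: flat_def)

lemma box_bump_tendsto: "(\<lambda>n. box_bump n a b x) \<longlonglongrightarrow> indicator (box a b) x"
proof (cases "x \<in> box a b")
  case True
  have flat: "(\<lambda>n. flat 0 (real n * s)) \<longlonglongrightarrow> 1" if "s > 0" for s
  proof -
    have "(\<lambda>n. exp (- (inverse s * inverse (real n)))) \<longlonglongrightarrow> exp (- (inverse s * 0))"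
      by (intro tendsto_intros lim_inverse_n)
    then have "(\<lambda>n. exp (- (inverse s * inverse (real n)))) \<longlonglongrightarrow> 1" by simp
    moreover have "\<forall>\<^sub>F n in sequentially. exp (- (inverse s * inverse (real n))) = flat 0 (real n * s)"
      using eventually_gt_at_top[of 0] by eventually_elim (use that in \<open>auto simp: flat_def\<close>)
    ultimately show ?thesis by (rule Lim_transform_eventually)
  qed
  have "(\<lambda>n. box_bump n a b x) \<longlonglongrightarrow> (\<Prod>i\<in>(Basis::'a set). 1 * 1)"
    unfolding box_bump_def using True by (intro tendsto_prod tendsto_mult flat) (auto simp: mem_box)
  then show ?thesis using True by simp
next
  case False
  then show ?thesis by (simp add: box_bump_outside)
qed

lemma test_function_continuous: "\<phi> \<in> test_functions U \<Longrightarrow> continuous_on UNIV \<phi>"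
  unfolding test_functions_def by (auto dest!: spec[of _ 0])

lemma test_function_derivative:
  assumes "\<phi> \<in> test_functions U"
  shows "(\<phi> has_derivative frechet_derivative \<phi> (at x)) (at x)"
    "(\<lambda>x. frechet_derivative \<phi> (at x) v) \<in> test_functions U"
proof -
  have C: "Ck_on n UNIV \<phi>" for n using assms by (auto simp: test_functions_def)
  obtain d0 where d0: "\<forall>x. (\<phi> has_derivative d0 x) (at x)"
    using C[of "Suc 0"] unfolding Ck_on.simps by auto
  show D: "(\<phi> has_derivative frechet_derivative \<phi> (at x)) (at x)" for x
    using d0 frechet_derivative_at[OF d0[rule_format, of x]] by metis
  have "Ck_on n UNIV (\<lambda>x. frechet_derivative \<phi> (at x) v)" for n
  proof -
    obtain d where d: "\<forall>x. (\<phi> has_derivative d x) (at x)" "\<forall>v. Ck_on n UNIV (\<lambda>x. d x v)"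
      using C[of "Suc n"] unfolding Ck_on.simps by auto
    have "frechet_derivative \<phi> (at x) = d x" for x
      using frechet_derivative_at[OF d(1)[rule_format, of x]] by metis
    then show ?thesis using d(2) by simp
  qed
  moreover obtain K where K: "compact K" "K \<subseteq> U" "\<And>x. x \<notin> K \<Longrightarrow> \<phi> x = 0"
    using assms by (auto simp: test_functions_def)
  moreover have "frechet_derivative \<phi> (at x) v = 0" if "x \<notin> K" for x
  proof -
    have "((\<lambda>x. 0) has_derivative (\<lambda>v. 0)) (at x)" by simp
    then have "(\<phi> has_derivative (\<lambda>v. 0)) (at x)"
      by (rule has_derivative_transform_within_open[of _ _ _ _ "- K"])
        (use that K in \<open>auto simp: compact_imp_closed open_Compl\<close>)
    from frechet_derivative_at[OF this] show ?thesis by metis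
  qed
  ultimately show "(\<lambda>x. frechet_derivative \<phi> (at x) v) \<in> test_functions U"
    unfolding test_functions_def by (intro CollectI conjI allI exI[of _ K]) auto
qed

section \<open>Weak derivatives\<close>

lemma integrable_lebesgue_on_support:
  fixes f :: "'a::euclidean_space \<Rightarrow> real"
  assumes "K \<subseteq> U" "K \<in> sets lebesgue" "U \<in> sets lebesgue" and "\<And>x. x \<in> U - K \<Longrightarrow> f x = 0"
  shows "integrable (lebesgue_on U) f \<longleftrightarrow> integrable (lebesgue_on K) f"
    and "(LINT x|lebesgue_on U. f x) = (LINT x|lebesgue_on K. f x)"
proof -
  have "(\<lambda>x. indicator U x *\<^sub>R f x) = (\<lambda>x. indicator K x *\<^sub>R f x)"
    using assms(1,4) by (auto simp: indicator_def fun_eq_iff)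
  then show "integrable (lebesgue_on U) f \<longleftrightarrow> integrable (lebesgue_on K) f"
    and "(LINT x|lebesgue_on U. f x) = (LINT x|lebesgue_on K. f x)"
    using assms(2,3) by (simp_all add: integrable_restrict_space integral_restrict_space)
qed

lemma integrable_locally_integrable_times:
  fixes w \<phi> :: "'a::euclidean_space \<Rightarrow> real"
  assumes w: "locally_integrable_on w U" and U: "U \<in> sets lebesgue" and \<phi>: "\<phi> \<in> test_functions U"
  shows "integrable (lebesgue_on U) (\<lambda>x. w x * \<phi> x)"
proof -
  obtain K where K: "compact K" "K \<subseteq> U" "\<And>x. x \<notin> K \<Longrightarrow> \<phi> x = 0"
    using \<phi> by (auto simp: test_functions_def)
  have c: "continuous_on UNIV \<phi>" by (rule test_function_continuous[OF \<phi>])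
  have "bounded (\<phi> ` K)"
    using c K(1) by (meson compact_continuous_image compact_imp_bounded continuous_on_subset top_greatest)
  then obtain B where B: "\<And>x. x \<in> K \<Longrightarrow> \<bar>\<phi> x\<bar> \<le> B" by (force simp: bounded_iff)
  have Kl: "K \<in> sets lebesgue" using K(1) by (simp add: compact_imp_closed borel_closed)
  have [measurable]: "\<phi> \<in> borel_measurable (lebesgue_on K)"
    using c Kl by (intro continuous_imp_measurable_on_sets_lebesgue) (auto intro: continuous_on_subset)
  have wi: "integrable (lebesgue_on K) w" using w K by (auto simp: locally_integrable_on_def)
  then have [measurable]: "w \<in> borel_measurable (lebesgue_on K)" by auto
  have "integrable (lebesgue_on K) (\<lambda>x. w x * \<phi> x)"
  proof (rule Bochner_Integration.integrable_bound)
    show "integrable (lebesgue_on K) (\<lambda>x. B * w x)" using wi by simp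
    show "AE x in lebesgue_on K. norm (w x * \<phi> x) \<le> norm (B * w x)"
    proof (rule AE_I2)
      fix x assume "x \<in> space (lebesgue_on K)"
      then have "\<bar>\<phi> x\<bar> \<le> \<bar>B\<bar>" using B[of x] by auto
      then show "norm (w x * \<phi> x) \<le> norm (B * w x)"
        by (simp add: abs_mult mult.commute mult_right_mono)
    qed
  qed measurable
  moreover have "w x * \<phi> x = 0" if "x \<in> U - K" for x using K(3) that by auto
  ultimately show ?thesis
    using integrable_lebesgue_on_support(1)[of K U "\<lambda>x. w x * \<phi> x"] K(2) Kl U by blast
qed

text \<open>The bumps of one box are bounded by 1 and converge to its indicator, so dominated
  convergence carries the hypothesis from test functions to the box itself.\<close>

lemma fundamental_lemma_box:
  fixes w :: "'a::euclidean_space \<Rightarrow> real"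
  assumes w: "locally_integrable_on w U" and U: "U \<in> sets lebesgue"
    and z: "\<And>\<phi>. \<phi> \<in> test_functions U \<Longrightarrow> (LINT x|lebesgue_on U. w x * \<phi> x) = 0"
    and ab: "cbox a b \<subseteq> U"
  shows "(LINT x|lebesgue_on (cbox a b). w x * indicator (box a b) x) = 0"
proof -
  have wi: "integrable (lebesgue_on (cbox a b)) w"
    using w ab by (auto simp: locally_integrable_on_def)
  then have [measurable]: "w \<in> borel_measurable (lebesgue_on (cbox a b))" by auto
  have bm: "box_bump n a b \<in> borel_measurable (lebesgue_on (cbox a b))" for n
    using test_function_continuous[OF box_bump_test[OF ab]]
    by (intro continuous_imp_measurable_on_sets_lebesgue) (auto intro: continuous_on_subset)
  have "(LINT x|lebesgue_on (cbox a b). w x * box_bump n a b x) = 0" for n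
  proof -
    have "w x * box_bump n a b x = 0" if "x \<in> U - cbox a b" for x
      using box_bump_outside[of x a b n] that box_subset_cbox by auto
    then show ?thesis
      using integrable_lebesgue_on_support(2)[of "cbox a b" U "\<lambda>x. w x * box_bump n a b x"]
        z[OF box_bump_test[OF ab]] ab U by auto
  qed
  moreover have "(\<lambda>n. LINT x|lebesgue_on (cbox a b). w x * box_bump n a b x)
      \<longlonglongrightarrow> (LINT x|lebesgue_on (cbox a b). w x * indicator (box a b) x)"
  proof (rule integral_dominated_convergence)
    show "integrable (lebesgue_on (cbox a b)) (\<lambda>x. \<bar>w x\<bar>)" using wi by simp
    show "AE x in lebesgue_on (cbox a b). (\<lambda>n. w x * box_bump n a b x) \<longlonglongrightarrow> w x * indicator (box a b) x"
      by (intro AE_I2 tendsto_intros box_bump_tendsto)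
    show "AE x in lebesgue_on (cbox a b). norm (w x * box_bump n a b x) \<le> \<bar>w x\<bar>" for n
      using box_bump_bounds[of n a b] by (intro AE_I2) (auto simp: abs_mult mult_left_le)
    show "(\<lambda>x. w x * indicator (box a b) x) \<in> borel_measurable (lebesgue_on (cbox a b))"
      by (intro borel_measurable_times borel_measurable_indicator) (auto simp: sets_restrict_space_iff box_subset_cbox)
    show "(\<lambda>x. w x * box_bump n a b x) \<in> borel_measurable (lebesgue_on (cbox a b))" for n
      using bm by (intro borel_measurable_times) auto
  qed
  ultimately show ?thesis by (simp add: LIMSEQ_const_iff)
qed

text \<open>Since \<open>w\<close> is only locally integrable, the argument is local: inside a
  closed box contained in \<open>U\<close> all integrals over smaller boxes vanish, so
  \<open>w\<close> vanishes there almost everywhere. Faces of boxes are null, and countably many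
  closed boxes exhaust \<open>U\<close>.\<close>

theorem fundamental_lemma_calculus_of_variations:
  fixes w :: "'a::euclidean_space \<Rightarrow> real"
  assumes w: "locally_integrable_on w U" and U: "open U"
    and z: "\<And>\<phi>. \<phi> \<in> test_functions U \<Longrightarrow> (LINT x|lebesgue_on U. w x * \<phi> x) = 0"
  shows "AE x in lebesgue_on U. w x = 0"
proof -
  have Ul: "U \<in> sets lebesgue" using U by auto
  have boxes: "AE x in lebesgue. x \<in> cbox a b \<longrightarrow> w x = 0" if ab: "cbox a b \<subseteq> U" for a b
  proof -
    define f where "f = (\<lambda>x. indicator (box a b) x * w x)"
    have wi: "integrable (lebesgue_on (cbox a b)) w"
      using w ab by (auto simp: locally_integrable_on_def)
    have i: "integrable lebesgue (\<lambda>x. indicator (cbox a b) x *\<^sub>R w x)"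
      using wi by (simp add: integrable_restrict_space)
    have "integrable lebesgue (\<lambda>x. indicator (box a b) x *\<^sub>R (indicator (cbox a b) x *\<^sub>R w x))"
      by (rule integrable_mult_indicator[OF _ i]) simp
    moreover have "(\<lambda>x. indicator (box a b) x *\<^sub>R (indicator (cbox a b) x *\<^sub>R w x)) = f"
      using box_subset_cbox[of a b] by (auto simp: f_def indicator_def fun_eq_iff)
    ultimately have f: "integrable lebesgue f" by simp
    have zero: "(\<integral>x. indicator (box c d) x * w x \<partial>lebesgue) = 0" if cd: "box c d \<subseteq> box a b" for c d
    proof (cases "box c d = {}")
      case False
      then have "cbox c d \<subseteq> cbox a b" using cd
        by (metis closure_box closure_mono box_eq_empty(1) subset_empty)
      then have "cbox c d \<subseteq> U" using ab by blast
      from fundamental_lemma_box[OF w Ul z this]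
      have "(\<integral>x. indicator (cbox c d) x * (w x * indicator (box c d) x) \<partial>lebesgue) = 0"
        by (simp add: integral_restrict_space)
      moreover have "(\<lambda>x. indicator (cbox c d) x * (w x * indicator (box c d) x)) = (\<lambda>x. indicator (box c d) x * w x)"
        using box_subset_cbox[of c d] by (auto simp: indicator_def fun_eq_iff)
      ultimately show ?thesis by simp
    qed simp
    have "AE x in lebesgue. f x = 0"
    proof (rule AE_zero_lebesgue_of_boxes[OF f])
      show "(\<integral>x. f x \<partial>lebesgue) = 0" unfolding f_def by (rule zero) simp
      fix c d :: 'a
      obtain c' d' where cd': "box c d \<inter> box a b = box c' d'" using box_Int_box[of c d a b] by blast
      have "(\<lambda>x. indicator (box c d) x *\<^sub>R f x) = (\<lambda>x. indicator (box c' d') x * w x)"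
        unfolding cd'[symmetric] by (auto simp: f_def indicator_def fun_eq_iff)
      moreover have "box c' d' \<subseteq> box a b" unfolding cd'[symmetric] by auto
      ultimately show "(LINT x:box c d|lebesgue. f x) = 0"
        unfolding set_lebesgue_integral_def using zero[of c' d'] by simp
    qed
    moreover have "AE x in lebesgue. x \<notin> cbox a b - box a b"
      using negligible_frontier_interval[of a b] unfolding negligible_iff_null_sets by (rule AE_not_in)
    ultimately show ?thesis by eventually_elim (auto simp: f_def indicator_def)
  qed
  obtain D where D: "countable D" "D \<subseteq> Pow U" "\<forall>X\<in>D. \<exists>a b. X = cbox a b" "\<Union>D = U"
    by (rule open_countable_Union_open_cbox[OF U]) auto
  have "AE x in lebesgue. \<forall>X\<in>D. x \<in> X \<longrightarrow> w x = 0"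
  proof (subst AE_ball_countable[OF D(1)], intro ballI)
    fix X assume X: "X \<in> D"
    then obtain a b where "X = cbox a b" using D(3) by blast
    then show "AE x in lebesgue. x \<in> X \<longrightarrow> w x = 0" using boxes[of a b] D(2) X by auto
  qed
  then have "AE x in lebesgue. x \<in> U \<longrightarrow> w x = 0"
    by eventually_elim (use D(4) in blast)
  then show ?thesis using Ul by (subst AE_restrict_space_iff) auto
qed

lemma has_weak_deriv_unique:
  fixes u :: "'a::euclidean_space \<Rightarrow> real"
  assumes U: "open U" and 1: "has_weak_deriv U u v w1" and 2: "has_weak_deriv U u v w2"
  shows "AE x in lebesgue_on U. w1 x = w2 x"
proof -
  have Ul: "U \<in> sets lebesgue" using U by auto
  have l: "locally_integrable_on w1 U" "locally_integrable_on w2 U"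
    using 1 2 by (auto simp: has_weak_deriv_def)
  have "AE x in lebesgue_on U. w1 x - w2 x = 0"
  proof (rule fundamental_lemma_calculus_of_variations[OF _ U])
    show "locally_integrable_on (\<lambda>x. w1 x - w2 x) U"
      using l by (auto simp: locally_integrable_on_def)
    fix \<phi> :: "'a \<Rightarrow> real" assume \<phi>: "\<phi> \<in> test_functions U"
    have "(LINT x|lebesgue_on U. w1 x * \<phi> x) = (LINT x|lebesgue_on U. w2 x * \<phi> x)"
      using 1 2 \<phi> unfolding has_weak_deriv_def by force
    then show "(LINT x|lebesgue_on U. (w1 x - w2 x) * \<phi> x) = 0"
      using integrable_locally_integrable_times[OF l(1) Ul \<phi>] integrable_locally_integrable_times[OF l(2) Ul \<phi>]
      by (simp add: left_diff_distrib)
  qed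
  then show ?thesis by eventually_elim simp
qed

text \<open>This makes the arbitrary choice in \<open>weak_deriv\<close> harmless: under an integral
  the chosen representative may be replaced by any weak derivative at hand, in particular by a
  classical one.\<close>

lemma AE_weak_deriv:
  fixes u :: "'a::euclidean_space \<Rightarrow> real"
  assumes "open U" "has_weak_deriv U u v w"
  shows "AE x in lebesgue_on U. weak_deriv U u v x = w x"
    and "has_weak_deriv U u v (weak_deriv U u v)"
proof -
  show "has_weak_deriv U u v (weak_deriv U u v)"
    unfolding weak_deriv_def using assms(2) by (rule someI[of "has_weak_deriv U u v"])
  then show "AE x in lebesgue_on U. weak_deriv U u v x = w x"
    using has_weak_deriv_unique[OF assms(1) _ assms(2)] by blast
qed

text \<open>By translation invariance every difference quotient has integral zero. The mean value
  theorem bounds the quotients uniformly on a fixed compact set, and dominated convergence gives the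
  derivative, for any direction and without iterated integrals.\<close>

lemma integral_directional_derivative_zero:
  fixes \<psi> :: "'a::euclidean_space \<Rightarrow> real"
  assumes d: "\<And>x. (\<psi> has_derivative \<psi>' x) (at x)" and c: "continuous_on UNIV (\<lambda>x. \<psi>' x v)"
    and K: "compact K" "\<And>x. x \<notin> K \<Longrightarrow> \<psi> x = 0"
  shows "(\<integral>x. \<psi>' x v \<partial>lebesgue) = 0"
proof -
  have \<psi>c: "continuous_on UNIV \<psi>"
    using d by (auto intro!: continuous_at_imp_continuous_on has_derivative_continuous)
  then have [measurable]: "\<psi> \<in> borel_measurable borel" by (rule borel_measurable_continuous_onI)
  have [measurable]: "(\<lambda>x. \<psi>' x v) \<in> borel_measurable borel" using c by (rule borel_measurable_continuous_onI)
  have z: "\<psi>' x v = 0" if "x \<notin> K" for x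
  proof -
    have "((\<lambda>x. 0) has_derivative (\<lambda>v. 0)) (at x)" by simp
    then have "(\<psi> has_derivative (\<lambda>v. 0)) (at x)"
      by (rule has_derivative_transform_within_open[of _ _ _ _ "- K"])
        (use that K in \<open>auto simp: compact_imp_closed open_Compl\<close>)
    then show ?thesis using has_derivative_unique[OF d[of x]] by metis
  qed
  have "bounded ((\<lambda>x. \<psi>' x v) ` K)"
    using c K(1) by (meson compact_continuous_image compact_imp_bounded continuous_on_subset top_greatest)
  then obtain B where B0: "\<And>x. x \<in> K \<Longrightarrow> \<bar>\<psi>' x v\<bar> \<le> B" by (force simp: bounded_iff)
  define B' where "B' = max B 0"
  have B: "\<bar>\<psi>' x v\<bar> \<le> B'" for x using B0[of x] z[of x] by (cases "x \<in> K") (auto simp: B'_def)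
  \<comment> \<open>All points that a shift by at most \<open>v\<close> can carry into
    \<open>K\<close>. For steps between 0 and 1 every difference quotient is supported in
    \<open>K \<union> K'\<close>.\<close>
  define K' where "K' = (\<lambda>(x, s). x - s *\<^sub>R v) ` (K \<times> {0..1})"
  have K': "compact K'" unfolding K'_def
    using K(1) by (intro compact_continuous_image continuous_intros compact_Times)
      (auto simp: case_prod_unfold intro!: continuous_intros)
  define s where "s = (\<lambda>n. inverse (real (Suc n)))"
  have s: "0 < s n" "s n \<le> 1" for n by (auto simp: s_def field_simps)
  have s0: "s \<longlonglongrightarrow> 0" unfolding s_def by (rule LIMSEQ_inverse_real_of_nat)
  define q where "q = (\<lambda>n x. (\<psi> (x + s n *\<^sub>R v) - \<psi> x) / s n)"
  have line: "((\<lambda>\<tau>. \<psi> (x + \<tau> *\<^sub>R v)) has_real_derivative \<psi>' (x + \<tau> *\<^sub>R v) v) (at \<tau>)" for x \<tau>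
  proof -
    have "((\<lambda>\<tau>. x + \<tau> *\<^sub>R v) has_derivative (\<lambda>t. t *\<^sub>R v)) (at \<tau>)"
      by (auto intro!: derivative_eq_intros)
    from diff_chain_at[OF this d] have "((\<lambda>\<tau>. \<psi> (x + \<tau> *\<^sub>R v)) has_derivative (\<lambda>t. \<psi>' (x + \<tau> *\<^sub>R v) (t *\<^sub>R v))) (at \<tau>)"
      by (simp add: o_def)
    moreover have "(\<lambda>t. \<psi>' (x + \<tau> *\<^sub>R v) (t *\<^sub>R v)) = (*) (\<psi>' (x + \<tau> *\<^sub>R v) v)"
      using linear_scale[OF has_derivative_linear[OF d]] by (auto simp: fun_eq_iff)
    ultimately show ?thesis by (simp add: has_field_derivative_def)
  qed
  have qlim: "(\<lambda>n. q n x) \<longlonglongrightarrow> \<psi>' x v" for x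
  proof -
    have "((\<lambda>h. (\<psi> (x + h *\<^sub>R v) - \<psi> x) / h) \<longlongrightarrow> \<psi>' x v) (at 0)"
      using line[of x 0] by (simp add: has_field_derivative_iff)
    then show ?thesis unfolding q_def
      by (rule filterlim_compose) (use s s0 in \<open>auto simp: filterlim_at less_le\<close>)
  qed
  have qbound: "norm (q n x) \<le> indicator (K \<union> K') x * B'" for n x
  proof (cases "x \<in> K \<union> K'")
    case True
    obtain \<tau> where "\<psi> (x + s n *\<^sub>R v) - \<psi> (x + 0 *\<^sub>R v) = (s n - 0) * \<psi>' (x + \<tau> *\<^sub>R v) v"
      using MVT2[OF s(1)[of n], of "\<lambda>\<tau>. \<psi> (x + \<tau> *\<^sub>R v)" "\<lambda>\<tau>. \<psi>' (x + \<tau> *\<^sub>R v) v"] line by blast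
    then have "q n x = \<psi>' (x + \<tau> *\<^sub>R v) v" using s(1)[of n] by (simp add: q_def)
    then show ?thesis using True B by simp
  next
    case False
    have "x + s n *\<^sub>R v \<notin> K"
    proof
      assume "x + s n *\<^sub>R v \<in> K"
      then have "(\<lambda>(x, s). x - s *\<^sub>R v) (x + s n *\<^sub>R v, s n) \<in> K'"
        unfolding K'_def using s[of n] by (intro imageI) auto
      then show False using False by simp
    qed
    then show ?thesis using False K(2) by (simp add: q_def)
  qed
  have \<psi>i: "integrable lborel \<psi>"
  proof -
    have "integrable lborel (\<lambda>x. indicator K x *\<^sub>R \<psi> x)"
      using borel_integrable_compact[OF K(1) continuous_on_subset[OF \<psi>c]] by simp
    moreover have "(\<lambda>x. indicator K x *\<^sub>R \<psi> x) = \<psi>" using K(2) by (auto simp: indicator_def fun_eq_iff)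
    ultimately show ?thesis by simp
  qed
  have trans: "integrable lborel (\<lambda>x. \<psi> (x + t))" "(\<integral>x. \<psi> (x + t) \<partial>lborel) = (\<integral>x. \<psi> x \<partial>lborel)" for t
  proof -
    have "distr lborel borel (\<lambda>x. t + x) = (lborel :: 'a measure)" by (rule lborel_distr_plus)
    then have *: "distr lborel borel (\<lambda>x. x + t) = (lborel :: 'a measure)" by (simp add: add.commute)
    show "integrable lborel (\<lambda>x. \<psi> (x + t))"
      using \<psi>i by (subst (asm) *[symmetric]) (simp add: integrable_distr_eq)
    show "(\<integral>x. \<psi> (x + t) \<partial>lborel) = (\<integral>x. \<psi> x \<partial>lborel)"
      by (subst (2) *[symmetric]) (simp add: integral_distr)
  qed
  have qz: "(\<integral>x. q n x \<partial>lborel) = 0" for n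
    unfolding q_def using trans \<psi>i by simp
  have "(\<lambda>n. \<integral>x. q n x \<partial>lborel) \<longlonglongrightarrow> (\<integral>x. \<psi>' x v \<partial>lborel)"
  proof (rule integral_dominated_convergence)
    have "compact (K \<union> K')" using K(1) K' by (rule compact_Un)
    then have "K \<union> K' \<in> sets borel" "emeasure lborel (K \<union> K') < \<infinity>"
      by (auto intro: borel_compact simp: emeasure_bounded_finite[OF compact_imp_bounded, unfolded infinity_ennreal_def])
    then show "integrable lborel (\<lambda>x. indicator (K \<union> K') x * B')"
      by (intro integrable_mult_left) auto
    show "AE x in lborel. norm (q n x) \<le> indicator (K \<union> K') x * B'" for n using qbound by simp
    show "AE x in lborel. (\<lambda>n. q n x) \<longlonglongrightarrow> \<psi>' x v" using qlim by simp
    show "q n \<in> borel_measurable lborel" for n unfolding q_def by measurable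
  qed measurable
  then have "(\<integral>x. \<psi>' x v \<partial>lborel) = 0" by (simp add: qz LIMSEQ_const_iff)
  then show ?thesis by (subst integral_completion) auto
qed

lemma has_weak_deriv_classical:
  fixes u :: "'a::euclidean_space \<Rightarrow> real"
  assumes U: "open U" and d: "\<And>x. x \<in> U \<Longrightarrow> (u has_derivative u' x) (at x)"
    and c: "continuous_on U (\<lambda>x. u' x v)"
  shows "has_weak_deriv U u v (\<lambda>x. u' x v)"
  unfolding has_weak_deriv_def
proof (intro conjI ballI)
  have uc: "continuous_on U u"
    using d by (auto intro!: continuous_at_imp_continuous_on has_derivative_continuous)
  have li: "locally_integrable_on f U" if "continuous_on U f" for f
    unfolding locally_integrable_on_def
  proof (intro allI impI)
    fix K assume K: "compact K \<and> K \<subseteq> U"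
    have Kb: "K \<in> sets borel" using K by (auto intro: borel_compact)
    have "integrable lborel (\<lambda>x. indicator K x *\<^sub>R f x)"
      using K that by (intro borel_integrable_compact) (auto intro: continuous_on_subset)
    then have "integrable lebesgue (\<lambda>x. indicator K x *\<^sub>R f x)"
      by (subst integrable_completion) auto
    then show "integrable (lebesgue_on K) f" using Kb by (simp add: integrable_restrict_space)
  qed
  show 1: "locally_integrable_on u U" by (rule li[OF uc])
  show 2: "locally_integrable_on (\<lambda>x. u' x v) U" by (rule li[OF c])
  have Ul: "U \<in> sets lebesgue" using U by auto
  fix \<phi> :: "'a \<Rightarrow> real" assume \<phi>: "\<phi> \<in> test_functions U"
  obtain K where K: "compact K" "K \<subseteq> U" "\<And>x. x \<notin> K \<Longrightarrow> \<phi> x = 0"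
    using \<phi> by (auto simp: test_functions_def)
  let ?D = "\<lambda>x. frechet_derivative \<phi> (at x)"
  note D = test_function_derivative[OF \<phi>]
  have Dz: "?D x = (\<lambda>v. 0)" if "x \<notin> K" for x
  proof -
    have "((\<lambda>x. 0) has_derivative (\<lambda>v. 0)) (at x)" by simp
    then have "(\<phi> has_derivative (\<lambda>v. 0)) (at x)"
      by (rule has_derivative_transform_within_open[of _ _ _ _ "- K"])
        (use that K in \<open>auto simp: compact_imp_closed open_Compl\<close>)
    from frechet_derivative_at[OF this] show ?thesis by metis
  qed
  \<comment> \<open>The product is extended by zero because \<open>u\<close> is known only in
    \<open>U\<close>. The extension is differentiable everywhere, since \<open>U\<close> and the
    complement of the support of \<open>\<phi>\<close> are open and cover the space.\<close>
  define \<psi> where "\<psi> = (\<lambda>x. if x \<in> U then u x * \<phi> x else 0)"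
  define \<psi>' where "\<psi>' = (\<lambda>x v. if x \<in> U then u x * ?D x v + u' x v * \<phi> x else 0)"
  have opK: "open (- K)" using K(1) by (simp add: compact_imp_closed open_Compl)
  have UK: "U \<union> - K = UNIV" using K(2) by auto
  have "(\<integral>x. \<psi>' x v \<partial>lebesgue) = 0"
  proof (rule integral_directional_derivative_zero[OF _ _ K(1)])
    show "\<psi> x = 0" if "x \<notin> K" for x using that K by (simp add: \<psi>_def)
    show "(\<psi> has_derivative \<psi>' x) (at x)" for x
    proof (cases "x \<in> U")
      case True
      have "((\<lambda>x. u x * \<phi> x) has_derivative (\<lambda>v. u x * ?D x v + u' x v * \<phi> x)) (at x)"
        by (intro has_derivative_mult d[OF True] D(1))
      then have "(\<psi> has_derivative (\<lambda>v. u x * ?D x v + u' x v * \<phi> x)) (at x)"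
        by (rule has_derivative_transform_within_open[OF _ U True]) (simp add: \<psi>_def)
      then show ?thesis using True by (simp add: \<psi>'_def)
    next
      case False
      have "((\<lambda>x. 0) has_derivative (\<lambda>v. 0)) (at x)" by simp
      then have "(\<psi> has_derivative (\<lambda>v. 0)) (at x)"
        by (rule has_derivative_transform_within_open[OF _ opK])
          (use False K in \<open>auto simp: \<psi>_def\<close>)
      then show ?thesis using False by (simp add: \<psi>'_def[abs_def])
    qed
    have "continuous_on U (\<lambda>x. u x * ?D x v + u' x v * \<phi> x)"
      using test_function_continuous[OF \<phi>] test_function_continuous[OF D(2)]
      by (intro continuous_intros uc c) (auto intro: continuous_on_subset)
    then have cU: "continuous_on U (\<lambda>x. \<psi>' x v)"
      by (rule continuous_on_eq) (simp add: \<psi>'_def)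
    have "continuous_on (- K) (\<lambda>x. 0::real)" by simp
    then have cK: "continuous_on (- K) (\<lambda>x. \<psi>' x v)"
      by (rule continuous_on_eq) (auto simp: \<psi>'_def Dz K(3))
    show "continuous_on UNIV (\<lambda>x. \<psi>' x v)"
      using continuous_on_open_Un[OF U opK cU cK] UK by simp
  qed
  moreover have "(\<lambda>x. \<psi>' x v) = (\<lambda>x. indicator U x *\<^sub>R (u x * ?D x v + u' x v * \<phi> x))"
    by (auto simp: \<psi>'_def indicator_def fun_eq_iff)
  ultimately have "(\<integral>x. indicator U x *\<^sub>R (u x * ?D x v + u' x v * \<phi> x) \<partial>lebesgue) = 0"
    by simp
  then have "(LINT x|lebesgue_on U. u x * ?D x v + u' x v * \<phi> x) = 0"
    using Ul by (simp add: integral_restrict_space)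
  then show "(LINT x|lebesgue_on U. u x * ?D x v) = - (LINT x|lebesgue_on U. u' x v * \<phi> x)"
    using integrable_locally_integrable_times[OF 1 Ul D(2)] integrable_locally_integrable_times[OF 2 Ul \<phi>]
    by (simp add: Bochner_Integration.integral_add)
qed

text \<open>Completeness of Lebesgue measure. It gives measurability of the chosen representative in
  \<open>weak_deriv\<close>, about which only an almost everywhere statement is available.\<close>

lemma measurable_AE_lebesgue:
  fixes f g :: "'a::euclidean_space \<Rightarrow> real"
  assumes f: "f \<in> borel_measurable lebesgue" and ae: "AE x in lebesgue. g x = f x"
  shows "g \<in> borel_measurable lebesgue"
proof -
  obtain N where N: "N \<in> null_sets lebesgue" "{x. g x \<noteq> f x} \<subseteq> N"
    using ae by (auto simp: eventually_ae_filter)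
  show ?thesis
  proof (rule measurableI)
    fix A :: "real set" assume A: "A \<in> sets borel"
    have "g -` A \<inter> space lebesgue = (f -` A - {x. g x \<noteq> f x}) \<union> (g -` A \<inter> {x. g x \<noteq> f x})"
      by auto
    moreover have fA: "f -` A \<in> sets lebesgue" using measurable_sets[OF f A] by simp
    moreover have S: "S \<in> sets lebesgue" if "S \<subseteq> {x. g x \<noteq> f x}" for S
      using that N null_sets_completion_subset[of S N lborel] by auto
    moreover have "(f -` A - {x. g x \<noteq> f x}) \<union> (g -` A \<inter> {x. g x \<noteq> f x}) \<in> sets lebesgue"
      by (intro sets.Un sets.Diff fA S) auto
    ultimately show "g -` A \<inter> space lebesgue \<in> sets lebesgue" by simp
  qed simp
qed

lemma ivl_open_iff:
  fixes f :: "real \<Rightarrow> real"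
  shows borel_measurable_ivl_open_iff:
      "f \<in> borel_measurable (lebesgue_on {a..b}) \<longleftrightarrow> f \<in> borel_measurable (lebesgue_on {a<..<b})" (is ?M)
    and integrable_ivl_open_iff: "integrable (lebesgue_on {a..b}) f \<longleftrightarrow> integrable (lebesgue_on {a<..<b}) f" (is ?I)
    and integral_ivl_open: "(LINT x|lebesgue_on {a..b}. f x) = (LINT x|lebesgue_on {a<..<b}. f x)" (is ?E)
proof -
  \<comment> \<open>The two endpoint corrections. Their guards differ so that an empty interval gets
    none and a one-point interval is not counted twice.\<close>
  define c where "c = (if a \<le> b then f a else 0)"
  define d where "d = (if a < b then f b else 0)"
  let ?p = "\<lambda>x. indicator {a} x * c + indicator {b} x * d :: real"
  let ?f = "\<lambda>x. indicator {a..b} x *\<^sub>R f x" and ?g = "\<lambda>x. indicator {a<..<b} x *\<^sub>R f x"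
  have f: "?f = (\<lambda>x. ?g x + ?p x)" and g: "?g = (\<lambda>x. ?f x - ?p x)"
    by (auto simp: fun_eq_iff indicator_def c_def d_def)
  have p: "integrable lebesgue ?p"
    by (intro Bochner_Integration.integrable_add integrable_mult_left integrable_real_indicator) (auto simp: emeasure_completion)
  then have pm: "?p \<in> borel_measurable lebesgue" by (rule borel_measurable_integrable)
  have "?f \<in> borel_measurable lebesgue \<longleftrightarrow> ?g \<in> borel_measurable lebesgue"
    using borel_measurable_add[OF _ pm, of ?g] borel_measurable_diff[OF _ pm, of ?f] f g by metis
  then show ?M by (simp add: borel_measurable_restrict_space_iff)
  have I: "integrable lebesgue ?f \<longleftrightarrow> integrable lebesgue ?g"
    using Bochner_Integration.integrable_add[OF _ p, of ?g] Bochner_Integration.integrable_diff[OF _ p, of ?f] f g by metis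
  then show i: ?I by (simp add: integrable_restrict_space)
  have "AE x in lebesgue. x \<noteq> a" "AE x in lebesgue. x \<noteq> b"
    by (auto intro: AE_completion AE_lborel_singleton)
  then have ae: "AE x in lebesgue. ?f x = ?g x" by eventually_elim (auto simp: indicator_def)
  have "integral\<^sup>L lebesgue ?f = integral\<^sup>L lebesgue ?g"
  proof (cases "integrable lebesgue ?f")
    case True
    then show ?thesis using I by (intro integral_cong_AE ae) auto
  next
    case False
    then have "\<not> integrable lebesgue ?g" using I by blast
    then show ?thesis using False by (metis not_integrable_integral_eq)
  qed
  then show ?E by (simp add: integral_restrict_space)
qed

section \<open>Sobolev functions on an interval\<close>

lemma L2_on_integrable_ivl:
  fixes R :: real
  assumes "w \<in> L2_on {0<..<R}"
  shows "integrable (lebesgue_on {0..R}) w" "integrable (lebesgue_on {0..R}) (\<lambda>x. (w x)\<^sup>2)"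
    "w \<in> borel_measurable (lebesgue_on {0..R})"
proof -
  show wm: "w \<in> borel_measurable (lebesgue_on {0..R})"
    and w2: "integrable (lebesgue_on {0..R}) (\<lambda>x. (w x)\<^sup>2)"
    using assms unfolding L2_on_def mem_Collect_eq borel_measurable_ivl_open_iff integrable_ivl_open_iff
    by blast+
  show "integrable (lebesgue_on {0..R}) w"
  proof (rule Bochner_Integration.integrable_bound)
    show "integrable (lebesgue_on {0..R}) (\<lambda>x. 1 + (w x)\<^sup>2)"
      using w2 continuous_imp_integrable_real[of 0 R "\<lambda>x. 1::real"] by (intro Bochner_Integration.integrable_add) auto
    have "\<bar>y\<bar> \<le> 1 + y\<^sup>2" for y :: real
      using zero_le_power2[of "\<bar>y\<bar> - 1"] unfolding power2_diff by (auto simp: abs_if)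
    then show "AE x in lebesgue_on {0..R}. norm (w x) \<le> norm (1 + (w x)\<^sup>2)"
      by (intro AE_I2) auto
  qed (rule wm)
qed

text \<open>The product rule for primitives, applied to \<open>h\<close> and a test function, leaves
  no boundary terms.\<close>

lemma has_weak_deriv_primitive:
  assumes h: "primitive R h w"
  shows "has_weak_deriv {0<..<R} h 1 w"
  unfolding has_weak_deriv_def
proof (intro conjI ballI)
  have li: "locally_integrable_on f {0<..<R}" if f: "integrable (lebesgue_on {0..R}) f" for f
    unfolding locally_integrable_on_def
  proof (intro allI impI)
    fix K :: "real set" assume K: "compact K \<and> K \<subseteq> {0<..<R}"
    then have Kb: "K \<in> sets lebesgue" by (auto simp: compact_imp_closed borel_closed)
    have i: "integrable lebesgue (\<lambda>x. indicator {0..R} x *\<^sub>R f x)"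
      using f by (simp add: integrable_restrict_space)
    have "integrable lebesgue (\<lambda>x. indicator K x *\<^sub>R (indicator {0..R} x *\<^sub>R f x))"
      by (rule integrable_mult_indicator[OF Kb i])
    moreover have "(\<lambda>x. indicator K x *\<^sub>R (indicator {0..R} x *\<^sub>R f x)) = (\<lambda>x. indicator K x *\<^sub>R f x)"
      using K by (auto simp: indicator_def fun_eq_iff)
    ultimately show "integrable (lebesgue_on K) f" using Kb by (simp add: integrable_restrict_space)
  qed
  show 1: "locally_integrable_on h {0<..<R}"
    by (intro li continuous_imp_integrable_real primitive_continuous[OF h])
  show 2: "locally_integrable_on w {0<..<R}" by (intro li primitive_integrable[OF h])
  fix \<phi> :: "real \<Rightarrow> real" assume \<phi>: "\<phi> \<in> test_functions {0<..<R}"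
  obtain K where K: "compact K" "K \<subseteq> {0<..<R}" "\<And>x. x \<notin> K \<Longrightarrow> \<phi> x = 0"
    using \<phi> by (auto simp: test_functions_def)
  let ?D = "\<lambda>x. frechet_derivative \<phi> (at x) 1"
  note D = test_function_derivative[OF \<phi>]
  have "(\<phi> has_field_derivative ?D x) (at x)" for x
  proof -
    have "frechet_derivative \<phi> (at x) v = ?D x * v" for v
    proof -
      have "frechet_derivative \<phi> (at x) (v *\<^sub>R 1) = v *\<^sub>R ?D x"
        by (rule linear_scale[OF has_derivative_linear[OF D(1)[of x]]])
      then show ?thesis by (metis mult.commute mult.right_neutral real_scaleR_def)
    qed
    then have "frechet_derivative \<phi> (at x) = (*) (?D x)" by (rule ext)
    then show ?thesis using D(1)[of x] unfolding has_field_derivative_def by metis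
  qed
  then have p: "primitive R \<phi> ?D"
    by (intro primitive_C1) (auto intro: has_field_derivative_at_within continuous_on_subset[OF test_function_continuous[OF D(2)]])
  show "(LINT x|lebesgue_on {0<..<R}. h x * ?D x) = - (LINT x|lebesgue_on {0<..<R}. w x * \<phi> x)"
  proof (cases "0 \<le> R")
    case True
    have "0 \<notin> K" "R \<notin> K" using K(2) by auto
    then have "\<phi> 0 = 0" "\<phi> R = 0" using K(3) by blast+
    note m = primitive_mult[OF h p]
    have "0 = integral {0..R} (\<lambda>x. w x * \<phi> x + ?D x * h x)"
      using primitive_eq[OF m, of R] True \<open>\<phi> 0 = 0\<close> \<open>\<phi> R = 0\<close> by auto
    also have "\<dots> = (LINT x|lebesgue_on {0..R}. w x * \<phi> x + ?D x * h x)"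
      using integral_lebesgue_on_ivl[OF primitive_integrable[OF m]] by simp
    also have "\<dots> = (LINT x|lebesgue_on {0<..<R}. w x * \<phi> x + h x * ?D x)"
      by (simp add: integral_ivl_open mult.commute)
    also have "\<dots> = (LINT x|lebesgue_on {0<..<R}. w x * \<phi> x) + (LINT x|lebesgue_on {0<..<R}. h x * ?D x)"
      by (intro Bochner_Integration.integral_add integrable_locally_integrable_times 1 2 \<phi> D) auto
    finally show ?thesis by simp
  qed simp
qed

text \<open>The argument of du Bois-Reymond: subtracting a multiple of one fixed bump gives any test
  function mean zero, and then it is the derivative of a test function. Hence \<open>k\<close> minus
  a constant is orthogonal to all test functions.\<close>

lemma constant_of_weak_deriv_zero:
  fixes k :: "real \<Rightarrow> real"
  assumes k: "has_weak_deriv {0<..<R} k 1 (\<lambda>x. 0)" and c: "continuous_on {0..R} k" and R: "R > 0"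
    and x: "x \<in> {0..R}"
  shows "k x = k 0"
proof -
  let ?U = "{0<..<R}"
  have kl: "locally_integrable_on k ?U" using k by (auto simp: has_weak_deriv_def)
  define \<rho>0 where "\<rho>0 = box_bump 1 (R / 3) (2 * R / 3)"
  have \<rho>0t: "\<rho>0 \<in> test_functions ?U"
    unfolding \<rho>0_def using R by (intro box_bump_test) (auto simp: cbox_interval)
  have ti: "integrable (lebesgue_on ?U) \<psi>" if "\<psi> \<in> test_functions ?U" for \<psi>
    using integrable_continuous_times continuous_imp_integrable_real[of 0 R \<psi>]
      test_function_continuous[OF that] by (auto simp: ivl_open_iff[symmetric] intro: continuous_on_subset)
  define m where "m = (LINT x|lebesgue_on ?U. \<rho>0 x)"
  have "m \<noteq> 0"
  proof
    assume "m = 0"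
    then have "AE x in lebesgue_on ?U. \<rho>0 x = 0"
      using integral_nonneg_eq_0_iff_AE[OF ti[OF \<rho>0t]] box_bump_bounds(1)[of 1 "R/3" "2*R/3"]
      unfolding m_def \<rho>0_def by simp
    then have "AE x in lebesgue. x \<in> ?U \<longrightarrow> \<rho>0 x = 0" by (subst (asm) AE_restrict_space_iff) auto
    then have "AE x in lebesgue. x \<notin> box (R/3) (2 * R/3)"
    proof eventually_elim
      case (elim x)
      then show ?case using box_bump_pos[of x "R/3" "2*R/3" 1] R by (auto simp: \<rho>0_def box_real)
    qed
    then have "emeasure lebesgue (box (R/3) (2 * R/3)) = 0"
      by (subst (asm) AE_iff_measurable[of "box (R/3) (2 * R/3)"]) auto
    then show False using R by (simp add: box_real)
  qed
  define \<rho> where "\<rho> = (\<lambda>x. inverse m * \<rho>0 x)"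
  define C where "C = (LINT x|lebesgue_on ?U. k x * \<rho> x)"
  have "AE x in lebesgue_on ?U. k x - C = 0"
  proof (rule fundamental_lemma_calculus_of_variations)
    have "locally_integrable_on (\<lambda>x. C) ?U"
      using has_weak_deriv_classical[of ?U "\<lambda>x. C" "\<lambda>x v. 0" 1] by (simp add: has_weak_deriv_def)
    then show "locally_integrable_on (\<lambda>x. k x - C) ?U" using kl by (auto simp: locally_integrable_on_def)
    fix \<psi> :: "real \<Rightarrow> real" assume \<psi>: "\<psi> \<in> test_functions ?U"
    define n where "n = (LINT x|lebesgue_on ?U. \<psi> x)"
    define g where "g = (\<lambda>x. \<psi> x + (- n * inverse m) * \<rho>0 x)"
    have gt: "g \<in> test_functions ?U"
    proof -
      obtain K1 where K1: "compact K1" "K1 \<subseteq> ?U" "\<And>x. x \<notin> K1 \<Longrightarrow> \<psi> x = 0"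
        using \<psi> by (auto simp: test_functions_def)
      obtain K2 where K2: "compact K2" "K2 \<subseteq> ?U" "\<And>x. x \<notin> K2 \<Longrightarrow> \<rho>0 x = 0"
        using \<rho>0t by (auto simp: test_functions_def)
      have "Ck_on j UNIV g" for j
        unfolding g_def using \<psi> \<rho>0t by (intro Ck_on_add Ck_on_mult Ck_on_const) (auto simp: test_functions_def)
      then show ?thesis unfolding test_functions_def using K1 K2
        by (intro CollectI conjI allI exI[of _ "K1 \<union> K2"]) (auto simp: g_def)
    qed
    obtain K where K: "compact K" "K \<subseteq> ?U" "\<And>x. x \<notin> K \<Longrightarrow> g x = 0"
      using gt by (auto simp: test_functions_def)
    have gc: "continuous_on S g" for S using test_function_continuous[OF gt] by (rule continuous_on_subset) simp
    have gint: "(LINT x|lebesgue_on ?U. g x) = 0"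
      unfolding g_def using ti[OF \<psi>] ti[OF \<rho>0t] \<open>m \<noteq> 0\<close> by (simp add: n_def[symmetric] m_def[symmetric])
    \<comment> \<open>Adding the midpoint makes the compact set nonempty, so that it has a least and
      a greatest element even when \<open>g\<close> is zero.\<close>
    define K' where "K' = insert (R/2) K"
    have K': "compact K'" "K' \<noteq> {}" "K' \<subseteq> ?U" using K R by (auto simp: K'_def)
    obtain a where a: "a \<in> K'" "\<And>x. x \<in> K' \<Longrightarrow> a \<le> x" using compact_attains_inf[OF K'(1,2)] by blast
    obtain b where b: "b \<in> K'" "\<And>x. x \<in> K' \<Longrightarrow> x \<le> b" using compact_attains_sup[OF K'(1,2)] by blast
    have ab: "0 < a" "a \<le> b" "b < R" using a b K' by force+
    have g0: "g x = 0" if "x < a \<or> b < x" for x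
      using K(3)[of x] a(2)[of x] b(2)[of x] that by (force simp: K'_def)
    define \<phi> where "\<phi> = (\<lambda>x. integral {0..x} g)"
    have \<phi>a: "\<phi> x = 0" if "x < a" for x
    proof -
      have "integral {0..x} g = integral {0..x} (\<lambda>x. 0)"
        using that g0 by (intro Henstock_Kurzweil_Integration.integral_cong) auto
      then show ?thesis by (simp add: \<phi>_def)
    qed
    have gz: "integral {0..R} g = 0"
      using gint integral_lebesgue_on_ivl[OF continuous_imp_integrable_real[OF gc]] by (simp add: integral_ivl_open)
    have \<phi>b: "\<phi> x = 0" if "b < x" for x
    proof -
      have gi: "g integrable_on {0..y}" for y by (rule integrable_continuous_real[OF gc])
      have z: "integral {y..z} g = 0" if "b < y" for y z
      proof -
        have "integral {y..z} g = integral {y..z} (\<lambda>x. 0)"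
          using that g0 by (intro Henstock_Kurzweil_Integration.integral_cong) auto
        then show ?thesis by simp
      qed
      show ?thesis
      proof (cases "x \<le> R")
        case True
        have "integral {0..x} g + integral {x..R} g = integral {0..R} g"
          using True that ab gi by (intro Henstock_Kurzweil_Integration.integral_combine) auto
        then show ?thesis using z[OF that, of R] gz by (simp add: \<phi>_def)
      next
        case False
        have "integral {0..R} g + integral {R..x} g = integral {0..x} g"
          using False that ab gi R by (intro Henstock_Kurzweil_Integration.integral_combine) auto
        then show ?thesis using z[OF ab(3), of x] gz by (simp add: \<phi>_def)
      qed
    qed
    have d: "(\<phi> has_real_derivative g x) (at x)" for x
    proof (cases "x < a")
      case True
      have "((\<lambda>x. 0) has_real_derivative 0) (at x)" by simp
      then have "(\<phi> has_real_derivative 0) (at x)"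
        by (rule has_field_derivative_transform_within_open[of _ _ _ "{..<a}"]) (use True \<phi>a in auto)
      then show ?thesis using g0 True by simp
    next
      case False
      have "(\<phi> has_real_derivative g x) (at x within {0..x + 1})"
        unfolding \<phi>_def using False ab by (intro integral_has_real_derivative gc) auto
      then show ?thesis using False ab by (simp add: at_within_Icc_at)
    qed
    have D: "(\<phi> has_derivative (\<lambda>v. v * g x)) (at x)" for x
      using d[of x] by (simp add: has_field_derivative_def mult_commute_abs)
    have "\<phi> \<in> test_functions ?U"
    proof -
      have "Ck_on n UNIV \<phi>" for n
      proof (rule Ck_on_SucD)
        show "Ck_on (Suc n) UNIV \<phi>" unfolding Ck_on.simps
        proof (intro exI conjI ballI allI)
          show "(\<phi> has_derivative (\<lambda>v. v * g x)) (at x)" for x by (rule D)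
          show "Ck_on n UNIV (\<lambda>x. v * g x)" for v
            using gt by (intro Ck_on_mult Ck_on_const) (auto simp: test_functions_def)
        qed
      qed
      then show ?thesis unfolding test_functions_def using \<phi>a \<phi>b ab
        by (intro CollectI conjI allI exI[of _ "{a..b}"]) (auto simp: not_le)
    qed
    then have "(LINT x|lebesgue_on ?U. k x * frechet_derivative \<phi> (at x) 1) = 0"
      using k by (auto simp: has_weak_deriv_def)
    moreover have "frechet_derivative \<phi> (at x) 1 = g x" for x
      using frechet_derivative_at[OF D[of x]] by (metis mult_1)
    ultimately have z: "(LINT x|lebesgue_on ?U. k x * g x) = 0" by simp
    have i: "integrable (lebesgue_on ?U) (\<lambda>x. k x * \<psi> x)" "integrable (lebesgue_on ?U) (\<lambda>x. k x * \<rho>0 x)"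
      by (intro integrable_locally_integrable_times kl \<psi> \<rho>0t; simp)+
    have "(LINT x|lebesgue_on ?U. k x * g x) = (LINT x|lebesgue_on ?U. k x * \<psi> x + (- n * inverse m) * (k x * \<rho>0 x))"
      by (simp add: g_def algebra_simps)
    also have "\<dots> = (LINT x|lebesgue_on ?U. k x * \<psi> x) + (- n * inverse m) * (LINT x|lebesgue_on ?U. k x * \<rho>0 x)"
      using i by simp
    also have "(LINT x|lebesgue_on ?U. k x * \<rho>0 x) = m * C"
    proof -
      have "C = (LINT x|lebesgue_on ?U. inverse m * (k x * \<rho>0 x))" by (simp add: C_def \<rho>_def mult_ac)
      then show ?thesis using \<open>m \<noteq> 0\<close> by simp
    qed
    finally have "(LINT x|lebesgue_on ?U. k x * \<psi> x) = n * C" using z \<open>m \<noteq> 0\<close> by simp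
    then show "(LINT x|lebesgue_on ?U. (k x - C) * \<psi> x) = 0"
      using i(1) ti[OF \<psi>] by (simp add: left_diff_distrib n_def)
  qed simp
  then have ae: "AE x in lebesgue. x \<in> ?U \<longrightarrow> k x = C" by (subst (asm) AE_restrict_space_iff) auto
  \<comment> \<open>Continuity upgrades almost everywhere to everywhere: the exceptional set is
    open, and a nonempty open set is not null.\<close>
  have kU: "k x = C" if x: "x \<in> ?U" for x
  proof (rule ccontr)
    assume "k x \<noteq> C"
    have "continuous_on ?U k" using c by (rule continuous_on_subset) auto
    then have op: "open {x \<in> ?U. k x \<noteq> C}"
      using continuous_open_preimage[of ?U k "- {C}"] by (auto simp: vimage_def Int_def)
    have "{x \<in> ?U. k x \<noteq> C} \<in> null_sets lebesgue"
    proof (subst AE_iff_null_sets)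
      show "{x \<in> ?U. k x \<noteq> C} \<in> sets lebesgue" using op by auto
      show "AE x in lebesgue. x \<notin> {x \<in> ?U. k x \<noteq> C}" using ae by eventually_elim auto
    qed
    then show False using op open_not_negligible[of "{x \<in> ?U. k x \<noteq> C}"] x \<open>k x \<noteq> C\<close>
      by (auto simp: negligible_iff_null_sets)
  qed
  have cl: "k y = C" if "y \<in> {0..R}" for y
  proof (rule continuous_constant_on_closure[where S = ?U and f = k and x = y])
    show "continuous_on (closure ?U) k" using c R by simp
    show "y \<in> closure ?U" using that R by simp
  qed (use kU in auto)
  show ?thesis using cl[OF x] cl[of 0] R by simp
qed

text \<open>The indefinite integral of \<open>w\<close> has the same weak derivative as
  \<open>h\<close>, so the difference is constant. Continuity of \<open>h\<close> up to the
  endpoints is what carries this to the closed interval.\<close>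

lemma primitive_of_W12:
  fixes h :: "real \<Rightarrow> real"
  assumes w: "has_weak_deriv {0<..<R} h 1 w" "integrable (lebesgue_on {0..R}) w"
    and c: "continuous_on {0..R} h" and R: "R > 0"
  shows "primitive R h w"
  unfolding primitive_def
proof (intro conjI ballI w)
  define W where "W = (\<lambda>x. integral {0..x} w)"
  let ?U = "{0<..<R}"
  have p: "primitive R W w" unfolding W_def by (rule primitive_integral[OF w(2)])
  note Wd = has_weak_deriv_primitive[OF p]
  have Wc: "continuous_on {0..R} W" by (rule primitive_continuous[OF p])
  have "has_weak_deriv ?U (\<lambda>x. h x - W x) 1 (\<lambda>x. 0)"
    unfolding has_weak_deriv_def
  proof (intro conjI ballI)
    have l: "locally_integrable_on h ?U" "locally_integrable_on W ?U"
      using w Wd by (auto simp: has_weak_deriv_def)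
    show "locally_integrable_on (\<lambda>x. h x - W x) ?U" using l by (auto simp: locally_integrable_on_def)
    show "locally_integrable_on (\<lambda>x. 0) ?U" by (auto simp: locally_integrable_on_def)
    fix \<phi> :: "real \<Rightarrow> real" assume \<phi>: "\<phi> \<in> test_functions ?U"
    let ?D = "\<lambda>x. frechet_derivative \<phi> (at x) 1"
    have "(LINT x|lebesgue_on ?U. h x * ?D x) = (LINT x|lebesgue_on ?U. W x * ?D x)"
      using w(1) Wd \<phi> by (simp add: has_weak_deriv_def)
    then have "(LINT x|lebesgue_on ?U. (h x - W x) * ?D x) = 0"
      using integrable_locally_integrable_times[OF l(1) _ test_function_derivative(2)[OF \<phi>, of 1]]
        integrable_locally_integrable_times[OF l(2) _ test_function_derivative(2)[OF \<phi>, of 1]]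
      by (simp add: left_diff_distrib)
    then show "(LINT x|lebesgue_on ?U. (h x - W x) * ?D x) = - (LINT x|lebesgue_on ?U. 0 * \<phi> x)"
      by simp
  qed
  then have const: "h x - W x = h 0 - W 0" if "x \<in> {0..R}" for x
    using constant_of_weak_deriv_zero[of R "\<lambda>x. h x - W x" x] that R
      continuous_on_diff[OF c Wc] by simp
  fix x assume "x \<in> {0..R}"
  from const[OF this] show "h x = h 0 + integral {0..x} w" by (simp add: W_def)
qed

lemma A_h_weak_deriv:
  assumes h: "h \<in> A_h R" and R: "R > 0"
  defines "w \<equiv> weak_deriv {0<..<R} h 1"
  shows "primitive R h w" "integrable (lebesgue_on {0..R}) (\<lambda>x. (w x)\<^sup>2)"
    "w \<in> borel_measurable (lebesgue_on {0..R})"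
proof -
  have "h \<in> W12 {0<..<R}" and c: "continuous_on {0..R} h" using h by (auto simp: A_h_def)
  then obtain v where v: "v \<in> L2_on {0<..<R}" "has_weak_deriv {0<..<R} h 1 v"
    by (auto simp: W12_def)
  note vi = L2_on_integrable_ivl[OF v(1)]
  have wd: "AE x in lebesgue_on {0<..<R}. w x = v x" "has_weak_deriv {0<..<R} h 1 w"
    unfolding w_def by (rule AE_weak_deriv[OF _ v(2)]; simp)+
  have ae: "AE x in lebesgue. x \<in> {0<..<R} \<longrightarrow> w x = v x"
    using wd(1) by (subst (asm) AE_restrict_space_iff) auto
  have v0: "v \<in> borel_measurable (lebesgue_on {0<..<R})" using v(1) by (simp add: L2_on_def)
  have vm: "(\<lambda>x. indicator {0<..<R} x *\<^sub>R v x) \<in> borel_measurable lebesgue"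
    using v0 by (simp add: borel_measurable_restrict_space_iff)
  have "(\<lambda>x. indicator {0<..<R} x *\<^sub>R w x) \<in> borel_measurable lebesgue"
    by (rule measurable_AE_lebesgue[OF vm]) (use ae in eventually_elim, auto simp: indicator_def)
  then have w0: "w \<in> borel_measurable (lebesgue_on {0<..<R})" by (simp add: borel_measurable_restrict_space_iff)
  show wm: "w \<in> borel_measurable (lebesgue_on {0..R})"
    using w0 by (simp only: borel_measurable_ivl_open_iff)
  have i: "integrable (lebesgue_on {0<..<R}) v" "integrable (lebesgue_on {0<..<R}) (\<lambda>x. (v x)\<^sup>2)"
    using vi(1,2) by (simp_all only: integrable_ivl_open_iff)
  have "integrable (lebesgue_on {0<..<R}) w"
    by (rule integrable_cong_AE_imp[OF i(1) w0]) (use wd(1) in eventually_elim, auto)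
  then have wi: "integrable (lebesgue_on {0..R}) w" by (simp only: integrable_ivl_open_iff)
  have "integrable (lebesgue_on {0<..<R}) (\<lambda>x. (w x)\<^sup>2)"
    by (rule integrable_cong_AE_imp[OF i(2) borel_measurable_power[OF w0]]) (use wd(1) in eventually_elim, auto)
  then show "integrable (lebesgue_on {0..R}) (\<lambda>x. (w x)\<^sup>2)" by (simp only: integrable_ivl_open_iff)
  show "primitive R h w" by (rule primitive_of_W12[OF wd(2) wi c R])
qed

section \<open>Existence of a minimizer\<close>

text \<open>The completeness of L1, for a sequence with geometric increments. The rate makes the
  telescoping series absolutely summable almost everywhere, and its sum of absolute values is the
  dominating function; so the limit exists pointwise and in mean.\<close>

lemma L1_summable_limit:
  fixes f :: "nat \<Rightarrow> 'a \<Rightarrow> real"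
  assumes f: "\<And>n. integrable M (f n)" and d: "\<And>n. (\<integral>x. \<bar>f (Suc n) x - f n x\<bar> \<partial>M) \<le> (1/2) ^ n"
  shows "\<exists>F. integrable M F \<and> (AE x in M. (\<lambda>n. f n x) \<longlonglongrightarrow> F x) \<and>
    (\<lambda>n. \<integral>x. \<bar>f n x - F x\<bar> \<partial>M) \<longlonglongrightarrow> 0"
proof -
  define \<delta> where "\<delta> = (\<lambda>n x. f (Suc n) x - f n x)"
  have \<delta>: "integrable M (\<delta> n)" for n unfolding \<delta>_def using f by simp
  then have [measurable]: "\<delta> n \<in> borel_measurable M" for n by auto
  have fm [measurable]: "f n \<in> borel_measurable M" for n using f by auto
  have sn: "summable (\<lambda>n. \<integral>x. norm (\<delta> n x) \<partial>M)"
    by (rule summable_comparison_test[OF _ summable_geometric[of "1/2"]]) (use d in \<open>auto simp: \<delta>_def\<close>)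
  have "(\<integral>\<^sup>+x. (\<Sum>n. ennreal \<bar>\<delta> n x\<bar>) \<partial>M) = (\<Sum>n. \<integral>\<^sup>+x. ennreal \<bar>\<delta> n x\<bar> \<partial>M)"
    by (rule nn_integral_suminf) measurable
  also have "\<dots> = (\<Sum>n. ennreal (\<integral>x. \<bar>\<delta> n x\<bar> \<partial>M))"
    using \<delta> by (subst nn_integral_eq_integral) auto
  also have "\<dots> \<noteq> \<infinity>" using sn by (subst suminf_ennreal2) auto
  finally have "AE x in M. (\<Sum>n. ennreal \<bar>\<delta> n x\<bar>) \<noteq> \<infinity>"
    by (intro nn_integral_PInf_AE) (auto simp: less_top)
  then have s: "AE x in M. summable (\<lambda>n. norm (\<delta> n x))"
    by eventually_elim (auto intro: summable_suminf_not_top)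
  define G where "G = (\<lambda>x. \<Sum>n. \<bar>\<delta> n x\<bar>)"
  have G: "integrable M G"
    unfolding G_def using integrable_suminf[of M "\<lambda>n x. \<bar>\<delta> n x\<bar>"] \<delta> s sn by simp
  define F where "F = (\<lambda>x. f 0 x + (\<Sum>n. \<delta> n x))"
  have F: "integrable M F"
    unfolding F_def using integrable_suminf[OF \<delta> s sn] f by (intro Bochner_Integration.integrable_add) auto
  have tele: "f n x = f 0 x + (\<Sum>i<n. \<delta> i x)" for n x
    using sum_lessThan_telescope[of "\<lambda>i. f i x" n] by (simp add: \<delta>_def)
  have lim: "AE x in M. (\<lambda>n. f n x) \<longlonglongrightarrow> F x"
    using s
  proof eventually_elim
    case (elim x)
    then have "(\<lambda>n. \<Sum>i<n. \<delta> i x) \<longlonglongrightarrow> (\<Sum>i. \<delta> i x)"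
      by (rule summable_LIMSEQ[OF summable_norm_cancel])
    then have "(\<lambda>n. f 0 x + (\<Sum>i<n. \<delta> i x)) \<longlonglongrightarrow> F x" unfolding F_def by (intro tendsto_intros)
    moreover have "(\<lambda>n. f n x) = (\<lambda>n. f 0 x + (\<Sum>i<n. \<delta> i x))"
      by (rule ext) (rule tele)
    ultimately show ?case by metis
  qed
  have "(\<lambda>n. \<integral>x. \<bar>f n x - F x\<bar> \<partial>M) \<longlonglongrightarrow> (\<integral>x. 0 \<partial>M)"
  proof (rule integral_dominated_convergence)
    show "integrable M (\<lambda>x. 2 * G x)" using G by simp
    show "AE x in M. (\<lambda>n. \<bar>f n x - F x\<bar>) \<longlonglongrightarrow> 0"
      using lim by eventually_elim (auto intro: tendsto_rabs_zero simp: LIM_zero)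
    show "AE x in M. norm \<bar>f n x - F x\<bar> \<le> 2 * G x" for n
      using s
    proof eventually_elim
      case (elim x)
      have a: "\<bar>\<Sum>i<n. \<delta> i x\<bar> \<le> G x"
        unfolding G_def using elim sum_le_suminf[of "\<lambda>n. \<bar>\<delta> n x\<bar>" "{..<n}"]
        by (intro order_trans[OF sum_abs]) auto
      have b: "\<bar>\<Sum>i. \<delta> i x\<bar> \<le> G x"
        unfolding G_def using summable_norm[of "\<lambda>i. \<delta> i x"] elim by simp
      show ?case unfolding tele[of n x] F_def using a b by simp
    qed
  qed (use F in auto)
  then show ?thesis using F lim by auto
qed

section \<open>The functional without weight and its a priori bounds\<close>

abbreviation prim :: "(real \<Rightarrow> real) \<Rightarrow> real \<Rightarrow> real" where
  "prim w x \<equiv> integral {0..x} w"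

text \<open>The argument \<open>w\<close> stands for \<open>(r h)'\<close>, so \<open>prim w r / r\<close> is \<open>h\<close> and \<open>prim w R = R\<close> encodes \<open>h R = 1\<close>.\<close>

definition radial_class :: "real \<Rightarrow> (real \<Rightarrow> real) set" where
  "radial_class R = {w. w \<in> borel_measurable (lebesgue_on {0..R}) \<and>
     integrable (lebesgue_on {0..R}) (\<lambda>x. (w x)\<^sup>2) \<and>
     integrable (lebesgue_on {0..R}) (\<lambda>x. (prim w x / x)\<^sup>2) \<and> prim w R = R}"

definition radial_density :: "real \<Rightarrow> (real \<Rightarrow> real) \<Rightarrow> real \<Rightarrow> real" where
  "radial_density t w r = 1 / 2 * (w r)\<^sup>2 + 3 * (prim w r / r)\<^sup>2 + r\<^sup>2 * f_bulk t (prim w r / r)"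

definition J_radial :: "real \<Rightarrow> real \<Rightarrow> (real \<Rightarrow> real) \<Rightarrow> real" where
  "J_radial t R w = (LINT r|lebesgue_on {0..R}. radial_density t w r)"

lemma L2_integrable:
  fixes w :: "real \<Rightarrow> real"
  assumes "w \<in> borel_measurable (lebesgue_on {0..R})" "integrable (lebesgue_on {0..R}) (\<lambda>x. (w x)\<^sup>2)"
  shows "integrable (lebesgue_on {0..R}) w"
proof (rule L2_on_integrable_ivl(1))
  show "w \<in> L2_on {0<..<R}"
    unfolding L2_on_def mem_Collect_eq borel_measurable_ivl_open_iff[symmetric] integrable_ivl_open_iff[symmetric]
    using assms by (rule conjI)
qed

lemma abs_le_weighted:
  fixes y l :: real
  assumes "l > 0"
  shows "\<bar>y\<bar> \<le> (l + y\<^sup>2 / l) / 2"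
proof -
  have "0 \<le> (\<bar>y\<bar> - l)\<^sup>2" by simp
  then have "2 * l * \<bar>y\<bar> \<le> l\<^sup>2 + y\<^sup>2" by (simp add: power2_diff mult_ac)
  then show ?thesis using assms by (simp add: field_simps power2_eq_square)
qed

text \<open>The Cauchy-Schwarz estimate, obtained from a weighted arithmetic-geometric mean. It
  serves twice: as equicontinuity for Arzela-Ascoli and, from the point 0, as the growth bound near
  the origin.\<close>

lemma primitive_Hoelder:
  fixes w :: "real \<Rightarrow> real"
  assumes w: "w \<in> borel_measurable (lebesgue_on {0..R})" "integrable (lebesgue_on {0..R}) (\<lambda>x. (w x)\<^sup>2)"
    and B: "(LINT x|lebesgue_on {0..R}. (w x)\<^sup>2) \<le> B" "B > 0" and xy: "0 \<le> x" "x \<le> y" "y \<le> R"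
  shows "\<bar>prim w y - prim w x\<bar> \<le> sqrt (B * (y - x))"
proof (cases "x = y")
  case False
  then have lt: "x < y" using xy by simp
  note wi = L2_integrable[OF w]
  have sub: "{x..y} \<subseteq> {0..R}" using xy by auto
  define p q where "p = sqrt B" and "q = sqrt (y - x)"
  have pq: "p > 0" "q > 0" "p\<^sup>2 = B" "q\<^sup>2 = y - x" using B lt by (auto simp: p_def q_def)
  \<comment> \<open>The optimal weight: it makes \<open>l * (y - x)\<close> and \<open>B / l\<close>
    equal.\<close>
  define l where "l = p / q"
  have l: "l > 0" using pq by (simp add: l_def)
  have l2: "l * (y - x) = sqrt (B * (y - x))" "B / l = sqrt (B * (y - x))"
    unfolding real_sqrt_mult p_def[symmetric] q_def[symmetric] pq(3,4)[symmetric] l_def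
    using pq(1,2) by (simp_all add: power2_eq_square)
  have w1: "integrable (lebesgue_on {x..y}) w" "integrable (lebesgue_on {x..y}) (\<lambda>x. (w x)\<^sup>2)"
    using integrable_lebesgue_on_subset_ivl[OF wi sub] integrable_lebesgue_on_subset_ivl[OF w(2) sub] .
  have c: "integrable (lebesgue_on {x..y}) (\<lambda>s. l)" "(LINT s|lebesgue_on {x..y}. l) = l * (y - x)"
    using lt continuous_imp_integrable_real[of x y "\<lambda>s. l"] integral_lebesgue_on_ivl[of x y "\<lambda>s. l"] by (auto simp: mult.commute)
  have "prim w y - prim w x = integral {x..y} w"
    using primitive_increment[OF primitive_integral[OF wi]] xy by simp
  also have "\<dots> = (LINT s|lebesgue_on {x..y}. w s)" by (rule integral_lebesgue_on_ivl[OF w1(1), symmetric])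
  finally have "\<bar>prim w y - prim w x\<bar> \<le> (LINT s|lebesgue_on {x..y}. \<bar>w s\<bar>)"
    using integral_norm_bound[of "lebesgue_on {x..y}" w] by simp
  also have "\<dots> \<le> (LINT s|lebesgue_on {x..y}. (l + (w s)\<^sup>2 / l) / 2)"
    using w1 c abs_le_weighted[OF l] by (intro integral_mono) auto
  also have "\<dots> = (l * (y - x) + (LINT s|lebesgue_on {x..y}. (w s)\<^sup>2) / l) / 2"
    using w1 c by simp
  also have "(LINT s|lebesgue_on {x..y}. (w s)\<^sup>2) \<le> (LINT s|lebesgue_on {0..R}. (w s)\<^sup>2)"
    using w(2) sub by (intro integral_mono_lebesgue_on_AE) auto
  also have "\<dots> \<le> B" by (rule B(1))
  finally show ?thesis using l l2 by (simp add: divide_right_mono)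
qed simp

text \<open>The relation \<open>4 * b = 1 + 3 * a\<close> says that 1 is a critical point of the
  bulk potential. It is the quadratic equation of \<open>h_plus\<close> in disguise and gives the
  differential equation its stated form.\<close>

lemma f_bulk_expand:
  assumes "t > 1"
  defines "a \<equiv> h_plus t / t" and "b \<equiv> (h_plus t)\<^sup>2 / (2 * t)"
  shows "f_bulk t s = - s\<^sup>2 / 2 - a * s ^ 3 + b * s ^ 4 + C_const t" "a > 0" "b > 0" "4 * b = 1 + 3 * a"
proof -
  show "f_bulk t s = - s\<^sup>2 / 2 - a * s ^ 3 + b * s ^ 4 + C_const t"
    by (simp add: f_bulk_def bulk_def a_def b_def)
  show "a > 0" "b > 0" using h_plus_root[OF assms(1)] assms(1) by (auto simp: a_def b_def)
  show "4 * b = 1 + 3 * a" using h_plus_root(1)[OF assms(1)] assms(1) by (simp add: a_def b_def field_simps)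
qed

text \<open>The quartic term decides: \<open>r\<^sup>2 * (u / r) ^ 4\<close> is
  \<open>u ^ 4 / r\<^sup>2\<close>, which the growth bound keeps below \<open>B\<^sup>2\<close>. The
  bulk energy is thus dominated by a constant for all competitors of bounded energy.\<close>

lemma scaled_bulk_bound:
  assumes t: "t > 1" and R: "R > 0"
  obtains K where "\<And>u r. 0 < r \<Longrightarrow> r \<le> R \<Longrightarrow> \<bar>u\<bar> \<le> sqrt (B * r) \<Longrightarrow> B > 0 \<Longrightarrow> \<bar>r\<^sup>2 * f_bulk t (u / r)\<bar> \<le> K"
proof -
  define a where "a = h_plus t / t"
  define b where "b = (h_plus t)\<^sup>2 / (2 * t)"
  note fb = f_bulk_expand[OF t, folded a_def b_def]
  define K where "K = B * R / 2 + a * (B * R + B\<^sup>2) / 2 + b * B\<^sup>2 + \<bar>C_const t\<bar> * R\<^sup>2"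
  have "\<bar>r\<^sup>2 * f_bulk t (u / r)\<bar> \<le> K" if r: "0 < r" "r \<le> R" and u: "\<bar>u\<bar> \<le> sqrt (B * r)" and B: "B > 0" for u r
  proof -
    define s where "s = u / r"
    have u2: "u\<^sup>2 \<le> B * r"
      using power_mono[OF u, of 2] B r by simp
    have s2: "r\<^sup>2 * s\<^sup>2 \<le> B * R"
    proof -
      have "r\<^sup>2 * s\<^sup>2 = u\<^sup>2" using r by (simp add: s_def power_divide)
      also have "\<dots> \<le> B * r" by (rule u2)
      also have "\<dots> \<le> B * R" using r B by simp
      finally show ?thesis .
    qed
    have "u ^ 4 \<le> (B * r)\<^sup>2"
      using power_mono[OF u2, of 2] by (simp add: power_mult[symmetric])
    then have s4: "r\<^sup>2 * s ^ 4 \<le> B\<^sup>2"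
      using r by (simp add: s_def power_divide power_mult_distrib field_simps power4_eq_xxxx power2_eq_square)
    \<comment> \<open>The cubic term has no bound of its own; it is interpolated between the
      quadratic and the quartic ones.\<close>
    have "\<bar>s\<bar> * s\<^sup>2 \<le> (1 + s\<^sup>2) / 2 * s\<^sup>2"
      using abs_le_weighted[of 1 s] by (intro mult_right_mono) auto
    then have "\<bar>s ^ 3\<bar> \<le> (s\<^sup>2 + s ^ 4) / 2"
      by (simp add: power_abs power3_eq_cube power4_eq_xxxx power2_eq_square abs_mult algebra_simps)
    then have "r\<^sup>2 * \<bar>s ^ 3\<bar> \<le> r\<^sup>2 * ((s\<^sup>2 + s ^ 4) / 2)" by (intro mult_left_mono) auto
    also have "\<dots> \<le> (B * R + B\<^sup>2) / 2" using s2 s4 by (simp add: algebra_simps)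
    finally have s3: "r\<^sup>2 * \<bar>s ^ 3\<bar> \<le> (B * R + B\<^sup>2) / 2" .
    have c: "r\<^sup>2 * \<bar>C_const t\<bar> \<le> \<bar>C_const t\<bar> * R\<^sup>2"
      using r power_mono[of r R 2] by (simp add: mult.commute mult_left_mono)
    have "\<bar>r\<^sup>2 * f_bulk t s\<bar> = \<bar>- (r\<^sup>2 * s\<^sup>2 / 2) - a * (r\<^sup>2 * s ^ 3) + b * (r\<^sup>2 * s ^ 4) + r\<^sup>2 * C_const t\<bar>"
      unfolding fb(1) by (rule arg_cong[of _ _ abs]) (simp add: algebra_simps)
    also have "\<dots> \<le> r\<^sup>2 * s\<^sup>2 / 2 + a * (r\<^sup>2 * \<bar>s ^ 3\<bar>) + b * (r\<^sup>2 * s ^ 4) + r\<^sup>2 * \<bar>C_const t\<bar>"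
    proof -
      have "\<bar>a * (r\<^sup>2 * s ^ 3)\<bar> = a * (r\<^sup>2 * \<bar>s ^ 3\<bar>)" "\<bar>b * (r\<^sup>2 * s ^ 4)\<bar> = b * (r\<^sup>2 * s ^ 4)"
        "\<bar>r\<^sup>2 * C_const t\<bar> = r\<^sup>2 * \<bar>C_const t\<bar>" "\<bar>r\<^sup>2 * s\<^sup>2 / 2\<bar> = r\<^sup>2 * s\<^sup>2 / 2"
        using fb(2,3) by (simp_all add: abs_mult)
      then show ?thesis by linarith
    qed
    also have "\<dots> \<le> K"
    proof -
      have "a * (r\<^sup>2 * \<bar>s ^ 3\<bar>) \<le> a * ((B * R + B\<^sup>2) / 2)" using s3 fb(2) by (intro mult_left_mono) auto
      moreover have "a * ((B * R + B\<^sup>2) / 2) = a * (B * R + B\<^sup>2) / 2" by simp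
      moreover have "b * (r\<^sup>2 * s ^ 4) \<le> b * B\<^sup>2" using s4 fb(3) by (intro mult_left_mono) auto
      ultimately show ?thesis unfolding K_def using s2 c by linarith
    qed
    finally show ?thesis by (simp add: s_def)
  qed
  then show ?thesis by (rule that)
qed

lemma radial_class_integrable:
  assumes w: "w \<in> radial_class R"
  shows "w \<in> borel_measurable (lebesgue_on {0..R})" "integrable (lebesgue_on {0..R}) (\<lambda>x. (w x)\<^sup>2)"
    "integrable (lebesgue_on {0..R}) (\<lambda>x. (prim w x / x)\<^sup>2)" "integrable (lebesgue_on {0..R}) w"
    "prim w R = R" "primitive R (prim w) w"
proof -
  show 1: "w \<in> borel_measurable (lebesgue_on {0..R})" "integrable (lebesgue_on {0..R}) (\<lambda>x. (w x)\<^sup>2)"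
    "integrable (lebesgue_on {0..R}) (\<lambda>x. (prim w x / x)\<^sup>2)" "prim w R = R"
    using w unfolding radial_class_def mem_Collect_eq by blast+
  show 2: "integrable (lebesgue_on {0..R}) w" by (rule L2_integrable[OF 1(1,2)])
  show "primitive R (prim w) w" by (rule primitive_integral[OF 2])
qed

lemma radial_class_growth:
  assumes w: "w \<in> borel_measurable (lebesgue_on {0..R})" "integrable (lebesgue_on {0..R}) (\<lambda>x. (w x)\<^sup>2)"
    and B: "(LINT x|lebesgue_on {0..R}. (w x)\<^sup>2) \<le> B" "B > 0" and x: "x \<in> {0..R}"
  shows "\<bar>prim w x\<bar> \<le> sqrt (B * x)"
  using primitive_Hoelder[OF w B, of 0 x] x by simp

lemma f_bulk_continuous: "continuous_on S (f_bulk t)"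
  unfolding f_bulk_def[abs_def] bulk_def divide_inverse by (intro continuous_intros)

lemma measurable_scaled_bulk:
  assumes c: "continuous_on {0..R} u"
  shows "(\<lambda>r. r\<^sup>2 * f_bulk t (u r / r)) \<in> borel_measurable (lebesgue_on {0..R})"
    "(\<lambda>r. (u r / r)\<^sup>2) \<in> borel_measurable (lebesgue_on {0..R})"
proof -
  have [measurable]: "u \<in> borel_measurable (lebesgue_on {0..R})" "(\<lambda>r. r) \<in> borel_measurable (lebesgue_on {0..R})"
    using c by (auto intro!: continuous_imp_measurable_on_sets_lebesgue continuous_intros)
  have [measurable]: "f_bulk t \<in> borel_measurable borel"
    by (rule borel_measurable_continuous_onI[OF f_bulk_continuous])
  show "(\<lambda>r. r\<^sup>2 * f_bulk t (u r / r)) \<in> borel_measurable (lebesgue_on {0..R})"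
    "(\<lambda>r. (u r / r)\<^sup>2) \<in> borel_measurable (lebesgue_on {0..R})"
    by measurable
qed

text \<open>The bound is asked only for positive arguments, where quotients by \<open>x\<close> have
  their usual meaning; the value at 0 is absorbed into the constant.\<close>

lemma integrable_bounded_ivl:
  fixes f :: "real \<Rightarrow> real"
  assumes m: "f \<in> borel_measurable (lebesgue_on {0..R})" and b: "\<And>x. 0 < x \<Longrightarrow> x \<le> R \<Longrightarrow> \<bar>f x\<bar> \<le> K"
  shows "integrable (lebesgue_on {0..R}) f"
proof (rule Bochner_Integration.integrable_bound[OF _ m])
  show "integrable (lebesgue_on {0..R}) (\<lambda>x. max K \<bar>f 0\<bar>)"
    by (rule continuous_imp_integrable_real) simp
  show "AE x in lebesgue_on {0..R}. norm (f x) \<le> norm (max K \<bar>f 0\<bar>)"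
  proof (rule AE_I2)
    fix x assume "x \<in> space (lebesgue_on {0..R})"
    then show "norm (f x) \<le> norm (max K \<bar>f 0\<bar>)" using b[of x] by (cases "x = 0") auto
  qed
qed

lemma scaled_bulk_integrable:
  assumes t: "t > 1" and R: "R > 0" and u: "continuous_on {0..R} u"
    and g: "\<And>x. x \<in> {0..R} \<Longrightarrow> \<bar>u x\<bar> \<le> sqrt (B * x)" "B > 0"
  shows "integrable (lebesgue_on {0..R}) (\<lambda>r. r\<^sup>2 * f_bulk t (u r / r))"
proof -
  obtain K where "\<And>u r. 0 < r \<Longrightarrow> r \<le> R \<Longrightarrow> \<bar>u\<bar> \<le> sqrt (B * r) \<Longrightarrow> B > 0 \<Longrightarrow> \<bar>r\<^sup>2 * f_bulk t (u / r)\<bar> \<le> K"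
    by (rule scaled_bulk_bound[OF t R, of B]) blast
  then show ?thesis using g by (intro integrable_bounded_ivl[of _ R K] measurable_scaled_bulk u) auto
qed

lemma radial_class_bulk_integrable:
  assumes t: "t > 1" and R: "R > 0" and w: "w \<in> radial_class R"
  shows "integrable (lebesgue_on {0..R}) (\<lambda>r. r\<^sup>2 * f_bulk t (prim w r / r))"
proof -
  note wi = radial_class_integrable[OF w]
  define B where "B = (LINT x|lebesgue_on {0..R}. (w x)\<^sup>2) + 1"
  have B: "(LINT x|lebesgue_on {0..R}. (w x)\<^sup>2) \<le> B" "B > 0"
  proof -
    have "0 \<le> (LINT x|lebesgue_on {0..R}. (w x)\<^sup>2)" by (rule Bochner_Integration.integral_nonneg) simp
    then show "(LINT x|lebesgue_on {0..R}. (w x)\<^sup>2) \<le> B" "B > 0" unfolding B_def by linarith+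
  qed
  show ?thesis
    by (rule scaled_bulk_integrable[OF t R primitive_continuous[OF wi(6)] radial_class_growth[OF wi(1,2) B] B(2)])
qed

lemma radial_density_integrable:
  assumes t: "t > 1" and R: "R > 0" and w: "w \<in> radial_class R"
  shows "integrable (lebesgue_on {0..R}) (radial_density t w)"
  unfolding radial_density_def[abs_def]
  using radial_class_integrable[OF w] radial_class_bulk_integrable[OF assms] by simp

lemma J_radial_expand:
  assumes t: "t > 1" and R: "R > 0" and w: "w \<in> radial_class R"
  shows "J_radial t R w = 1/2 * (LINT r|lebesgue_on {0..R}. (w r)\<^sup>2) +
    3 * (LINT r|lebesgue_on {0..R}. (prim w r / r)\<^sup>2) + (LINT r|lebesgue_on {0..R}. r\<^sup>2 * f_bulk t (prim w r / r))"
  unfolding J_radial_def radial_density_def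
  using radial_class_integrable[OF w] radial_class_bulk_integrable[OF assms] by simp

lemma radial_density_nonneg: "t > 1 \<Longrightarrow> 0 \<le> radial_density t w r"
  unfolding radial_density_def by (intro add_nonneg_nonneg mult_nonneg_nonneg C_const_eq(2)) auto

lemma exists_J_minimizer:
  assumes t: "t > 1" and R: "R > 0"
  shows "\<exists>w\<in>radial_class R. \<forall>v\<in>radial_class R. J_radial t R w \<le> J_radial t R v"
proof -
  let ?M = "lebesgue_on {0..R}"
  let ?E = "\<lambda>u. LINT r|?M. r\<^sup>2 * f_bulk t (u r / r)"
  define m where "m = Inf (J_radial t R ` radial_class R)"
  have J0: "0 \<le> J_radial t R w" for w
    unfolding J_radial_def by (intro Bochner_Integration.integral_nonneg radial_density_nonneg t)
  \<comment> \<open>The constant density 1 belongs to the profile \<open>h = 1\<close>.\<close>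
  have ne: "(\<lambda>x. 1) \<in> radial_class R"
  proof -
    have p: "prim (\<lambda>x. 1) x = x" if "0 \<le> x" for x :: real using that by simp
    have "integrable ?M (\<lambda>x. (prim (\<lambda>x. 1) x / x)\<^sup>2)"
    proof (rule integrable_bounded_ivl[of _ _ 1])
      show "(\<lambda>x. (prim (\<lambda>x. 1) x / x)\<^sup>2) \<in> borel_measurable ?M"
        by (intro measurable_scaled_bulk(2) indefinite_integral_continuous_1 integrable_continuous_real) simp
      show "\<bar>(prim (\<lambda>x. 1) x / x)\<^sup>2\<bar> \<le> 1" if "0 < x" for x :: real using p[of x] that by simp
    qed
    then show ?thesis using R p[of R] by (auto simp: radial_class_def intro: continuous_imp_integrable_real)
  qed
  have bdd: "bdd_below (J_radial t R ` radial_class R)" using J0 by (auto intro!: bdd_belowI[of _ 0])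
  have mle: "m \<le> J_radial t R v" if "v \<in> radial_class R" for v
    unfolding m_def using that bdd by (intro cInf_lower) auto
  have "\<exists>w\<in>radial_class R. J_radial t R w < m + 1 / real (Suc n)" for n
  proof -
    have "Inf (J_radial t R ` radial_class R) < m + 1 / real (Suc n)" by (simp add: m_def)
    then show ?thesis using ne by (subst (asm) cInf_less_iff) (auto intro: bdd)
  qed
  then obtain w where w: "\<And>n. w n \<in> radial_class R" "\<And>n. J_radial t R (w n) < m + 1 / real (Suc n)"
    by metis
  have m0: "m \<ge> 0" unfolding m_def using ne J0 by (intro cInf_greatest) auto
  \<comment> \<open>Half the square norm of \<open>w\<close> is at most \<open>J\<close>, and
    \<open>J\<close> stays below \<open>m + 1\<close> along the sequence.\<close>
  define B where "B = 2 * (m + 1)"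
  have B: "B > 0" using m0 by (simp add: B_def)
  have wB: "(LINT x|?M. (w n x)\<^sup>2) \<le> B" for n
  proof -
    have "0 \<le> (LINT r|?M. (prim (w n) r / r)\<^sup>2)" "0 \<le> ?E (prim (w n))"
      using C_const_eq(2)[OF t] by (auto intro!: Bochner_Integration.integral_nonneg)
    moreover have "J_radial t R (w n) < m + 1"
      by (rule order_less_le_trans[OF w(2)]) simp
    moreover have "a \<le> 2 * (m + 1)" if "J = 1/2 * a + 3 * b + c" "0 \<le> b" "0 \<le> c" "J < m + 1" for J a b c :: real
      using that by argo
    ultimately show ?thesis using J_radial_expand[OF t R w(1)[of n]] unfolding B_def by blast
  qed
  note wi = radial_class_integrable[OF w(1)]
  note hol = primitive_Hoelder[OF wi(1,2) wB B]
  note gr = radial_class_growth[OF wi(1,2) wB B]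
  have eqc: "\<exists>d>0. \<forall>n y. y \<in> {0..R} \<and> norm (x - y) < d \<longrightarrow> norm (prim (w n) x - prim (w n) y) < e"
    if "x \<in> {0..R}" "0 < e" for x e :: real
  proof (intro exI[of _ "e\<^sup>2 / B"] conjI allI impI)
    show "0 < e\<^sup>2 / B" using B that by simp
    fix n y assume y: "y \<in> {0..R} \<and> norm (x - y) < e\<^sup>2 / B"
    have "\<bar>prim (w n) x - prim (w n) y\<bar> \<le> sqrt (B * \<bar>x - y\<bar>)"
      using hol[of x y n] hol[of y x n] y that by (cases "x \<le> y") (auto simp: abs_minus_commute)
    also have "\<dots> < sqrt (e\<^sup>2)"
      using y B by (intro real_sqrt_less_mono) (auto simp: field_simps)
    finally show "norm (prim (w n) x - prim (w n) y) < e" using that by simp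
  qed
  have bnd: "norm (prim (w n) x) \<le> sqrt (B * R)" if "x \<in> {0..R}" for n x
  proof -
    have "sqrt (B * x) \<le> sqrt (B * R)" using that B by simp
    then show ?thesis unfolding real_norm_def by (rule order_trans[OF gr[OF that]])
  qed
  have "\<exists>g k. continuous_on {0..R} g \<and> strict_mono (k :: nat \<Rightarrow> nat) \<and>
      (\<forall>e>0. \<exists>N. \<forall>n x. n \<ge> N \<and> x \<in> {0..R} \<longrightarrow> norm (prim (w (k n)) x - g x) < e)"
  proof (rule Arzela_Ascoli[of "{0..R}" "\<lambda>n. prim (w n)" "sqrt (B * R)"])
    show "norm (prim (w n) x) \<le> sqrt (B * R)" if "x \<in> {0..R}" for n x by (rule bnd[OF that])
    show "\<exists>d>0. \<forall>n y. y \<in> {0..R} \<and> norm (x - y) < d \<longrightarrow> norm (prim (w n) x - prim (w n) y) < e"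
      if "x \<in> {0..R}" "0 < e" for x e by (rule eqc[OF that])
  qed (simp, blast)
  then obtain g k where g: "continuous_on {0..R} g" "strict_mono (k :: nat \<Rightarrow> nat)"
      "\<forall>e>0. \<exists>N. \<forall>n x. n \<ge> N \<and> x \<in> {0..R} \<longrightarrow> norm (prim (w (k n)) x - g x) < e"
    by blast
  define v where "v = (\<lambda>n. w (k n))"
  have v: "v n \<in> radial_class R" for n unfolding v_def by (rule w)
  have vB: "(LINT x|?M. (v n x)\<^sup>2) \<le> B" for n unfolding v_def by (rule wB)
  note vi = radial_class_integrable[OF v]
  have vlim: "(\<lambda>n. prim (v n) x) \<longlonglongrightarrow> g x" if "x \<in> {0..R}" for x
    unfolding LIMSEQ_iff v_def using g(3) that by blast
  have Jv: "(\<lambda>n. J_radial t R (v n)) \<longlonglongrightarrow> m"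
  proof (rule tendsto_sandwich[of "\<lambda>n. m" _ _ "\<lambda>n. m + 1 / real (Suc n)"])
    show "\<forall>\<^sub>F n in sequentially. J_radial t R (v n) \<le> m + 1 / real (Suc n)"
    proof (rule always_eventually, rule allI)
      fix n
      have "1 / real (Suc (k n)) \<le> 1 / real (Suc n)"
        using seq_suble[OF g(2), of n] by (intro divide_left_mono) auto
      then show "J_radial t R (v n) \<le> m + 1 / real (Suc n)" using w(2)[of "k n"] unfolding v_def by linarith
    qed
    have "(\<lambda>n. m + 1 / real (Suc n)) \<longlonglongrightarrow> m + 0"
      by (intro tendsto_add tendsto_const LIMSEQ_Suc[OF lim_1_over_n])
    then show "(\<lambda>n. m + 1 / real (Suc n)) \<longlonglongrightarrow> m" by simp
  qed (use mle v in auto)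
  obtain K where K: "\<And>u r. 0 < r \<Longrightarrow> r \<le> R \<Longrightarrow> \<bar>u\<bar> \<le> sqrt (B * r) \<Longrightarrow> B > 0 \<Longrightarrow> \<bar>r\<^sup>2 * f_bulk t (u / r)\<bar> \<le> K"
    by (rule scaled_bulk_bound[OF t R, of B]) blast
  \<comment> \<open>Pointwise convergence with the common growth bound suffices for the bulk term,
    so its lack of convexity does no harm.\<close>
  have Elim: "(\<lambda>n. ?E (u n)) \<longlonglongrightarrow> ?E g"
    if u: "\<And>n. continuous_on {0..R} (u n)" "\<And>n x. x \<in> {0..R} \<Longrightarrow> \<bar>u n x\<bar> \<le> sqrt (B * x)"
      "\<And>x. x \<in> {0..R} \<Longrightarrow> (\<lambda>n. u n x) \<longlonglongrightarrow> g x" for u :: "nat \<Rightarrow> real \<Rightarrow> real"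
  proof (rule integral_dominated_convergence)
    show "integrable ?M (\<lambda>x. max K 0)" by (rule continuous_imp_integrable_real) simp
    show "AE r in ?M. (\<lambda>n. r\<^sup>2 * f_bulk t (u n r / r)) \<longlonglongrightarrow> r\<^sup>2 * f_bulk t (g r / r)"
    proof (rule AE_I2)
      fix r assume "r \<in> space ?M"
      then have "(\<lambda>n. u n r / r) \<longlonglongrightarrow> g r / r" using u(3)[of r] unfolding divide_inverse by (auto intro: tendsto_mult_right)
      then show "(\<lambda>n. r\<^sup>2 * f_bulk t (u n r / r)) \<longlonglongrightarrow> r\<^sup>2 * f_bulk t (g r / r)"
        using f_bulk_continuous[of UNIV t]
        by (intro tendsto_mult tendsto_const) (auto intro: continuous_on_tendsto_compose)
    qed
    show "AE r in ?M. norm (r\<^sup>2 * f_bulk t (u n r / r)) \<le> max K 0" for n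
    proof (rule AE_I2)
      fix r assume "r \<in> space ?M"
      then show "norm (r\<^sup>2 * f_bulk t (u n r / r)) \<le> max K 0"
        using K[of r "u n r"] u(2)[of r n] B by (cases "r = 0") auto
    qed
  qed (intro measurable_scaled_bulk g u)+
  \<comment> \<open>Stated for two arbitrary index sequences, so that the Cauchy property follows by
    contradiction from a choice of bad pairs. The quadratic part of \<open>J\<close> is uniformly
    convex in \<open>w\<close>, and the bulk terms of both sequences and of their midpoints have the
    same limit.\<close>
  have conv: "(\<lambda>n. LINT x|?M. (v (p n) x - v (q n) x)\<^sup>2) \<longlonglongrightarrow> 0"
    if p: "filterlim p at_top sequentially" and q: "filterlim q at_top sequentially" for p q :: "nat \<Rightarrow> nat"
  proof -
    define z where "z = (\<lambda>n x. (v (p n) x + v (q n) x) / 2)"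
    define y where "y = (\<lambda>n x. v (p n) x - v (q n) x)"
    have prz: "prim (z n) x = (prim (v (p n)) x + prim (v (q n)) x) / 2" if x: "x \<in> {0..R}" for n x
    proof -
      have "v j integrable_on {0..x}" for j
        using integrable_lebesgue_on_subset_ivl[OF vi(4), of 0 x j] x by (auto intro: integrable_on_of_lebesgue_ivl)
      then show ?thesis unfolding z_def by (simp add: Henstock_Kurzweil_Integration.integral_add)
    qed
    have [measurable]: "v n \<in> borel_measurable ?M" for n by (rule vi)
    have half: "((a + b) / 2)\<^sup>2 \<le> (a\<^sup>2 + b\<^sup>2) / 2" for a b :: real
      using zero_le_power2[of "a - b"] by (simp add: power2_eq_square field_simps)
    have z2: "integrable ?M (\<lambda>x. (z n x)\<^sup>2)" for n
    proof (rule Bochner_Integration.integrable_bound)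
      show "integrable ?M (\<lambda>x. ((v (p n) x)\<^sup>2 + (v (q n) x)\<^sup>2) / 2)" using vi(2) by simp
    qed (use half in \<open>auto simp: z_def\<close>)
    have zi: "integrable ?M (z n)" for n unfolding z_def using vi(4) by simp
    have phalf: "(prim (z n) x / x)\<^sup>2 \<le> ((prim (v (p n)) x / x)\<^sup>2 + (prim (v (q n)) x / x)\<^sup>2) / 2"
      if "x \<in> {0..R}" for n x
    proof -
      have "prim (z n) x / x = (prim (v (p n)) x / x + prim (v (q n)) x / x) / 2"
        using prz[OF that, of n] by (simp add: add_divide_distrib)
      then show ?thesis by (simp only: half)
    qed
    have z3: "integrable ?M (\<lambda>x. (prim (z n) x / x)\<^sup>2)" for n
    proof (rule Bochner_Integration.integrable_bound)
      show "integrable ?M (\<lambda>x. ((prim (v (p n)) x / x)\<^sup>2 + (prim (v (q n)) x / x)\<^sup>2) / 2)" using vi(3) by simp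
      show "(\<lambda>x. (prim (z n) x / x)\<^sup>2) \<in> borel_measurable ?M"
        by (rule measurable_scaled_bulk(2)[OF primitive_continuous[OF primitive_integral[OF zi]]])
      show "AE x in ?M. norm ((prim (z n) x / x)\<^sup>2) \<le> norm (((prim (v (p n)) x / x)\<^sup>2 + (prim (v (q n)) x / x)\<^sup>2) / 2)"
        using phalf by (intro AE_I2) simp
    qed
    have zX: "z n \<in> radial_class R" for n
      using z2 z3 prz[of R n] vi(5) R by (auto simp: radial_class_def z_def)
    have y2: "integrable ?M (\<lambda>x. (y n x)\<^sup>2)" for n
    proof (rule Bochner_Integration.integrable_bound)
      show "integrable ?M (\<lambda>x. 2 * ((v (p n) x)\<^sup>2 + (v (q n) x)\<^sup>2))" using vi(2) by simp
      have "(a - b)\<^sup>2 \<le> 2 * (a\<^sup>2 + b\<^sup>2)" for a b :: real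
        using zero_le_power2[of "a + b"] by (simp add: power2_eq_square field_simps)
      then show "AE x in ?M. norm ((y n x)\<^sup>2) \<le> norm (2 * ((v (p n) x)\<^sup>2 + (v (q n) x)\<^sup>2))"
        by (intro AE_I2) (simp add: y_def)
    qed (simp add: y_def)
    \<comment> \<open>the parallelogram law, with \<open>J \<ge> m\<close> at the midpoint\<close>
    have par: "1/8 * (LINT x|?M. (y n x)\<^sup>2) \<le>
      (J_radial t R (v (p n)) + J_radial t R (v (q n))) / 2 - m
       - (?E (prim (v (p n))) + ?E (prim (v (q n)))) / 2 + ?E (prim (z n))" for n
    proof -
      have 1: "(LINT x|?M. (z n x)\<^sup>2) = ((LINT x|?M. (v (p n) x)\<^sup>2) + (LINT x|?M. (v (q n) x)\<^sup>2)) / 2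
        - (LINT x|?M. (y n x)\<^sup>2) / 4"
      proof -
        have "(LINT x|?M. (z n x)\<^sup>2) = (LINT x|?M. ((v (p n) x)\<^sup>2 + (v (q n) x)\<^sup>2) / 2 - (y n x)\<^sup>2 / 4)"
          by (rule Bochner_Integration.integral_cong) (auto simp: z_def y_def power2_eq_square field_simps)
        then show ?thesis using vi(2) y2 by simp
      qed
      have 2: "(LINT x|?M. (prim (z n) x / x)\<^sup>2) \<le>
        ((LINT x|?M. (prim (v (p n)) x / x)\<^sup>2) + (LINT x|?M. (prim (v (q n)) x / x)\<^sup>2)) / 2"
      proof -
        have "(LINT x|?M. (prim (z n) x / x)\<^sup>2) \<le> (LINT x|?M. ((prim (v (p n)) x / x)\<^sup>2 + (prim (v (q n)) x / x)\<^sup>2) / 2)"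
          using vi(3) phalf by (intro integral_mono[OF z3]) auto
        then show ?thesis using vi(3) by simp
      qed
      show ?thesis
      proof -
        have "1/8 * y2 \<le> (Jp + Jq) / 2 - m - (Ep + Eq) / 2 + Ez"
          if "m \<le> Jz" "z2 = (p2 + q2) / 2 - y2 / 4" "z3 \<le> (p3 + q3) / 2" "Jz = 1/2 * z2 + 3 * z3 + Ez"
            "Jp = 1/2 * p2 + 3 * p3 + Ep" "Jq = 1/2 * q2 + 3 * q3 + Eq"
          for Jp Jq Jz p2 q2 y2 z2 p3 q3 z3 Ep Eq Ez :: real
          using that by argo
        from this[OF mle[OF zX[of n]] 1 2 J_radial_expand[OF t R zX[of n]] J_radial_expand[OF t R v[of "p n"]]
          J_radial_expand[OF t R v[of "q n"]]] show ?thesis .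
      qed
    qed
    have zB: "(LINT x|?M. (z n x)\<^sup>2) \<le> B" for n
    proof -
      have "(LINT x|?M. (z n x)\<^sup>2) \<le> (LINT x|?M. ((v (p n) x)\<^sup>2 + (v (q n) x)\<^sup>2) / 2)"
        using half vi(2) by (intro integral_mono[OF z2]) (auto simp: z_def)
      also have "\<dots> = ((LINT x|?M. (v (p n) x)\<^sup>2) + (LINT x|?M. (v (q n) x)\<^sup>2)) / 2" using vi(2) by simp
      finally show ?thesis using vB[of "p n"] vB[of "q n"] by simp
    qed
    have E1: "(\<lambda>n. ?E (prim (v n))) \<longlonglongrightarrow> ?E g"
      by (intro Elim primitive_continuous[OF vi(6)] radial_class_growth[OF vi(1,2) vB B] vlim)
    have E2: "(\<lambda>n. ?E (prim (z n))) \<longlonglongrightarrow> ?E g"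
    proof (intro Elim primitive_continuous[OF primitive_integral[OF zi]])
      show "\<bar>prim (z n) x\<bar> \<le> sqrt (B * x)" if "x \<in> {0..R}" for n x
        using radial_class_growth[OF _ z2 zB B that] by (simp add: z_def)
      show "(\<lambda>n. prim (z n) x) \<longlonglongrightarrow> g x" if x: "x \<in> {0..R}" for x
      proof -
        have "(\<lambda>n. (prim (v (p n)) x + prim (v (q n)) x) / 2) \<longlonglongrightarrow> (g x + g x) / 2"
          by (intro tendsto_intros filterlim_compose[OF vlim[OF x]] p q) simp
        then show ?thesis unfolding prz[OF x] by simp
      qed
    qed
    have lim: "(\<lambda>n. 8 * ((J_radial t R (v (p n)) + J_radial t R (v (q n))) / 2 - m
       - (?E (prim (v (p n))) + ?E (prim (v (q n)))) / 2 + ?E (prim (z n))))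
      \<longlonglongrightarrow> 8 * ((m + m) / 2 - m - (?E g + ?E g) / 2 + ?E g)"
      by (intro tendsto_intros filterlim_compose[OF Jv] filterlim_compose[OF E1] E2 p q) simp_all
    then have lim0: "(\<lambda>n. 8 * ((J_radial t R (v (p n)) + J_radial t R (v (q n))) / 2 - m
       - (?E (prim (v (p n))) + ?E (prim (v (q n)))) / 2 + ?E (prim (z n)))) \<longlonglongrightarrow> 0"
      by simp
    have "(\<lambda>n. LINT x|?M. (y n x)\<^sup>2) \<longlonglongrightarrow> 0"
    proof (rule tendsto_sandwich[OF _ _ tendsto_const lim0])
      show "\<forall>\<^sub>F n in sequentially. 0 \<le> (LINT x|?M. (y n x)\<^sup>2)"
        by (intro always_eventually allI Bochner_Integration.integral_nonneg) simp
      show "\<forall>\<^sub>F n in sequentially. (LINT x|?M. (y n x)\<^sup>2) \<le> 8 * ((J_radial t R (v (p n)) + J_radial t R (v (q n))) / 2 - m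
       - (?E (prim (v (p n))) + ?E (prim (v (q n)))) / 2 + ?E (prim (z n)))"
      proof (intro always_eventually allI)
        have "b \<le> 8 * c" if "1/8 * b \<le> c" for b c :: real using that by argo
        then show "(LINT x|?M. (y n x)\<^sup>2) \<le> 8 * ((J_radial t R (v (p n)) + J_radial t R (v (q n))) / 2 - m
          - (?E (prim (v (p n))) + ?E (prim (v (q n)))) / 2 + ?E (prim (z n)))" for n using par[of n] .
      qed
    qed
    then show ?thesis by (simp add: y_def)
  qed
  have Cauchy: "\<exists>N. \<forall>i\<ge>N. \<forall>j\<ge>N. (LINT x|?M. (v i x - v j x)\<^sup>2) < e" if e: "e > 0" for e
  proof (rule ccontr)
    assume "\<not> ?thesis"
    then have "\<forall>N. \<exists>i j. N \<le> i \<and> N \<le> j \<and> \<not> (LINT x|?M. (v i x - v j x)\<^sup>2) < e" by blast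
    then obtain p q where pq: "\<And>N. N \<le> p N" "\<And>N. N \<le> q N" "\<And>N. \<not> (LINT x|?M. (v (p N) x - v (q N) x)\<^sup>2) < e"
      by metis
    have "filterlim p at_top sequentially" "filterlim q at_top sequentially"
      using pq(1,2) by (auto intro!: filterlim_at_top_mono[OF filterlim_ident])
    from conv[OF this] have "\<forall>\<^sub>F n in sequentially. (LINT x|?M. (v (p n) x - v (q n) x)\<^sup>2) < e"
      using e by (rule order_tendstoD)
    then show False using pq(3) by (simp add: eventually_sequentially)
  qed
  have "\<exists>N. \<forall>i\<ge>N. \<forall>j\<ge>N. (LINT x|?M. \<bar>v i x - v j x\<bar>) \<le> (1/2) ^ n" for n
  proof -
    \<comment> \<open>Chosen so that in the weighted inequality both \<open>l * R\<close> and, for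
      square norms below \<open>l * (1/2) ^ n\<close>, the quotient by \<open>l\<close> are at most
      \<open>(1/2) ^ n\<close>. This converts the Cauchy property in L2 to geometric increments in
      L1.\<close>
    define l where "l = (1/2) ^ n / R"
    have l: "l > 0" using R by (simp add: l_def)
    then have "l * (1/2) ^ n > 0" by simp
    from Cauchy[OF this] obtain N where
      N: "\<And>i j. i \<ge> N \<Longrightarrow> j \<ge> N \<Longrightarrow> (LINT x|?M. (v i x - v j x)\<^sup>2) < l * (1/2) ^ n" by blast
    have "(LINT x|?M. \<bar>v i x - v j x\<bar>) \<le> (1/2) ^ n" if ij: "i \<ge> N" "j \<ge> N" for i j
    proof -
      have [measurable]: "v n \<in> borel_measurable ?M" for n by (rule vi)
      have y2: "integrable ?M (\<lambda>x. (v i x - v j x)\<^sup>2)"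
      proof (rule Bochner_Integration.integrable_bound)
        show "integrable ?M (\<lambda>x. 2 * ((v i x)\<^sup>2 + (v j x)\<^sup>2))" using vi(2) by simp
        have "(a - b)\<^sup>2 \<le> 2 * (a\<^sup>2 + b\<^sup>2)" for a b :: real
          using zero_le_power2[of "a + b"] by (simp add: power2_eq_square field_simps)
        then show "AE x in ?M. norm ((v i x - v j x)\<^sup>2) \<le> norm (2 * ((v i x)\<^sup>2 + (v j x)\<^sup>2))"
          by (intro AE_I2) simp
      qed simp
      have c: "integrable ?M (\<lambda>s. l)" "(LINT s|?M. l) = l * R"
        using R continuous_imp_integrable_real[of 0 R "\<lambda>s. l"] integral_lebesgue_on_ivl[of 0 R "\<lambda>s. l"] by (auto simp: mult.commute)
      have "(LINT x|?M. \<bar>v i x - v j x\<bar>) \<le> (LINT x|?M. (l + (v i x - v j x)\<^sup>2 / l) / 2)"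
        using y2 c vi(4) abs_le_weighted[OF l] by (intro integral_mono) auto
      also have "\<dots> = (l * R + (LINT x|?M. (v i x - v j x)\<^sup>2) / l) / 2"
        using y2 c by simp
      also have "\<dots> \<le> (l * R + (1/2) ^ n) / 2"
        using less_imp_le[OF N[OF ij]] l by (simp add: divide_le_eq mult.commute)
      also have "\<dots> = (1/2) ^ n" using R by (simp add: l_def)
      finally show ?thesis .
    qed
    then show ?thesis by blast
  qed
  then obtain N where N: "\<And>n i j. N n \<le> i \<Longrightarrow> N n \<le> j \<Longrightarrow> (LINT x|?M. \<bar>v i x - v j x\<bar>) \<le> (1/2) ^ n"
    by metis
  \<comment> \<open>The running sum makes both \<open>s n\<close> and \<open>s (Suc n)\<close>
    exceed \<open>N n\<close>, and the summand \<open>n\<close> makes \<open>s\<close> tend to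
    infinity.\<close>
  define s where "s = (\<lambda>n. n + (\<Sum>i\<le>n. N i))"
  have sN: "N n \<le> s n" "N n \<le> s (Suc n)" "n \<le> s n" for n
  proof -
    have "N n \<le> (\<Sum>i\<le>n. N i)" by (rule member_le_sum) auto
    then show "N n \<le> s n" "N n \<le> s (Suc n)" "n \<le> s n" by (auto simp: s_def)
  qed
  have sl: "filterlim s at_top sequentially"
    by (rule filterlim_at_top_mono[OF filterlim_ident]) (use sN(3) in simp)
  define f where "f = (\<lambda>n. v (s n))"
  have fX: "f n \<in> radial_class R" for n unfolding f_def by (rule v)
  note fi = radial_class_integrable[OF fX]
  have "\<exists>F. integrable ?M F \<and> (AE x in ?M. (\<lambda>n. f n x) \<longlonglongrightarrow> F x) \<and>
    (\<lambda>n. \<integral>x. \<bar>f n x - F x\<bar> \<partial>?M) \<longlonglongrightarrow> 0"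
    by (rule L1_summable_limit[OF fi(4)]) (unfold f_def, rule N, rule sN, rule sN)
  then obtain F where F: "integrable ?M F" "AE x in ?M. (\<lambda>n. f n x) \<longlonglongrightarrow> F x"
    "(\<lambda>n. \<integral>x. \<bar>f n x - F x\<bar> \<partial>?M) \<longlonglongrightarrow> 0" by blast
  have Fm: "F \<in> borel_measurable ?M" using F(1) by (rule borel_measurable_integrable)
  have flim: "(\<lambda>n. prim (f n) x) \<longlonglongrightarrow> g x" if "x \<in> {0..R}" for x
    unfolding f_def by (rule filterlim_compose[OF vlim[OF that] sl])
  have prF: "prim F x = g x" if x: "x \<in> {0..R}" for x
  proof (rule LIMSEQ_unique[OF _ flim[OF x]])
    have "(\<lambda>n. prim (f n) x - prim F x) \<longlonglongrightarrow> 0"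
    proof (rule tendsto_rabs_zero_cancel, rule tendsto_sandwich[OF _ _ tendsto_const F(3)])
      have sub: "{0..x} \<subseteq> {0..R}" using x by auto
      have "\<bar>prim (f n) x - prim F x\<bar> \<le> (\<integral>y. \<bar>f n y - F y\<bar> \<partial>?M)" for n
      proof -
        have i: "integrable (lebesgue_on {0..x}) (f n)" "integrable (lebesgue_on {0..x}) F"
          using integrable_lebesgue_on_subset_ivl[OF fi(4) sub] integrable_lebesgue_on_subset_ivl[OF F(1) sub] .
        have "prim (f n) x - prim F x = (LINT y|lebesgue_on {0..x}. f n y - F y)"
          using i by (simp add: integral_lebesgue_on_ivl)
        then have "\<bar>prim (f n) x - prim F x\<bar> \<le> (LINT y|lebesgue_on {0..x}. \<bar>f n y - F y\<bar>)"
          using integral_norm_bound[of "lebesgue_on {0..x}" "\<lambda>y. f n y - F y"] by simp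
        also have "\<dots> \<le> (\<integral>y. \<bar>f n y - F y\<bar> \<partial>?M)"
          using fi(4) F(1) sub by (intro integral_mono_lebesgue_on_AE) auto
        finally show ?thesis .
      qed
      then show "\<forall>\<^sub>F n in sequentially. \<bar>prim (f n) x - prim F x\<bar> \<le> (\<integral>y. \<bar>f n y - F y\<bar> \<partial>?M)" by simp
    qed simp
    then show "(\<lambda>n. prim (f n) x) \<longlonglongrightarrow> prim F x" by (simp add: LIM_zero_iff)
  qed
  have dm: "radial_density t y \<in> borel_measurable ?M"
    if "y \<in> borel_measurable ?M" "continuous_on {0..R} (prim y)" for y
    unfolding radial_density_def[abs_def]
    by (intro borel_measurable_add measurable_scaled_bulk[OF that(2)]
      borel_measurable_times[OF borel_measurable_const measurable_scaled_bulk(2)[OF that(2)]]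
      borel_measurable_times[OF borel_measurable_const borel_measurable_power[OF that(1)]])
  have Fc: "continuous_on {0..R} (prim F)"
    by (rule primitive_continuous[OF primitive_integral[OF F(1)]])
  note dF = dm[OF Fm Fc]
  note df = dm[OF fi(1) primitive_continuous[OF fi(6)]]
  have dlim: "AE r in ?M. (\<lambda>n. radial_density t (f n) r) \<longlonglongrightarrow> radial_density t F r"
  proof -
    have "AE r in ?M. r \<in> {0..R}" by (rule AE_I2) simp
    then show ?thesis using F(2)
    proof eventually_elim
      case (elim r)
      have "(\<lambda>n. prim (f n) r) \<longlonglongrightarrow> prim F r" using flim[OF elim(1)] prF[OF elim(1)] by simp
      then have q: "(\<lambda>n. prim (f n) r / r) \<longlonglongrightarrow> prim F r / r"
        unfolding divide_inverse by (rule tendsto_mult_right)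
      then have "(\<lambda>n. f_bulk t (prim (f n) r / r)) \<longlonglongrightarrow> f_bulk t (prim F r / r)"
        using f_bulk_continuous[of UNIV t] by (auto intro: continuous_on_tendsto_compose)
      then show ?case unfolding radial_density_def
        by (intro tendsto_add tendsto_mult tendsto_const tendsto_power q elim(2))
    qed
  qed
  \<comment> \<open>Fatou's lemma. It works with values in the extended reals because integrability
    of the density of \<open>F\<close> is not known yet; it comes out as a consequence.\<close>
  have "(\<integral>\<^sup>+r. ennreal (radial_density t F r) \<partial>?M) = (\<integral>\<^sup>+r. liminf (\<lambda>n. ennreal (radial_density t (f n) r)) \<partial>?M)"
  proof (rule nn_integral_cong_AE)
    show "AE r in ?M. ennreal (radial_density t F r) = liminf (\<lambda>n. ennreal (radial_density t (f n) r))"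
      using dlim
    proof eventually_elim
      case (elim r)
      then have "(\<lambda>n. ennreal (radial_density t (f n) r)) \<longlonglongrightarrow> ennreal (radial_density t F r)"
        by (rule tendsto_ennrealI)
      from lim_imp_Liminf[OF _ this] show ?case by simp
    qed
  qed
  also have "\<dots> \<le> liminf (\<lambda>n. \<integral>\<^sup>+r. ennreal (radial_density t (f n) r) \<partial>?M)"
    using df by (intro nn_integral_liminf) simp
  also have "(\<lambda>n. \<integral>\<^sup>+r. ennreal (radial_density t (f n) r) \<partial>?M) = (\<lambda>n. ennreal (J_radial t R (f n)))"
    unfolding J_radial_def
    by (rule ext, rule nn_integral_eq_integral[OF radial_density_integrable[OF t R fX]])
      (simp add: radial_density_nonneg[OF t])
  also have "liminf (\<lambda>n. ennreal (J_radial t R (f n))) = ennreal m"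
  proof (rule lim_imp_Liminf)
    show "(\<lambda>n. ennreal (J_radial t R (f n))) \<longlonglongrightarrow> ennreal m"
      unfolding f_def by (rule tendsto_ennrealI[OF filterlim_compose[OF Jv sl]])
  qed simp
  finally have nn: "(\<integral>\<^sup>+r. ennreal (radial_density t F r) \<partial>?M) \<le> ennreal m" .
  have dFi: "integrable ?M (radial_density t F)"
  proof (rule integrableI_nonneg[OF dF])
    show "AE r in ?M. 0 \<le> radial_density t F r" by (simp add: radial_density_nonneg[OF t])
    show "(\<integral>\<^sup>+r. ennreal (radial_density t F r) \<partial>?M) < \<infinity>"
      using nn by (rule order_le_less_trans) simp
  qed
  have "ennreal (J_radial t R F) \<le> ennreal m"
    using nn nn_integral_eq_integral[OF dFi] radial_density_nonneg[OF t] by (simp add: J_radial_def)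
  then have JF: "J_radial t R F \<le> m" using m0 by simp
  \<comment> \<open>As the bulk potential is nonnegative, the density dominates both squares, so
    finite energy already places \<open>F\<close> in the class.\<close>
  have F2: "integrable ?M (\<lambda>r. (F r)\<^sup>2)" "integrable ?M (\<lambda>r. (prim F r / r)\<^sup>2)"
  proof -
    have d2: "integrable ?M (\<lambda>r. 2 * radial_density t F r)" using dFi by simp
    have le: "(F r)\<^sup>2 \<le> 2 * radial_density t F r" "(prim F r / r)\<^sup>2 \<le> 2 * radial_density t F r" for r
    proof -
      have "0 \<le> (F r)\<^sup>2" "0 \<le> (prim F r / r)\<^sup>2" "0 \<le> r\<^sup>2 * f_bulk t (prim F r / r)"
        using C_const_eq(2)[OF t] by auto
      then show "(F r)\<^sup>2 \<le> 2 * radial_density t F r" "(prim F r / r)\<^sup>2 \<le> 2 * radial_density t F r"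
        unfolding radial_density_def by argo+
    qed
    show "integrable ?M (\<lambda>r. (F r)\<^sup>2)"
    proof (rule Bochner_Integration.integrable_bound[OF d2 borel_measurable_power[OF Fm]])
      show "AE r in ?M. norm ((F r)\<^sup>2) \<le> norm (2 * radial_density t F r)"
        by (intro AE_I2) (simp only: real_norm_def abs_of_nonneg zero_le_power2, rule order_trans[OF le(1) abs_ge_self])
    qed
    show "integrable ?M (\<lambda>r. (prim F r / r)\<^sup>2)"
    proof (rule Bochner_Integration.integrable_bound[OF d2 measurable_scaled_bulk(2)[OF Fc]])
      show "AE r in ?M. norm ((prim F r / r)\<^sup>2) \<le> norm (2 * radial_density t F r)"
        by (intro AE_I2) (simp only: real_norm_def abs_of_nonneg zero_le_power2, rule order_trans[OF le(2) abs_ge_self])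
    qed
  qed
  have "(\<lambda>n. prim (v n) R) \<longlonglongrightarrow> g R" using vlim[of R] R by simp
  then have "g R = R" using vi(5) by (simp add: LIMSEQ_const_iff)
  then have "F \<in> radial_class R" using F2 Fm prF[of R] R by (simp add: radial_class_def)
  then show ?thesis using JF mle by (intro bexI[of _ F] ballI) (auto intro: order_trans)
qed

section \<open>The Euler-Lagrange equation of the profile\<close>

lemma polynomial_minimum_at_0:
  fixes a1 a2 a3 a4 :: real
  assumes "\<And>x. 0 \<le> x * a1 + x\<^sup>2 * a2 + x ^ 3 * a3 + x ^ 4 * a4"
  shows "a1 = 0"
proof -
  have "((\<lambda>x. x * a1 + x\<^sup>2 * a2 + x ^ 3 * a3 + x ^ 4 * a4) has_real_derivative a1) (at 0)"
    by (auto intro!: derivative_eq_intros)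
  then show ?thesis
    by (rule DERIV_local_min[of _ _ _ 1]) (use assms in auto)
qed

text \<open>Every power up to the fourth is at most \<open>1 + s ^ 4\<close>, whose product with
  \<open>r\<^sup>2\<close> is bounded by assumption.\<close>

lemma integrable_weight_product:
  fixes \<sigma> s :: "real \<Rightarrow> real"
  assumes s: "s \<in> borel_measurable (lebesgue_on {0..R})" and sb: "\<And>r. 0 < r \<Longrightarrow> r \<le> R \<Longrightarrow> r\<^sup>2 * s r ^ 4 \<le> B"
    and \<sigma>: "\<sigma> \<in> borel_measurable (lebesgue_on {0..R})" and \<sigma>b: "\<And>r. 0 < r \<Longrightarrow> r \<le> R \<Longrightarrow> \<bar>\<sigma> r\<bar> \<le> L"
    and i: "i \<le> 4"
  shows "integrable (lebesgue_on {0..R}) (\<lambda>r. r\<^sup>2 * (s r ^ i * \<sigma> r ^ j))"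
proof (rule integrable_bounded_ivl[where K = "(R\<^sup>2 + B) * L ^ j"])
  have [measurable]: "(\<lambda>r. r) \<in> borel_measurable (lebesgue_on {0..R})"
    by (auto intro!: continuous_imp_measurable_on_sets_lebesgue continuous_intros)
  note [measurable] = s \<sigma>
  show "(\<lambda>r. r\<^sup>2 * (s r ^ i * \<sigma> r ^ j)) \<in> borel_measurable (lebesgue_on {0..R})" by measurable
  fix r assume r: "0 < r" "r \<le> R"
  have "\<bar>s r\<bar> ^ i \<le> 1 + s r ^ 4"
  proof (cases "\<bar>s r\<bar> \<le> 1")
    case True
    then have "\<bar>s r\<bar> ^ i \<le> 1" by (simp add: power_le_one)
    then show ?thesis by (simp add: add_increasing2)
  next
    case False
    then have "\<bar>s r\<bar> ^ i \<le> \<bar>s r\<bar> ^ 4" using i by (intro power_increasing) auto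
    then show ?thesis by simp
  qed
  then have "r\<^sup>2 * \<bar>s r\<bar> ^ i \<le> r\<^sup>2 * (1 + s r ^ 4)" by (intro mult_left_mono) auto
  also have "\<dots> = r\<^sup>2 + r\<^sup>2 * s r ^ 4" by (simp add: algebra_simps)
  also have "\<dots> \<le> R\<^sup>2 + B" using sb[OF r] r by (intro add_mono power_mono) auto
  finally have 1: "r\<^sup>2 * \<bar>s r\<bar> ^ i \<le> R\<^sup>2 + B" .
  have 2: "\<bar>\<sigma> r\<bar> ^ j \<le> L ^ j" using \<sigma>b[OF r] by (intro power_mono) auto
  have "0 \<le> r\<^sup>2 * \<bar>s r\<bar> ^ i" by simp
  then have "0 \<le> R\<^sup>2 + B" using 1 by (rule order_trans)
  then have "(r\<^sup>2 * \<bar>s r\<bar> ^ i) * \<bar>\<sigma> r\<bar> ^ j \<le> (R\<^sup>2 + B) * L ^ j"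
    using 1 2 by (intro mult_mono) auto
  then show "\<bar>r\<^sup>2 * (s r ^ i * \<sigma> r ^ j)\<bar> \<le> (R\<^sup>2 + B) * L ^ j"
    by (simp add: abs_mult power_abs mult.assoc)
qed

lemma growth_imp_fourth_power:
  fixes u r B :: real
  assumes "0 < r" "\<bar>u\<bar> \<le> sqrt (B * r)" "B > 0"
  shows "r\<^sup>2 * (u / r) ^ 4 \<le> B\<^sup>2"
proof -
  have u2: "u\<^sup>2 \<le> B * r" using power_mono[OF assms(2), of 2] assms by simp
  have "u ^ 4 \<le> (B * r)\<^sup>2" using power_mono[OF u2, of 2] by (simp add: power_mult[symmetric])
  then show ?thesis
    using assms by (simp add: power_divide power_mult_distrib field_simps power4_eq_xxxx power2_eq_square)
qed

lemma L2_product_integrable: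
  fixes f g :: "real \<Rightarrow> real"
  assumes [measurable]: "f \<in> borel_measurable M" "g \<in> borel_measurable M"
    and "integrable M (\<lambda>x. (f x)\<^sup>2)" "integrable M (\<lambda>x. (g x)\<^sup>2)"
  shows "integrable M (\<lambda>x. f x * g x)" "integrable M (\<lambda>x. (f x + c * g x)\<^sup>2)"
proof -
  show 1: "integrable M (\<lambda>x. f x * g x)"
  proof (rule Bochner_Integration.integrable_bound)
    show "integrable M (\<lambda>x. (f x)\<^sup>2 + (g x)\<^sup>2)" using assms by simp
    have "\<bar>a * b\<bar> \<le> a\<^sup>2 + b\<^sup>2" for a b :: real
      using zero_le_power2[of "\<bar>a\<bar> - \<bar>b\<bar>"] zero_le_power2[of a] zero_le_power2[of b]
      unfolding power2_diff abs_mult power2_abs by argo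
    then show "AE x in M. norm (f x * g x) \<le> norm ((f x)\<^sup>2 + (g x)\<^sup>2)" by (intro AE_I2) simp
  qed measurable
  have "(\<lambda>x. (f x + c * g x)\<^sup>2) = (\<lambda>x. (f x)\<^sup>2 + 2 * c * (f x * g x) + c\<^sup>2 * (g x)\<^sup>2)"
    by (auto simp: fun_eq_iff power2_eq_square algebra_simps)
  then show "integrable M (\<lambda>x. (f x + c * g x)\<^sup>2)" using 1 assms(3,4) by simp
qed

text \<open>Along \<open>w + \<epsilon> v\<close> the functional is a polynomial of degree four in
  \<open>\<epsilon>\<close>, so no differentiation under the integral is involved. The cubic decay
  of \<open>prim v\<close> makes \<open>prim v r / r\<close> bounded, hence all coefficients
  integrable; \<open>prim v R = 0\<close> keeps the boundary value.\<close>

lemma first_variation: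
  assumes t: "t > 1" and R: "R > 0" and w: "w \<in> radial_class R"
    and min: "\<And>v. v \<in> radial_class R \<Longrightarrow> J_radial t R w \<le> J_radial t R v"
    and v: "v \<in> borel_measurable (lebesgue_on {0..R})" "integrable (lebesgue_on {0..R}) (\<lambda>x. (v x)\<^sup>2)"
    and L: "\<And>x. x \<in> {0..R} \<Longrightarrow> \<bar>prim v x\<bar> \<le> L * x ^ 3" and vR: "prim v R = 0"
  defines "a \<equiv> h_plus t / t" and "b \<equiv> (h_plus t)\<^sup>2 / (2 * t)"
  defines "A \<equiv> (\<lambda>r. w r * v r + 6 * (prim w r / r * (prim v r / r)) +
     r\<^sup>2 * (- (prim w r / r) - 3 * a * (prim w r / r)\<^sup>2 + 4 * b * (prim w r / r) ^ 3) * (prim v r / r))"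
  shows "integrable (lebesgue_on {0..R}) A" "(LINT r|lebesgue_on {0..R}. A r) = 0"
proof -
  let ?M = "lebesgue_on {0..R}"
  note wi = radial_class_integrable[OF w]
  note vint = L2_integrable[OF v]
  define s where "s = (\<lambda>r. prim w r / r)"
  define \<sigma> where "\<sigma> = (\<lambda>r. prim v r / r)"
  define B where "B = (LINT x|?M. (w x)\<^sup>2) + 1"
  have B: "(LINT x|?M. (w x)\<^sup>2) \<le> B" "B > 0"
  proof -
    have "0 \<le> (LINT x|?M. (w x)\<^sup>2)" by (rule Bochner_Integration.integral_nonneg) simp
    then show "(LINT x|?M. (w x)\<^sup>2) \<le> B" "B > 0" unfolding B_def by linarith+
  qed
  have [measurable]: "(\<lambda>r. r) \<in> borel_measurable ?M"
    by (auto intro!: continuous_imp_measurable_on_sets_lebesgue continuous_intros)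
  have [measurable]: "prim w \<in> borel_measurable ?M" "prim v \<in> borel_measurable ?M"
    using primitive_continuous[OF wi(6)] primitive_continuous[OF primitive_integral[OF vint]]
    by (auto intro!: continuous_imp_measurable_on_sets_lebesgue)
  have sm [measurable]: "s \<in> borel_measurable ?M" and \<sigma>m [measurable]: "\<sigma> \<in> borel_measurable ?M"
    unfolding s_def \<sigma>_def by measurable
  have s4: "r\<^sup>2 * s r ^ 4 \<le> B\<^sup>2" if "0 < r" "r \<le> R" for r
    unfolding s_def using growth_imp_fourth_power radial_class_growth[OF wi(1,2) B, of r] B(2) that by auto
  have \<sigma>b: "\<bar>\<sigma> r\<bar> \<le> \<bar>L\<bar> * R\<^sup>2" if r: "0 < r" "r \<le> R" for r
  proof -
    have "\<bar>\<sigma> r\<bar> \<le> L * r ^ 3 / r" unfolding \<sigma>_def using L[of r] r by (simp add: divide_right_mono)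
    also have "\<dots> = L * r\<^sup>2" using r by (simp add: power3_eq_cube power2_eq_square)
    also have "\<dots> \<le> \<bar>L\<bar> * R\<^sup>2" using r by (intro mult_mono power_mono) auto
    finally show ?thesis .
  qed
  have ip: "integrable ?M (\<lambda>r. r\<^sup>2 * (s r ^ i * \<sigma> r ^ j))" if "i \<le> 4" for i j
    by (rule integrable_weight_product[OF sm s4 \<sigma>m \<sigma>b that])
  have s2: "integrable ?M (\<lambda>r. (s r)\<^sup>2)" unfolding s_def by (rule wi)
  have \<sigma>2: "integrable ?M (\<lambda>r. (\<sigma> r)\<^sup>2)"
    by (rule integrable_bounded_ivl[where K = "(\<bar>L\<bar> * R\<^sup>2)\<^sup>2"])
      (use \<sigma>b power_mono[OF \<sigma>b, of _ 2] in \<open>auto intro: borel_measurable_power\<close>)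
  have wv: "integrable ?M (\<lambda>r. w r * v r)" by (rule L2_product_integrable[OF wi(1) v(1) wi(2) v(2)])
  have s\<sigma>: "integrable ?M (\<lambda>r. s r * \<sigma> r)" by (rule L2_product_integrable[OF sm \<sigma>m s2 \<sigma>2])
  \<comment> \<open>The coefficients of the second, third and fourth power of
    \<open>\<epsilon>\<close> in the density. Trivial powers such as \<open>s r ^ 0\<close> are kept
    so that every bulk term has the shape of \<open>integrable_weight_product\<close>.\<close>
  define A2 where "A2 = (\<lambda>r. (v r)\<^sup>2 / 2 + 3 * (\<sigma> r)\<^sup>2 + (- 1/2) * (r\<^sup>2 * (s r ^ 0 * \<sigma> r ^ 2))
    + (- 3 * a) * (r\<^sup>2 * (s r ^ 1 * \<sigma> r ^ 2)) + 6 * b * (r\<^sup>2 * (s r ^ 2 * \<sigma> r ^ 2)))"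
  define A3 where "A3 = (\<lambda>r. (- a) * (r\<^sup>2 * (s r ^ 0 * \<sigma> r ^ 3)) + 4 * b * (r\<^sup>2 * (s r ^ 1 * \<sigma> r ^ 3)))"
  define A4 where "A4 = (\<lambda>r. b * (r\<^sup>2 * (s r ^ 0 * \<sigma> r ^ 4)))"
  have A1: "A = (\<lambda>r. w r * v r + 6 * (s r * \<sigma> r) + (- 1) * (r\<^sup>2 * (s r ^ 1 * \<sigma> r ^ 1))
    + (- 3 * a) * (r\<^sup>2 * (s r ^ 2 * \<sigma> r ^ 1)) + 4 * b * (r\<^sup>2 * (s r ^ 3 * \<sigma> r ^ 1)))"
    unfolding A_def s_def[symmetric] \<sigma>_def[symmetric] by (rule ext) (simp add: s_def \<sigma>_def algebra_simps)
  show Ai: "integrable ?M A" unfolding A1 by (intro Bochner_Integration.integrable_add integrable_mult_right wv s\<sigma> ip) auto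
  have A2i: "integrable ?M A2" unfolding A2_def
    by (intro Bochner_Integration.integrable_add integrable_mult_right integrable_divide v \<sigma>2 ip) auto
  have A3i: "integrable ?M A3" unfolding A3_def
    by (intro Bochner_Integration.integrable_add integrable_mult_right ip) auto
  have A4i: "integrable ?M A4" unfolding A4_def
    by (intro integrable_mult_right ip) auto
  have vx: "v integrable_on {0..x}" "w integrable_on {0..x}" if "x \<in> {0..R}" for x
    using integrable_lebesgue_on_subset_ivl[OF vint, of 0 x] integrable_lebesgue_on_subset_ivl[OF wi(4), of 0 x] that
    by (auto intro: integrable_on_of_lebesgue_ivl)
  have pr: "prim (\<lambda>x. w x + \<epsilon> * v x) x = prim w x + \<epsilon> * prim v x" if "x \<in> {0..R}" for \<epsilon> x
    using vx[OF that] by (simp add: Henstock_Kurzweil_Integration.integral_add integrable_on_mult_right)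
  have "0 \<le> \<epsilon> * integral\<^sup>L ?M A + \<epsilon>\<^sup>2 * integral\<^sup>L ?M A2 + \<epsilon> ^ 3 * integral\<^sup>L ?M A3 + \<epsilon> ^ 4 * integral\<^sup>L ?M A4" for \<epsilon>
  proof -
    let ?w = "\<lambda>x. w x + \<epsilon> * v x"
    have X: "?w \<in> radial_class R"
      unfolding radial_class_def mem_Collect_eq
    proof (intro conjI)
      show "?w \<in> borel_measurable ?M" using wi(1) v(1) by simp
      show "integrable ?M (\<lambda>x. (?w x)\<^sup>2)" by (rule L2_product_integrable(2)[OF wi(1) v(1) wi(2) v(2)])
      show "prim ?w R = R" using pr[of R] vR wi(5) R by simp
      have "integrable ?M (\<lambda>x. (s x + \<epsilon> * \<sigma> x)\<^sup>2)" by (rule L2_product_integrable(2)[OF sm \<sigma>m s2 \<sigma>2])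
      moreover have "(prim ?w x / x)\<^sup>2 = (s x + \<epsilon> * \<sigma> x)\<^sup>2" if "x \<in> space ?M" for x
        using pr[of x \<epsilon>] that by (simp add: s_def \<sigma>_def add_divide_distrib)
      ultimately show "integrable ?M (\<lambda>x. (prim ?w x / x)\<^sup>2)"
        using Bochner_Integration.integrable_cong[OF refl, of ?M "\<lambda>x. (prim ?w x / x)\<^sup>2" "\<lambda>x. (s x + \<epsilon> * \<sigma> x)\<^sup>2"] by blast
    qed
    have "J_radial t R ?w = (LINT r|?M. radial_density t w r + \<epsilon> * A r + \<epsilon>\<^sup>2 * A2 r + \<epsilon> ^ 3 * A3 r + \<epsilon> ^ 4 * A4 r)"
      unfolding J_radial_def
    proof (rule Bochner_Integration.integral_cong[OF refl])
      fix r assume "r \<in> space ?M"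
      then have "prim ?w r / r = s r + \<epsilon> * \<sigma> r"
        using pr[of r \<epsilon>] by (simp add: s_def \<sigma>_def add_divide_distrib)
      then have d: "radial_density t ?w r = 1/2 * (w r + \<epsilon> * v r)\<^sup>2 + 3 * (s r + \<epsilon> * \<sigma> r)\<^sup>2 + r\<^sup>2 * f_bulk t (s r + \<epsilon> * \<sigma> r)"
        by (simp only: radial_density_def)
      show "radial_density t ?w r = radial_density t w r + \<epsilon> * A r + \<epsilon>\<^sup>2 * A2 r + \<epsilon> ^ 3 * A3 r + \<epsilon> ^ 4 * A4 r"
        unfolding d unfolding radial_density_def s_def[symmetric] A1 A2_def A3_def A4_def
          f_bulk_expand(1)[OF t, folded a_def b_def] s_def[symmetric]
        unfolding s_def[THEN fun_cong, symmetric]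
        by (simp add: field_simps power2_eq_square power3_eq_cube power4_eq_xxxx)
    qed
    also have "\<dots> = J_radial t R w + \<epsilon> * integral\<^sup>L ?M A + \<epsilon>\<^sup>2 * integral\<^sup>L ?M A2 + \<epsilon> ^ 3 * integral\<^sup>L ?M A3 + \<epsilon> ^ 4 * integral\<^sup>L ?M A4"
      unfolding J_radial_def using Ai A2i A3i A4i radial_density_integrable[OF t R w] by simp
    finally show ?thesis using min[OF X] by linarith
  qed
  then show "(LINT r|?M. A r) = 0" by (rule polynomial_minimum_at_0)
qed

section \<open>Averages against powers and decay at the origin\<close>

definition mean_op :: "nat \<Rightarrow> (real \<Rightarrow> real) \<Rightarrow> real \<Rightarrow> real" where
  "mean_op k f x = integral {0..1} (\<lambda>s. s ^ k * f (x * s))"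

lemma mean_op_continuous:
  assumes f: "continuous_on {0..R} f"
  shows "continuous_on {0..R} (mean_op k f)"
proof -
  have "continuous_on ({0..R} \<times> cbox 0 (1::real)) (\<lambda>(x, s). s ^ k * f (x * s))"
    unfolding case_prod_unfold
    by (intro continuous_intros continuous_on_compose2[OF f])
      (auto intro: mult_left_le order_trans[OF mult_left_le])
  from integral_continuous_on_param[OF this] show ?thesis
    by (simp add: mean_op_def[abs_def])
qed

text \<open>The right-hand side of the differential equation after the substitution
  \<open>h = x\<^sup>2 * e\<close> and division by \<open>x\<^sup>2\<close>, with \<open>c1\<close>
  and \<open>c2\<close> the coefficients 3a and 4b from the derivative of the bulk
  potential.\<close>

definition source :: "real \<Rightarrow> real \<Rightarrow> (real \<Rightarrow> real) \<Rightarrow> real \<Rightarrow> real" where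
  "source c1 c2 e x = - e x - c1 * x\<^sup>2 * (e x)\<^sup>2 + c2 * x ^ 4 * (e x) ^ 3"

text \<open>The substitution of \<open>x * s\<close> for the variable. It is the origin of the
  averages: they are the integrals that the equation produces, divided by their natural power of
  \<open>x\<close>, in a form that survives at 0.\<close>

lemma mean_op_scaling:
  fixes f :: "real \<Rightarrow> real"
  assumes f: "continuous_on {0..x} f" and x: "x > 0"
  shows "integral {0..x} (\<lambda>s. s ^ k * f s) = x ^ Suc k * mean_op k f x"
proof -
  have "(\<lambda>s. s ^ k * f s) integrable_on {0..x}"
    by (intro integrable_continuous_real continuous_intros f)
  then have "((\<lambda>s. s ^ k * f s) has_integral integral {0..x} (\<lambda>s. s ^ k * f s)) {0..x}" by (rule integrable_integral)
  from has_integral_stretch_real[OF this, of x]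
  have 1: "((\<lambda>s. (x * s) ^ k * f (x * s)) has_integral (1 / x) * integral {0..x} (\<lambda>s. s ^ k * f s)) ((\<lambda>s. s / x) ` {0..x})"
    using x by simp
  have "(\<lambda>s. s / x) ` {0..x} = {0..1}"
    using x image_divide_atLeastAtMost[of x 0 x] by simp
  with 1 have "integral {0..1} (\<lambda>s. (x * s) ^ k * f (x * s)) = (1 / x) * integral {0..x} (\<lambda>s. s ^ k * f s)"
    by (auto intro: integral_unique)
  moreover have "(\<lambda>s. (x * s) ^ k * f (x * s)) = (\<lambda>s. x ^ k * (s ^ k * f (x * s)))"
    by (simp add: power_mult_distrib mult.assoc)
  ultimately have "x ^ k * mean_op k f x = (1 / x) * integral {0..x} (\<lambda>s. s ^ k * f s)"
    unfolding mean_op_def by simp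
  then show ?thesis using x by (simp add: field_simps)
qed

text \<open>The bound on \<open>e'\<close> is minus the derivative of \<open>A / y ^ k\<close>. So
  \<open>A / y ^ k\<close> minus \<open>e\<close> or plus \<open>e\<close> is decreasing, and
  comparison with the endpoint \<open>R\<close> bounds \<open>e\<close> on both sides.\<close>

lemma decay_of_derivative:
  fixes e e' :: "real \<Rightarrow> real"
  assumes d: "\<And>x. 0 < x \<Longrightarrow> x \<le> R \<Longrightarrow> (e has_real_derivative e' x) (at x within {0..R})"
    and b: "\<And>x. 0 < x \<Longrightarrow> x \<le> R \<Longrightarrow> \<bar>e' x\<bar> \<le> A * real k / x ^ Suc k" and R: "R > 0" and A: "A \<ge> 0"
  obtains C where "C > 0" "\<And>x. 0 < x \<Longrightarrow> x \<le> R \<Longrightarrow> \<bar>e x\<bar> \<le> C / x ^ k"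
proof -
  have main: "\<sigma> * e x \<le> \<sigma> * e R + A / x ^ k" if x: "0 < x" "x \<le> R" and \<sigma>: "\<bar>\<sigma>\<bar> = 1" for x \<sigma> :: real
  proof -
    have sub: "{x..R} \<subseteq> {0..R}" using x by auto
    define g where "g = (\<lambda>y. A / y ^ k - \<sigma> * e y)"
    have gd: "(g has_real_derivative (- (A * real k / y ^ Suc k) - \<sigma> * e' y)) (at y within {x..R})" if "x \<le> y" "y \<le> R" for y
    proof -
      have "y > 0" using that x by simp
      have "((\<lambda>y. A / y ^ k) has_real_derivative - (A * real k / y ^ Suc k)) (at y within {x..R})"
      proof -
        have "((\<lambda>y. A / y ^ k) has_real_derivative (0 * y ^ k - A * (real k * y ^ (k - 1))) / (y ^ k * y ^ k)) (at y within {x..R})"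
          using \<open>y > 0\<close> by (auto intro!: derivative_eq_intros)
        moreover have "(0 * y ^ k - A * (real k * y ^ (k - 1))) / (y ^ k * y ^ k) = - (A * real k / y ^ Suc k)"
          using \<open>y > 0\<close> by (cases k) (simp_all add: field_simps)
        ultimately show ?thesis by simp
      qed
      moreover have "(e has_real_derivative e' y) (at y within {x..R})"
        using d[of y] that x by (auto intro: DERIV_subset[OF _ sub])
      ultimately show ?thesis unfolding g_def by (intro DERIV_diff DERIV_cmult)
    qed
    have "g R \<le> g x"
    proof (rule DERIV_nonpos_imp_decreasing_open[OF x(2)])
      show "continuous_on {x..R} g" using gd by (intro DERIV_continuous_on) auto
      fix y assume y: "x < y" "y < R"
      have "(g has_real_derivative (- (A * real k / y ^ Suc k) - \<sigma> * e' y)) (at y)"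
        using gd[of y] y by (simp add: at_within_Icc_at)
      moreover have "- (\<sigma> * e' y) \<le> \<bar>e' y\<bar>"
        using abs_ge_minus_self[of "\<sigma> * e' y"] \<sigma> by (simp add: abs_mult)
      moreover have "\<bar>e' y\<bar> \<le> A * real k / y ^ Suc k" using b[of y] x y by simp
      ultimately show "\<exists>z. (g has_real_derivative z) (at y) \<and> z \<le> 0"
        by (intro exI[of _ "- (A * real k / y ^ Suc k) - \<sigma> * e' y"]) linarith
    qed
    moreover have "0 \<le> A / R ^ k" using A R by simp
    ultimately show ?thesis unfolding g_def by argo
  qed
  define C where "C = \<bar>e R\<bar> * R ^ k + A + 1"
  have "C > 0" using R A by (simp add: C_def add_nonneg_pos)
  moreover have "\<bar>e x\<bar> \<le> C / x ^ k" if x: "0 < x" "x \<le> R" for x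
  proof -
    have "\<bar>e x\<bar> \<le> \<bar>e R\<bar> + A / x ^ k" using main[OF x, of 1] main[OF x, of "-1"] by auto
    moreover have "\<bar>e R\<bar> \<le> \<bar>e R\<bar> * R ^ k / x ^ k"
    proof -
      have "x ^ k \<le> R ^ k" using x by (intro power_mono) auto
      then show ?thesis using x by (simp add: le_divide_eq mult_left_mono)
    qed
    moreover have "C / x ^ k = \<bar>e R\<bar> * R ^ k / x ^ k + A / x ^ k + 1 / x ^ k"
      by (simp add: C_def add_divide_distrib)
    moreover have "0 \<le> 1 / x ^ k" using x by simp
    ultimately show ?thesis by argo
  qed
  ultimately show ?thesis by (rule that)
qed

lemma integral_bound_power:
  fixes \<kappa> :: "real \<Rightarrow> real"
  assumes c: "continuous_on {0..R} \<kappa>" and b: "\<And>x. 0 \<le> x \<Longrightarrow> x \<le> R \<Longrightarrow> \<bar>\<kappa> x\<bar> \<le> C * x ^ k" and C: "C \<ge> 0"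
    and x: "0 \<le> x" "x \<le> R"
  shows "\<bar>integral {0..x} \<kappa>\<bar> \<le> C * x ^ Suc k"
proof -
  have "norm (integral {0..x} \<kappa>) \<le> (C * x ^ k) * (x - 0)"
  proof (rule integral_bound)
    show "continuous_on {0..x} \<kappa>" using c x by (auto intro: continuous_on_subset)
    show "norm (\<kappa> y) \<le> C * x ^ k" if "y \<in> {0..x}" for y
    proof -
      have "norm (\<kappa> y) \<le> C * y ^ k" using b[of y] that x by auto
      also have "\<dots> \<le> C * x ^ k" using that C by (intro mult_left_mono power_mono) auto
      finally show ?thesis .
    qed
  qed (use x in auto)
  then show ?thesis by (simp add: mult_ac)
qed

text \<open>The Euler-Lagrange equation is obtained in once integrated form, by testing with a
  direction for which the first variation becomes the square integral of the defect
  \<open>Z\<close>. No constant of integration appears. Growth at the origin is then improved until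
  \<open>e' = K / x ^ 6\<close> is bounded, and the averages take over.\<close>

theorem J_minimizer_regular:
  assumes t: "t > 1" and R: "R > 0" and w: "w \<in> radial_class R"
    and min: "\<And>v. v \<in> radial_class R \<Longrightarrow> J_radial t R w \<le> J_radial t R v"
  defines "c1 \<equiv> 3 * (h_plus t / t)" and "c2 \<equiv> 4 * ((h_plus t)\<^sup>2 / (2 * t))"
  shows "\<exists>e. (\<forall>x\<in>{0..R}. (e has_real_derivative x * mean_op 6 (source c1 c2 e) x) (at x within {0..R})) \<and>
    (\<forall>x\<in>{0..R}. prim w x = x ^ 3 * e x)"
proof -
  let ?M = "lebesgue_on {0..R}"
  note wi = radial_class_integrable[OF w]
  have c12: "c1 > 0" "c2 > 0" using f_bulk_expand(2,3)[OF t] by (simp_all add: c1_def c2_def)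
  define u where "u = prim w"
  have uc: "continuous_on {0..R} u" unfolding u_def by (rule primitive_continuous[OF wi(6)])
  have up: "primitive R u w" unfolding u_def by (rule wi)
  define \<kappa> where "\<kappa> = (\<lambda>x. u x * x * (- x\<^sup>2 - c1 * x * u x + c2 * (u x)\<^sup>2))"
  have \<kappa>c: "continuous_on {0..R} \<kappa>" unfolding \<kappa>_def by (intro continuous_intros uc)
  define K where "K = prim \<kappa>"
  have Kp: "primitive R K \<kappa>"
    unfolding K_def by (rule primitive_integral[OF continuous_imp_integrable_real[OF \<kappa>c]])
  have Kc: "continuous_on {0..R} K" by (rule primitive_continuous[OF Kp])
  have pw: "primitive R (\<lambda>x. x ^ k) (\<lambda>x. real k * x ^ (k - 1))" for k
    by (rule primitive_C1) (auto intro!: derivative_eq_intros continuous_intros)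
  \<comment> \<open>With \<open>u = x ^ 3 * e\<close> one has formally
    \<open>Z = x ^ 6 * e' - K\<close>, so \<open>Z = 0\<close> is the equation integrated from the
    origin.\<close>
  define Z where "Z = (\<lambda>x. x ^ 3 * w x - 3 * x\<^sup>2 * u x - K x)"
  have cm: "f \<in> borel_measurable ?M" if "continuous_on {0..R} f" for f :: "real \<Rightarrow> real"
    using that by (intro continuous_imp_measurable_on_sets_lebesgue) auto
  have c2i: "integrable ?M (\<lambda>x. (f x)\<^sup>2)" if "continuous_on {0..R} f" for f :: "real \<Rightarrow> real"
    using that by (intro continuous_imp_integrable_real continuous_intros)
  have cw: "(\<lambda>x. f x * y x) \<in> borel_measurable ?M" "integrable ?M (\<lambda>x. (f x * y x)\<^sup>2)"
    if f: "continuous_on {0..R} f" and y: "y \<in> borel_measurable ?M" "integrable ?M (\<lambda>x. (y x)\<^sup>2)" for f y :: "real \<Rightarrow> real"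
  proof -
    show "(\<lambda>x. f x * y x) \<in> borel_measurable ?M" using cm[OF f] y(1) by (rule borel_measurable_times)
    have "continuous_on {0..R} (\<lambda>x. (f x)\<^sup>2)" by (intro continuous_intros f)
    from integrable_continuous_times[OF this y(2)] show "integrable ?M (\<lambda>x. (f x * y x)\<^sup>2)"
      by (simp add: power_mult_distrib)
  qed
  have g1: "continuous_on {0..R} (\<lambda>x. 3 * x\<^sup>2 * u x + K x)" by (intro continuous_intros uc Kc)
  have x3: "continuous_on {0..R} (\<lambda>x::real. x ^ 3)" by (intro continuous_intros)
  have Zeq: "Z = (\<lambda>x. x ^ 3 * w x + (-1) * (3 * x\<^sup>2 * u x + K x))" by (auto simp: Z_def)
  have Zm: "Z \<in> borel_measurable ?M"
    unfolding Zeq by (intro borel_measurable_add cw(1)[OF x3 wi(1,2)] borel_measurable_times borel_measurable_const cm[OF g1])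
  have Z2: "integrable ?M (\<lambda>x. (Z x)\<^sup>2)"
    unfolding Zeq by (rule L2_product_integrable(2)[OF cw(1)[OF x3 wi(1,2)] cm[OF g1] cw(2)[OF x3 wi(1,2)] c2i[OF g1]])
  have Zi: "integrable ?M Z" by (rule L2_integrable[OF Zm Z2])
  \<comment> \<open>A primitive of \<open>Z\<close> normalized to vanish at \<open>R\<close>. The
    variation of \<open>u\<close> is \<open>x ^ 3 * \<eta>\<close>, with \<open>v\<close> as its
    density, so both the boundary condition and the cubic decay hold.\<close>
  define \<eta> where "\<eta> = (\<lambda>x. prim Z x - prim Z R)"
  have \<eta>p: "primitive R \<eta> Z"
    unfolding primitive_def \<eta>_def using Zi by simp
  have \<eta>c: "continuous_on {0..R} \<eta>" by (rule primitive_continuous[OF \<eta>p])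
  define v where "v = (\<lambda>x. x ^ 3 * Z x + 1 * (3 * x\<^sup>2 * \<eta> x))"
  have g2: "continuous_on {0..R} (\<lambda>x. 3 * x\<^sup>2 * \<eta> x)" by (intro continuous_intros \<eta>c)
  have v: "v \<in> borel_measurable ?M" "integrable ?M (\<lambda>x. (v x)\<^sup>2)"
    unfolding v_def
    by (intro borel_measurable_add borel_measurable_times borel_measurable_const cm[OF g2] cm[OF x3] Zm)
      (rule L2_product_integrable(2)[OF cw(1)[OF x3 Zm Z2] cm[OF g2] cw(2)[OF x3 Zm Z2] c2i[OF g2]])
  have "primitive R (\<lambda>x. x ^ 3 * \<eta> x) (\<lambda>x. real 3 * x ^ (3 - 1) * \<eta> x + Z x * x ^ 3)"
    by (rule primitive_mult[OF pw \<eta>p])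
  moreover have "(\<lambda>x. real 3 * x ^ (3 - 1) * \<eta> x + Z x * x ^ 3) = v"
    by (auto simp: v_def fun_eq_iff)
  ultimately have vp: "primitive R (\<lambda>x. x ^ 3 * \<eta> x) v" by simp
  have prv: "prim v x = x ^ 3 * \<eta> x" if "x \<in> {0..R}" for x
    using primitive_eq[OF vp that] by simp
  have "bounded (\<eta> ` {0..R})"
    using \<eta>c compact_continuous_image compact_imp_bounded by blast
  then obtain L where L: "\<And>x. x \<in> {0..R} \<Longrightarrow> \<bar>\<eta> x\<bar> \<le> L" by (force simp: bounded_iff)
  have vL: "\<bar>prim v x\<bar> \<le> L * x ^ 3" if "x \<in> {0..R}" for x
    using L[OF that] that by (simp add: prv[OF that] abs_mult mult.commute mult_right_mono)
  have vR: "prim v R = 0" using prv[of R] R by (simp add: \<eta>_def)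
  note fv = first_variation[OF t R w min v vL vR]
  \<comment> \<open>An exact derivative with vanishing boundary values: \<open>K\<close> and
    \<open>x\<close> vanish at 0, and \<open>\<eta>\<close> vanishes at \<open>R\<close>. The
    integrand of the first variation minus this derivative is exactly the square of
    \<open>Z\<close>.\<close>
  have Phi: "primitive R (\<lambda>x. (3 * x\<^sup>2 * u x + K x) * \<eta> x)
     (\<lambda>x. (3 * (2 * x * u x + w x * x\<^sup>2) + \<kappa> x) * \<eta> x + Z x * (3 * x\<^sup>2 * u x + K x))"
  proof -
    have "primitive R (\<lambda>x. x ^ 2 * u x) (\<lambda>x. real 2 * x ^ (2 - 1) * u x + w x * x ^ 2)"
      by (rule primitive_mult[OF pw up])
    from primitive_mult[OF primitive_add[OF primitive_cmult[OF this, of 3] Kp] \<eta>p]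
    show ?thesis by (simp add: mult.assoc)
  qed
  have PhiR: "(LINT x|?M. (3 * (2 * x * u x + w x * x\<^sup>2) + \<kappa> x) * \<eta> x + Z x * (3 * x\<^sup>2 * u x + K x)) = 0"
  proof -
    have "K 0 = 0" "\<eta> R = 0" by (simp_all add: K_def \<eta>_def)
    then show ?thesis using primitive_eq[OF Phi, of R] R integral_lebesgue_on_ivl[OF primitive_integrable[OF Phi]] by simp
  qed
  have "(LINT x|?M. (Z x)\<^sup>2) = 0"
  proof -
    let ?A = "\<lambda>r. w r * v r + 6 * (prim w r / r * (prim v r / r)) +
     r\<^sup>2 * (- (prim w r / r) - 3 * (h_plus t / t) * (prim w r / r)\<^sup>2 + 4 * ((h_plus t)\<^sup>2 / (2 * t)) * (prim w r / r) ^ 3) * (prim v r / r)"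
    let ?P = "\<lambda>x. (3 * (2 * x * u x + w x * x\<^sup>2) + \<kappa> x) * \<eta> x + Z x * (3 * x\<^sup>2 * u x + K x)"
    have "(LINT x|?M. ?A x - ?P x) = 0"
      using fv PhiR primitive_integrable[OF Phi] by simp
    moreover have "(LINT x|?M. ?A x - ?P x) = (LINT x|?M. (Z x)\<^sup>2)"
    proof (rule Bochner_Integration.integral_cong[OF refl])
      fix x assume "x \<in> space ?M"
      then have x: "x \<in> {0..R}" by simp
      show "?A x - ?P x = (Z x)\<^sup>2"
      proof (cases "x = 0")
        case True
        have "u 0 = 0" "K 0 = 0" by (simp_all add: u_def K_def)
        then show ?thesis using True by (simp add: v_def Z_def \<kappa>_def)
      next
        case False
        have q: "6 * (u x / x * (x ^ 3 * \<eta> x / x)) = 6 * x * u x * \<eta> x"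
          "x\<^sup>2 * (- (u x / x) - c1 * (u x / x)\<^sup>2 + c2 * (u x / x) ^ 3) * (x ^ 3 * \<eta> x / x) = \<kappa> x * \<eta> x"
          using False by (simp_all add: \<kappa>_def field_simps power2_eq_square power3_eq_cube)
        have "?A x = w x * v x + 6 * x * u x * \<eta> x + \<kappa> x * \<eta> x"
        proof -
          have "prim w x = u x" by (simp add: u_def)
          then show ?thesis unfolding prv[OF x] c1_def[symmetric] c2_def[symmetric] by (simp only: q)
        qed
        then show ?thesis unfolding Z_def v_def by algebra
      qed
    qed
    ultimately show ?thesis by simp
  qed
  then have "AE x in ?M. (Z x)\<^sup>2 = 0"
    using integral_nonneg_eq_0_iff_AE[OF Z2] by simp
  then have Z0: "AE x in ?M. Z x = 0" by eventually_elim simp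
  define W where "W = (\<lambda>x. (3 * x\<^sup>2 * u x + K x) / x ^ 3)"
  have wW: "AE x in ?M. x \<noteq> 0 \<longrightarrow> w x = W x"
    using Z0 by eventually_elim (auto simp: Z_def W_def field_simps)
  \<comment> \<open>The equation determines \<open>w\<close> only almost everywhere, but its
    right-hand side \<open>W\<close> is continuous away from 0. Writing \<open>u\<close> as an
    indefinite integral from a positive point therefore makes it continuously differentiable
    there.\<close>
  have ud: "(u has_real_derivative W x) (at x within {0..R})" if x: "0 < x" "x \<le> R" for x
  proof -
    define \<delta> where "\<delta> = x / 2"
    have \<delta>: "0 < \<delta>" "\<delta> < x" using x by (simp_all add: \<delta>_def)
    have Wc: "continuous_on {\<delta>..R} W"
      unfolding W_def using \<delta> by (intro continuous_intros continuous_on_subset[OF uc] continuous_on_subset[OF Kc]) auto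
    have eq: "u y = u \<delta> + integral {\<delta>..y} W" if y: "y \<in> {\<delta>..R}" for y
    proof -
      have sub: "{\<delta>..y} \<subseteq> {0..R}" using \<delta> y by auto
      have wi': "integrable (lebesgue_on {\<delta>..y}) w" by (rule integrable_lebesgue_on_subset_ivl[OF wi(4) sub])
      have Wi': "integrable (lebesgue_on {\<delta>..y}) W"
        by (rule continuous_imp_integrable_real[OF continuous_on_subset[OF Wc]]) (use y in auto)
      have "AE x in lebesgue. x \<in> {0..R} \<longrightarrow> x \<noteq> 0 \<longrightarrow> w x = W x"
        using wW by (subst (asm) AE_restrict_space_iff) auto
      then have "AE x in lebesgue. x \<in> {\<delta>..y} \<longrightarrow> w x = W x"
        by eventually_elim (use sub \<delta> in auto)
      then have "AE x in lebesgue_on {\<delta>..y}. w x = W x" by (subst AE_restrict_space_iff) auto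
      then have "(LINT x|lebesgue_on {\<delta>..y}. w x) = (LINT x|lebesgue_on {\<delta>..y}. W x)"
        using wi' Wi' by (intro integral_cong_AE) auto
      then have "integral {\<delta>..y} w = integral {\<delta>..y} W"
        using integral_lebesgue_on_ivl[OF wi'] integral_lebesgue_on_ivl[OF Wi'] by simp
      then show ?thesis using primitive_increment[OF up, of \<delta> y] \<delta> y by simp
    qed
    have "((\<lambda>y. u \<delta> + integral {\<delta>..y} W) has_real_derivative 0 + W x) (at x within {\<delta>..R})"
      using \<delta> x by (intro DERIV_add DERIV_const integral_has_real_derivative Wc) auto
    then have "((\<lambda>y. u \<delta> + integral {\<delta>..y} W) has_real_derivative W x) (at x within {\<delta>..R})" by simp
    then have "(u has_real_derivative W x) (at x within {\<delta>..R})"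
    proof (rule has_field_derivative_transform_within[OF _ zero_less_one])
      show "x \<in> {\<delta>..R}" using \<delta> x by simp
    qed (rule eq[symmetric])
    moreover have "at x within {\<delta>..R} = at x within {0..R}"
      by (rule at_within_nhd[of x "{\<delta><..}"]) (use \<delta> in auto)
    ultimately show ?thesis by simp
  qed
  define e where "e = (\<lambda>x. u x / x ^ 3)"
  have ed: "(e has_real_derivative K x / x ^ 6) (at x within {0..R})" if x: "0 < x" "x \<le> R" for x
  proof -
    have "(e has_real_derivative (W x * x ^ 3 - u x * (3 * x\<^sup>2)) / (x ^ 3 * x ^ 3)) (at x within {0..R})"
      unfolding e_def using x by (intro DERIV_divide ud) (auto intro!: derivative_eq_intros)
    moreover have "(W x * x ^ 3 - u x * (3 * x\<^sup>2)) / (x ^ 3 * x ^ 3) = K x / x ^ 6"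
      using x by (simp add: W_def power_add[symmetric])
    ultimately show ?thesis by (simp only:)
  qed
  have ue: "u x = x ^ 3 * e x" if "0 < x" for x using that by (simp add: e_def)
  define B where "B = (LINT x|?M. (w x)\<^sup>2) + 1"
  have B: "(LINT x|?M. (w x)\<^sup>2) \<le> B" "B > 0"
  proof -
    have "0 \<le> (LINT x|?M. (w x)\<^sup>2)" by (rule Bochner_Integration.integral_nonneg) simp
    then show "(LINT x|?M. (w x)\<^sup>2) \<le> B" "B > 0" unfolding B_def by linarith+
  qed
  define U0 where "U0 = sqrt (B * R)"
  have uB: "\<bar>u x\<bar> \<le> sqrt (B * x)" if "x \<in> {0..R}" for x
    unfolding u_def by (rule radial_class_growth[OF wi(1,2) B that])
  have u2: "(u x)\<^sup>2 \<le> B * x" if "x \<in> {0..R}" for x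
    using power_mono[OF uB[OF that], of 2] B that by simp
  have uU0: "\<bar>u x\<bar> \<le> U0" if "x \<in> {0..R}" for x
  proof -
    have "sqrt (B * x) \<le> U0" unfolding U0_def using that B by simp
    then show ?thesis using uB[OF that] by linarith
  qed
  have U0: "U0 \<ge> 0" using B R by (simp add: U0_def)
  define V where "V = (\<lambda>x. - x\<^sup>2 - c1 * x * u x + c2 * (u x)\<^sup>2)"
  have \<kappa>V: "\<bar>\<kappa> x\<bar> = \<bar>u x\<bar> * x * \<bar>V x\<bar>" if "0 \<le> x" for x
    using that by (simp add: \<kappa>_def V_def abs_mult)
  have Vtri: "\<bar>V x\<bar> \<le> x\<^sup>2 + c1 * (x * \<bar>u x\<bar>) + c2 * (u x)\<^sup>2" if "0 \<le> x" for x
  proof -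
    have "\<bar>c1 * x * u x\<bar> = c1 * (x * \<bar>u x\<bar>)" "\<bar>c2 * (u x)\<^sup>2\<bar> = c2 * (u x)\<^sup>2" "\<bar>x\<^sup>2\<bar> = x\<^sup>2"
      using c12 that by (simp_all add: abs_mult)
    then show ?thesis unfolding V_def by linarith
  qed
  define D where "D = R + c1 * U0 + c2 * B"
  have D: "D \<ge> 0" using R c12 U0 B by (simp add: D_def)
  have VD: "\<bar>V x\<bar> \<le> D * x" if x: "0 \<le> x" "x \<le> R" for x
  proof -
    have "x\<^sup>2 \<le> R * x" using x by (simp add: power2_eq_square mult_right_mono)
    moreover have "c1 * (x * \<bar>u x\<bar>) \<le> c1 * (x * U0)" using x uU0[of x] c12 by (intro mult_left_mono) auto
    moreover have "c2 * (u x)\<^sup>2 \<le> c2 * (B * x)" using u2[of x] x c12 by (intro mult_left_mono) auto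
    moreover have "D * x = R * x + c1 * (x * U0) + c2 * (B * x)" by (simp add: D_def algebra_simps)
    ultimately show ?thesis using Vtri[OF x(1)] by linarith
  qed
  \<comment> \<open>One round of the bootstrap: \<open>\<kappa>\<close> of order
    \<open>j + 1\<close> gives \<open>K\<close> of order \<open>j + 2\<close>, hence
    \<open>e'\<close> of order \<open>j - 4\<close>, and integrating from \<open>R\<close> gives
    \<open>u\<close> of order \<open>j\<close>. The case \<open>k = 0\<close> is excluded because
    the integration would produce a logarithm.\<close>
  have step: "\<exists>C>0. \<forall>x. 0 < x \<longrightarrow> x \<le> R \<longrightarrow> \<bar>u x\<bar> \<le> C * x ^ j"
    if \<kappa>b: "\<And>x. 0 \<le> x \<Longrightarrow> x \<le> R \<Longrightarrow> \<bar>\<kappa> x\<bar> \<le> A * x ^ Suc j" and A: "A \<ge> 0" and jk: "j + k = 3" "k > 0" for A j k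
  proof -
    have Kb: "\<bar>K x / x ^ 6\<bar> \<le> (A / real k) * real k / x ^ Suc k" if x: "0 < x" "x \<le> R" for x
    proof -
      have "\<bar>K x\<bar> \<le> A * x ^ Suc (Suc j)"
        unfolding K_def using integral_bound_power[OF \<kappa>c \<kappa>b A, of x] x by simp
      then have "\<bar>K x / x ^ 6\<bar> \<le> A * x ^ Suc (Suc j) / x ^ 6"
        using x by (simp add: abs_divide divide_right_mono)
      also have "A * x ^ Suc (Suc j) / x ^ 6 = A * x ^ Suc (Suc j) / (x ^ Suc (Suc j) * x ^ Suc k)"
        using jk by (simp add: power_add[symmetric] del: power_Suc)
      also have "A * x ^ Suc (Suc j) / (x ^ Suc (Suc j) * x ^ Suc k) = (A / real k) * real k / x ^ Suc k"
        using x jk by simp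
      finally show ?thesis .
    qed
    have "A / real k \<ge> 0" using A by simp
    then obtain C where C: "C > 0" "\<And>x. 0 < x \<Longrightarrow> x \<le> R \<Longrightarrow> \<bar>e x\<bar> \<le> C / x ^ k"
      using decay_of_derivative[OF ed Kb R] by blast
    have "\<bar>u x\<bar> \<le> C * x ^ j" if x: "0 < x" "x \<le> R" for x
    proof -
      have "\<bar>u x\<bar> = x ^ 3 * \<bar>e x\<bar>" using ue[OF x(1)] x by (simp add: abs_mult)
      also have "\<dots> \<le> x ^ 3 * (C / x ^ k)" using C(2)[OF x] x by (intro mult_left_mono) auto
      also have "x ^ 3 = x ^ j * x ^ k" using jk by (simp add: power_add[symmetric])
      also have "x ^ j * x ^ k * (C / x ^ k) = C * x ^ j" using x by simp
      finally show ?thesis .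
    qed
    then show ?thesis using C(1) by blast
  qed
  \<comment> \<open>The first round uses only boundedness of \<open>u\<close> and
    \<open>(u x)\<^sup>2 \<le> B * x\<close>; it yields linear decay, and the same estimate of
    \<open>V\<close> then yields quadratic decay.\<close>
  have "\<bar>\<kappa> x\<bar> \<le> (U0 * D) * x ^ Suc 1" if x: "0 \<le> x" "x \<le> R" for x
  proof -
    have "\<bar>u x\<bar> * x * \<bar>V x\<bar> \<le> U0 * x * (D * x)"
      using uU0[of x] VD[OF x] x U0 by (intro mult_mono) auto
    then show ?thesis using \<kappa>V[OF x(1)] by (simp add: mult_ac power2_eq_square)
  qed
  then obtain C1 where C1: "C1 > 0" "\<And>x. 0 < x \<Longrightarrow> x \<le> R \<Longrightarrow> \<bar>u x\<bar> \<le> C1 * x ^ 1"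
    using step[of "U0 * D" 1 2] U0 D by auto
  have u0: "u 0 = 0" by (simp add: u_def)
  have C1': "\<bar>u x\<bar> \<le> C1 * x" if "0 \<le> x" "x \<le> R" for x
    using C1(2)[of x] that u0 by (cases "x = 0") auto
  have "\<bar>\<kappa> x\<bar> \<le> (C1 * D) * x ^ Suc 2" if x: "0 \<le> x" "x \<le> R" for x
  proof -
    have "\<bar>u x\<bar> * x * \<bar>V x\<bar> \<le> (C1 * x) * x * (D * x)"
      using C1'[OF x] VD[OF x] x C1(1) by (intro mult_mono) auto
    then show ?thesis using \<kappa>V[OF x(1)] by (simp add: mult_ac power2_eq_square power3_eq_cube)
  qed
  then obtain C2 where C2: "C2 > 0" "\<And>x. 0 < x \<Longrightarrow> x \<le> R \<Longrightarrow> \<bar>u x\<bar> \<le> C2 * x ^ 2"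
    using step[of "C1 * D" 2 1] C1(1) D by auto
  have C2': "\<bar>u x\<bar> \<le> C2 * x\<^sup>2" if "0 \<le> x" "x \<le> R" for x
    using C2(2)[of x] that u0 by (cases "x = 0") auto
  \<comment> \<open>Linear decay of \<open>u\<close> improves \<open>V\<close> from first to second
    order. Together with the quadratic decay of \<open>u\<close> this makes \<open>\<kappa>\<close>
    of order 5 and \<open>K\<close> of order 6, just enough to bound \<open>e'\<close>.\<close>
  define D' where "D' = 1 + c1 * C1 + c2 * C1\<^sup>2"
  have D': "D' \<ge> 0" using c12 C1(1) by (simp add: D'_def)
  have VD': "\<bar>V x\<bar> \<le> D' * x\<^sup>2" if x: "0 \<le> x" "x \<le> R" for x
  proof -
    have "c1 * (x * \<bar>u x\<bar>) \<le> c1 * (x * (C1 * x))" using C1'[OF x] c12 x by (intro mult_left_mono) auto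
    moreover have "(u x)\<^sup>2 \<le> (C1 * x)\<^sup>2" using power_mono[OF C1'[OF x], of 2] by simp
    then have "c2 * (u x)\<^sup>2 \<le> c2 * (C1 * x)\<^sup>2" using c12 by (intro mult_left_mono) auto
    moreover have "D' * x\<^sup>2 = x\<^sup>2 + c1 * (x * (C1 * x)) + c2 * (C1 * x)\<^sup>2"
      by (simp add: D'_def algebra_simps power2_eq_square)
    ultimately show ?thesis using Vtri[OF x(1)] by linarith
  qed
  have \<kappa>5: "\<bar>\<kappa> x\<bar> \<le> (C2 * D') * x ^ 5" if x: "0 \<le> x" "x \<le> R" for x
  proof -
    have "\<bar>u x\<bar> * x * \<bar>V x\<bar> \<le> (C2 * x\<^sup>2) * x * (D' * x\<^sup>2)"
      using C2'[OF x] VD'[OF x] x C2(1) by (intro mult_mono) auto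
    also have "\<dots> = (C2 * D') * x ^ 5" by (simp add: eval_nat_numeral mult_ac)
    finally show ?thesis using \<kappa>V[OF x(1)] by simp
  qed
  define g where "g = (\<lambda>x. K x / x ^ 6)"
  have gb: "\<bar>g x\<bar> \<le> C2 * D'" if x: "0 < x" "x \<le> R" for x
  proof -
    have "\<bar>K x\<bar> \<le> (C2 * D') * x ^ 6"
      unfolding K_def using integral_bound_power[OF \<kappa>c \<kappa>5, of x] x C2(1) D' by simp
    then show ?thesis using x by (simp add: g_def abs_divide divide_le_eq)
  qed
  have gi: "integrable ?M g"
  proof (rule integrable_bounded_ivl[OF _ gb])
    show "g \<in> borel_measurable ?M" unfolding g_def
      by (intro borel_measurable_divide cm Kc continuous_intros)
  qed
  \<comment> \<open>The quotient \<open>e\<close> has the conventional value 0 at the origin, which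
    need not be its limit. Integrating the bounded derivative back from \<open>R\<close> gives the
    continuous extension.\<close>
  define E where "E = (\<lambda>x. (e R - prim g R) + prim g x)"
  have gp: "primitive R (prim g) g" by (rule primitive_integral[OF gi])
  have Ec: "continuous_on {0..R} E"
    unfolding E_def by (intro continuous_intros primitive_continuous[OF gp])
  have Ee: "E x = e x" if x: "0 < x" "x \<le> R" for x
  proof -
    have "(g has_integral (e R - e x)) {x..R}"
    proof (rule fundamental_theorem_of_calculus[OF x(2)])
      fix y assume y: "y \<in> {x..R}"
      have "(e has_real_derivative g y) (at y within {x..R})"
        unfolding g_def by (rule DERIV_subset[OF ed]) (use x y in auto)
      then show "(e has_vector_derivative g y) (at y within {x..R})"
        by (simp add: has_real_derivative_iff_has_vector_derivative)
    qed
    then have "prim g R - prim g x = e R - e x"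
      using primitive_increment[OF gp, of x R] x by (simp add: integral_unique)
    then show ?thesis by (simp add: E_def)
  qed
  have uE: "u x = x ^ 3 * E x" if "x \<in> {0..R}" for x
    using that u0 ue[of x] Ee[of x] by (cases "x = 0") auto
  define P where "P = source c1 c2 E"
  have Pc: "continuous_on {0..R} P"
    unfolding P_def source_def[abs_def] by (intro continuous_intros Ec)
  have gP: "g x = x * mean_op 6 P x" if x: "0 < x" "x \<le> R" for x
  proof -
    have "K x = integral {0..x} (\<lambda>s. s ^ 6 * P s)"
      unfolding K_def
    proof (rule Henstock_Kurzweil_Integration.integral_cong)
      fix s assume "s \<in> {0..x}"
      then have "u s = s ^ 3 * E s" using uE[of s] x by auto
      then show "\<kappa> s = s ^ 6 * P s"
        unfolding \<kappa>_def P_def source_def by (simp add: eval_nat_numeral algebra_simps)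
    qed
    also have "\<dots> = x ^ Suc 6 * mean_op 6 P x"
      by (rule mean_op_scaling[OF continuous_on_subset[OF Pc] x(1)]) (use x in auto)
    finally have "K x = x * x ^ 6 * mean_op 6 P x" by (simp only: power_Suc)
    then show ?thesis using x by (simp add: g_def)
  qed
  have mc: "continuous_on {0..R} (\<lambda>x. x * mean_op 6 P x)"
    by (intro continuous_intros mean_op_continuous Pc)
  have EE: "E x = E 0 + integral {0..x} (\<lambda>y. y * mean_op 6 P y)" if x: "x \<in> {0..R}" for x
  proof -
    have "prim g x = integral {0..x} (\<lambda>y. y * mean_op 6 P y)"
      by (rule integral_spike[of "{0}"]) (use gP x in auto)
    then show ?thesis by (simp add: E_def)
  qed
  have "(E has_real_derivative x * mean_op 6 P x) (at x within {0..R})" if x: "x \<in> {0..R}" for x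
  proof -
    have "((\<lambda>x. E 0 + integral {0..x} (\<lambda>y. y * mean_op 6 P y)) has_real_derivative 0 + x * mean_op 6 P x) (at x within {0..R})"
      using x by (intro DERIV_add DERIV_const integral_has_real_derivative mc)
    then have "((\<lambda>x. E 0 + integral {0..x} (\<lambda>y. y * mean_op 6 P y)) has_real_derivative x * mean_op 6 P x) (at x within {0..R})"
      by simp
    then show ?thesis
      by (rule has_field_derivative_transform_within[OF _ zero_less_one x]) (rule EE[symmetric])
  qed
  then show ?thesis using uE unfolding P_def u_def by blast
qed

section \<open>Analyticity of the profile\<close>

lemma scaled_in_ivl:
  fixes x s :: real
  assumes "x \<in> {0..R}" "s \<in> {0..1}"
  shows "x * s \<in> {0..R}"
  using assms mult_left_le[of s x] by (auto intro: order_trans)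

lemma DERIV_scaled:
  assumes d: "\<And>x. x \<in> {0..R} \<Longrightarrow> (f has_real_derivative f' x) (at x within {0..R})"
    and x: "x \<in> {0..R}" and s: "s \<in> {0..1}"
  shows "((\<lambda>x. f (x * s)) has_real_derivative f' (x * s) * s) (at x within {0..R})"
    and "((\<lambda>s. f (x * s)) has_real_derivative f' (x * s) * x) (at s within {0..1})"
proof -
  have "(f has_real_derivative f' (x * s)) (at (x * s) within (\<lambda>x. x * s) ` {0..R})"
    by (rule DERIV_subset[OF d[OF scaled_in_ivl[OF x s]]]) (use scaled_in_ivl s in blast)
  moreover have "((\<lambda>x. x * s) has_real_derivative s) (at x within {0..R})" by (auto intro!: derivative_eq_intros)
  ultimately show "((\<lambda>x. f (x * s)) has_real_derivative f' (x * s) * s) (at x within {0..R})"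
    using DERIV_image_chain[of f "f' (x * s)" "\<lambda>x. x * s" x "{0..R}" s] by (simp add: o_def)
  have "(f has_real_derivative f' (x * s)) (at (x * s) within (\<lambda>s. x * s) ` {0..1})"
    by (rule DERIV_subset[OF d[OF scaled_in_ivl[OF x s]]]) (use scaled_in_ivl x in blast)
  moreover have "((\<lambda>s. x * s) has_real_derivative x) (at s within {0..1})" by (auto intro!: derivative_eq_intros)
  ultimately show "((\<lambda>s. f (x * s)) has_real_derivative f' (x * s) * x) (at s within {0..1})"
    using DERIV_image_chain[of f "f' (x * s)" "\<lambda>s. x * s" s "{0..1}" x] by (simp add: o_def)
qed

lemma mean_op_has_derivative:
  assumes d: "\<And>x. x \<in> {0..R} \<Longrightarrow> (f has_real_derivative f' x) (at x within {0..R})"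
    and c: "continuous_on {0..R} f'" and x: "x \<in> {0..R}"
  shows "(mean_op k f has_real_derivative mean_op (Suc k) f' x) (at x within {0..R})"
proof -
  have fc: "continuous_on {0..R} f" using d by (rule DERIV_continuous_on)
  have "((\<lambda>x. integral (cbox 0 1) (\<lambda>s. s ^ k * f (x * s))) has_field_derivative
    integral (cbox 0 1) (\<lambda>s. s ^ Suc k * f' (x * s))) (at x within {0..R})"
  proof (rule leibniz_rule_field_derivative)
    show "((\<lambda>x. s ^ k * f (x * s)) has_field_derivative s ^ Suc k * f' (x * s)) (at x within {0..R})"
      if "x \<in> {0..R}" "s \<in> cbox 0 1" for x s
      using DERIV_cmult[OF DERIV_scaled(1)[OF d that(1)], of s "s ^ k"] that(2) by (simp add: mult_ac)
    show "(\<lambda>s. s ^ k * f (x * s)) integrable_on cbox 0 1" if "x \<in> {0..R}" for x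
      unfolding box_real(2)
      by (intro integrable_continuous_real continuous_intros continuous_on_compose2[OF fc]) (use scaled_in_ivl[OF that] in auto)
    show "continuous_on ({0..R} \<times> cbox 0 1) (\<lambda>(x, s). s ^ Suc k * f' (x * s))"
      unfolding case_prod_unfold
      by (intro continuous_intros continuous_on_compose2[OF c]) (use scaled_in_ivl in force)
  qed (use x in auto)
  then show ?thesis by (simp add: mean_op_def[abs_def])
qed

text \<open>Integration by parts in \<open>s\<close>, a first-order equation for the average. For
  \<open>k = 6\<close> and \<open>f\<close> the source it is the second-order equation of the
  profile, valid at the origin too.\<close>

lemma mean_op_parts:
  assumes d: "\<And>x. x \<in> {0..R} \<Longrightarrow> (f has_real_derivative f' x) (at x within {0..R})"
    and c: "continuous_on {0..R} f'" and x: "x \<in> {0..R}"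
  shows "real (Suc k) * mean_op k f x + x * mean_op (Suc k) f' x = f x"
proof -
  have fc: "continuous_on {0..R} f" using d by (rule DERIV_continuous_on)
  have i: "(\<lambda>s. s ^ k * f (x * s)) integrable_on {0..1}" "(\<lambda>s. s ^ Suc k * f' (x * s)) integrable_on {0..1}"
    by (intro integrable_continuous_real continuous_intros continuous_on_compose2[OF fc] continuous_on_compose2[OF c];
      use scaled_in_ivl[OF x] in auto)+
  have "((\<lambda>s. real (Suc k) * (s ^ k * f (x * s)) + x * (s ^ Suc k * f' (x * s))) has_integral
      1 ^ Suc k * f (x * 1) - 0 ^ Suc k * f (x * 0)) {0..1}"
  proof (rule fundamental_theorem_of_calculus)
    fix s :: real assume s: "s \<in> {0..1}"
    have "((\<lambda>s. s ^ Suc k * f (x * s)) has_real_derivative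
       real (Suc k) * s ^ k * f (x * s) + (f' (x * s) * x) * s ^ Suc k) (at s within {0..1})"
      using DERIV_mult[OF DERIV_pow[of "Suc k" s "{0..1}"] DERIV_scaled(2)[OF d x s]]
      by (simp only: diff_Suc_Suc diff_zero)
    then show "((\<lambda>s. s ^ Suc k * f (x * s)) has_vector_derivative
       real (Suc k) * (s ^ k * f (x * s)) + x * (s ^ Suc k * f' (x * s))) (at s within {0..1})"
      by (simp add: has_real_derivative_iff_has_vector_derivative algebra_simps)
  qed simp
  then have "integral {0..1} (\<lambda>s. real (Suc k) * (s ^ k * f (x * s)) + x * (s ^ Suc k * f' (x * s))) = f x"
    by (simp add: integral_unique del: of_nat_Suc)
  moreover have "integral {0..1} (\<lambda>s. real (Suc k) * (s ^ k * f (x * s)) + x * (s ^ Suc k * f' (x * s))) =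
      real (Suc k) * mean_op k f x + x * mean_op (Suc k) f' x"
    unfolding mean_op_def
    by (subst Henstock_Kurzweil_Integration.integral_add) (use i in \<open>auto intro: integrable_on_mult_right simp del: of_nat_Suc power_Suc\<close>)
  ultimately show ?thesis by simp
qed

lemma mean_op_times: "mean_op k (\<lambda>y. y * f y) x = x * mean_op (Suc k) f x"
proof -
  have "(\<lambda>s. s ^ k * (x * s * f (x * s))) = (\<lambda>s. x * (s ^ Suc k * f (x * s)))"
    by (simp add: mult_ac)
  then show ?thesis unfolding mean_op_def by simp
qed

lemma mean_op_bound:
  assumes b: "\<And>x. x \<in> {0..R} \<Longrightarrow> \<bar>f x\<bar> \<le> M" and c: "continuous_on {0..R} f" and x: "x \<in> {0..R}"
  shows "\<bar>mean_op k f x\<bar> \<le> M"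
proof -
  have "norm (integral {0..1} (\<lambda>s. s ^ k * f (x * s))) \<le> M * (1 - 0)"
  proof (rule integral_bound)
    show "continuous_on {0..1} (\<lambda>s. s ^ k * f (x * s))"
      by (intro continuous_intros continuous_on_compose2[OF c]) (use scaled_in_ivl[OF x] in auto)
    fix s :: real assume s: "s \<in> {0..1}"
    have "\<bar>s ^ k\<bar> * \<bar>f (x * s)\<bar> \<le> 1 * \<bar>f (x * s)\<bar>"
      using s by (intro mult_right_mono) (auto simp: power_le_one)
    then show "norm (s ^ k * f (x * s)) \<le> M" using b[OF scaled_in_ivl[OF x s]] by (simp add: abs_mult)
  qed simp
  then show ?thesis by (simp add: mean_op_def)
qed

text \<open>The Taylor remainder is at most
  \<open>M * (n + 1) * (K * \<bar>z - w\<bar>) ^ (n + 1)\<close>. Derivatives are taken within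
  \<open>S\<close>, so the statement covers the endpoints of a closed interval.\<close>

lemma Taylor_sums:
  fixes f :: "nat \<Rightarrow> real \<Rightarrow> real"
  assumes S: "convex S" and d: "\<And>n x. x \<in> S \<Longrightarrow> (f n has_real_derivative f (Suc n) x) (at x within S)"
    and b: "\<And>n x. x \<in> S \<Longrightarrow> \<bar>f n x\<bar> \<le> M * K ^ n * fact n" and K: "K > 0"
    and w: "w \<in> S" and z: "z \<in> S" and wz: "\<bar>z - w\<bar> < 1 / K"
  shows "(\<lambda>n. f n w / fact n * (z - w) ^ n) sums f 0 z"
  unfolding sums_def_le
proof -
  define q where "q = K * \<bar>z - w\<bar>"
  have q: "norm q < 1" using wz K by (simp add: q_def field_simps abs_mult)
  have "(\<lambda>n. real n * q ^ n) \<longlonglongrightarrow> 0" by (rule powser_times_n_limit_0[OF q])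
  then have "(\<lambda>n. M * (real (Suc n) * q ^ Suc n)) \<longlonglongrightarrow> M * 0"
    by (intro tendsto_mult tendsto_const LIMSEQ_Suc)
  then have lim: "(\<lambda>n. M * (real (Suc n) * q ^ Suc n)) \<longlonglongrightarrow> 0" by simp
  have "(\<lambda>n. f 0 z - (\<Sum>i\<le>n. f i w * (z - w) ^ i / fact i)) \<longlonglongrightarrow> 0"
  proof (rule Lim_null_comparison[OF always_eventually lim], rule allI)
    fix n
    have "norm (f 0 z - (\<Sum>i\<le>n. f i w * (z - w) ^ i / fact i))
        \<le> (M * K ^ Suc n * fact (Suc n)) * norm (z - w) ^ Suc n / fact n"
    proof (rule field_Taylor[of S n f])
      show "norm (f (Suc n) x) \<le> M * K ^ Suc n * fact (Suc n)" if "x \<in> S" for x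
        using b[OF that, of "Suc n"] by simp
    qed (use S d w z in auto)
    also have "\<dots> = M * (real (Suc n) * q ^ Suc n)"
      by (simp add: q_def power_mult_distrib field_simps)
    finally show "norm (f 0 z - (\<Sum>i\<le>n. f i w * (z - w) ^ i / fact i)) \<le> M * (real (Suc n) * q ^ Suc n)" .
  qed
  from tendsto_diff[OF tendsto_const[of "f 0 z"] this]
  have "(\<lambda>n. \<Sum>i\<le>n. f i w * (z - w) ^ i / fact i) \<longlonglongrightarrow> f 0 z" by simp
  then show "(\<lambda>n. \<Sum>i\<le>n. f i w / fact i * (z - w) ^ i) \<longlonglongrightarrow> f 0 z" by simp
qed

text \<open>
  Here \<open>d\<close> bounds the degree in \<open>x\<close> and \<open>e\<close>, and \<open>N\<close> the sum of the coefficients, so that \<open>\<bar>f\<bar> \<le> N B ^ d\<close>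
  once \<open>\<bar>x\<bar>, \<bar>e\<bar> \<le> B\<close>. A derivative raises \<open>d\<close> by 7 and multiplies \<open>N\<close> by a multiple of \<open>d\<close>; this
  linear growth is what makes the Taylor series converge.
\<close>

inductive diff_class :: "(real \<Rightarrow> real) \<Rightarrow> nat \<Rightarrow> real \<Rightarrow> (real \<Rightarrow> real) \<Rightarrow> bool" for e where
  base: "diff_class e 1 1 e"
| ident: "diff_class e 1 1 (\<lambda>x. x)"
| one: "diff_class e 1 1 (\<lambda>x. 1)"
| add: "diff_class e d N f \<Longrightarrow> diff_class e d N' g \<Longrightarrow> diff_class e d (N + N') (\<lambda>x. f x + g x)"
| mult: "diff_class e d N f \<Longrightarrow> diff_class e d' N' g \<Longrightarrow> diff_class e (d + d') (N * N') (\<lambda>x. f x * g x)"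
| cmult: "diff_class e d N f \<Longrightarrow> diff_class e d (\<bar>c\<bar> * N) (\<lambda>x. c * f x)"
| weaken: "diff_class e d N f \<Longrightarrow> d \<le> d' \<Longrightarrow> N \<le> N' \<Longrightarrow> diff_class e d' N' f"
| mean: "diff_class e d N f \<Longrightarrow> diff_class e d N (mean_op k f)"

lemma diff_class_nonneg: "diff_class e d N f \<Longrightarrow> 0 \<le> N"
  by (induction rule: diff_class.induct) auto

lemma diff_class_continuous:
  "diff_class e d N f \<Longrightarrow> continuous_on {0..R} e \<Longrightarrow> continuous_on {0..R} f"
  by (induction rule: diff_class.induct) (auto intro!: continuous_intros mean_op_continuous)

lemma diff_class_bound:
  assumes "diff_class e d N f" and e: "continuous_on {0..R} e" "\<And>x. x \<in> {0..R} \<Longrightarrow> \<bar>e x\<bar> \<le> B"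
    and B: "B \<ge> 1" "B \<ge> R"
  shows "x \<in> {0..R} \<Longrightarrow> \<bar>f x\<bar> \<le> N * B ^ d"
  using assms(1)
proof (induction arbitrary: x rule: diff_class.induct)
  case (add d N f N' g)
  show ?case
    using abs_triangle_ineq[of "f x" "g x"] add.IH(1)[OF add.prems] add.IH(2)[OF add.prems] by (simp add: distrib_right)
next
  case (mult d N f d' N' g)
  have "\<bar>f x\<bar> * \<bar>g x\<bar> \<le> (N * B ^ d) * (N' * B ^ d')"
    using mult.IH(1)[of x] mult.IH(2)[of x] mult.prems diff_class_nonneg[OF mult.hyps(1)] B by (intro mult_mono) auto
  then show ?case by (simp add: abs_mult power_add mult_ac)
next
  case (cmult d N f c)
  then show ?case using mult_left_mono[OF cmult.IH[of x], of "\<bar>c\<bar>"] by (simp add: abs_mult mult.assoc)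
next
  case (weaken d N f d' N')
  have "N * B ^ d \<le> N' * B ^ d'"
    using weaken diff_class_nonneg[OF weaken.hyps(1)] B by (intro mult_mono power_increasing) auto
  then show ?case using weaken.IH[of x] weaken.prems by linarith
next
  case (mean d N f k)
  show ?case
    by (rule mean_op_bound[OF mean.IH diff_class_continuous[OF mean.hyps e(1)] mean.prems])
qed (use e B in auto)

text \<open>The top monomial \<open>x ^ 4 * e ^ 3\<close> has degree 7. As \<open>e'\<close> is
  \<open>x\<close> times an average of the source, it has degree 8, and this is why one
  differentiation costs 7 degrees.\<close>

lemma diff_class_source:
  "diff_class e 7 (1 + \<bar>c1\<bar> + \<bar>c2\<bar>) (source c1 c2 e)"
proof -
  have 1: "diff_class e 7 1 (\<lambda>x. (-1) * e x)"
    by (rule diff_class.weaken[OF diff_class.cmult[OF diff_class.base]]) auto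
  have x2: "diff_class e (1 + 1) (1 * 1) (\<lambda>x. x * x)" by (intro diff_class.mult diff_class.ident)
  have e2: "diff_class e (1 + 1) (1 * 1) (\<lambda>x. e x * e x)" by (intro diff_class.mult diff_class.base)
  have xe: "diff_class e ((1 + 1) + (1 + 1)) ((1 * 1) * (1 * 1)) (\<lambda>x. (x * x) * (e x * e x))"
    by (rule diff_class.mult[OF x2 e2])
  have 2: "diff_class e 7 \<bar>c1\<bar> (\<lambda>x. (- c1) * ((x * x) * (e x * e x)))"
    by (rule diff_class.weaken[OF diff_class.cmult[OF xe]]) auto
  have "diff_class e (((1 + 1) + (1 + 1)) + ((1 + 1) + 1)) (((1 * 1) * (1 * 1)) * ((1 * 1) * 1))
      (\<lambda>x. ((x * x) * (e x * e x)) * ((x * x) * e x))"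
    by (rule diff_class.mult[OF xe diff_class.mult[OF x2 diff_class.base]])
  then have 3: "diff_class e 7 \<bar>c2\<bar> (\<lambda>x. c2 * (((x * x) * (e x * e x)) * ((x * x) * e x)))"
    by (rule diff_class.weaken[OF diff_class.cmult]) auto
  have "source c1 c2 e = (\<lambda>x. (-1) * e x + (- c1) * ((x * x) * (e x * e x)) + c2 * (((x * x) * (e x * e x)) * ((x * x) * e x)))"
    by (simp add: source_def fun_eq_iff eval_nat_numeral mult_ac)
  then show ?thesis using diff_class.add[OF diff_class.add[OF 1 2] 3] by simp
qed

text \<open>The factor \<open>d\<close> is compatible with the product rule: the degrees of the two
  factors add in the derivative just as they do in the product. For averages the derivative is the
  next average of the derivative, with the same degree and weight.\<close>

lemma diff_class_derivative:
  assumes "diff_class e d N f"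
    and e: "\<And>x. x \<in> {0..R} \<Longrightarrow> (e has_real_derivative x * mean_op 6 (source c1 c2 e) x) (at x within {0..R})"
    and L: "L = 1 + \<bar>c1\<bar> + \<bar>c2\<bar>"
  shows "\<exists>f'. diff_class e (d + 7) (real d * L * N) f' \<and>
    (\<forall>x\<in>{0..R}. (f has_real_derivative f' x) (at x within {0..R}))"
  using assms(1)
proof (induction rule: diff_class.induct)
  case base
  have "diff_class e (1 + 7) (1 * L) (\<lambda>x. x * mean_op 6 (source c1 c2 e) x)"
    unfolding L by (intro diff_class.mult diff_class.ident diff_class.mean diff_class_source)
  then show ?case using e by (intro exI[of _ "\<lambda>x. x * mean_op 6 (source c1 c2 e) x"]) auto
next
  case ident
  have "diff_class e (1 + 7) (real 1 * L * 1) (\<lambda>x. 1)"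
    by (rule diff_class.weaken[OF diff_class.one]) (auto simp: L)
  then show ?case by (intro exI[of _ "\<lambda>x. 1"]) (auto intro!: derivative_eq_intros)
next
  case one
  have "diff_class e (1 + 7) (real 1 * L * 1) (\<lambda>x. 0 * 1)"
    by (rule diff_class.weaken[OF diff_class.cmult[OF diff_class.one]]) (auto simp: L)
  then show ?case by (intro exI[of _ "\<lambda>x. 0"]) auto
next
  case (add d N f N' g)
  then obtain f' g' where f': "diff_class e (d + 7) (real d * L * N) f'"
      "\<forall>x\<in>{0..R}. (f has_real_derivative f' x) (at x within {0..R})"
    and g': "diff_class e (d + 7) (real d * L * N') g'"
      "\<forall>x\<in>{0..R}. (g has_real_derivative g' x) (at x within {0..R})" by blast
  have "diff_class e (d + 7) (real d * L * (N + N')) (\<lambda>x. f' x + g' x)"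
    using diff_class.add[OF f'(1) g'(1)] by (simp add: algebra_simps)
  then show ?case using f'(2) g'(2) by (intro exI[of _ "\<lambda>x. f' x + g' x"]) (auto intro!: DERIV_add)
next
  case (mult d N f d' N' g)
  then obtain f' g' where f': "diff_class e (d + 7) (real d * L * N) f'"
      "\<forall>x\<in>{0..R}. (f has_real_derivative f' x) (at x within {0..R})"
    and g': "diff_class e (d' + 7) (real d' * L * N') g'"
      "\<forall>x\<in>{0..R}. (g has_real_derivative g' x) (at x within {0..R})" by blast
  have "diff_class e (d + d' + 7) (real d * L * N * N') (\<lambda>x. f' x * g x)"
    using diff_class.mult[OF f'(1) mult.hyps(2)] by (simp add: add_ac)
  moreover have "diff_class e (d + d' + 7) (real d' * L * N' * N) (\<lambda>x. g' x * f x)"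
    using diff_class.mult[OF g'(1) mult.hyps(1)] by (simp add: add_ac)
  ultimately have "diff_class e (d + d' + 7) (real d * L * N * N' + real d' * L * N' * N) (\<lambda>x. f' x * g x + g' x * f x)"
    by (rule diff_class.add)
  moreover have "real d * L * N * N' + real d' * L * N' * N = real (d + d') * L * (N * N')"
    by (simp add: algebra_simps)
  ultimately show ?case
    using f'(2) g'(2) by (intro exI[of _ "\<lambda>x. f' x * g x + g' x * f x"]) (auto intro!: DERIV_mult)
next
  case (cmult d N f c)
  then obtain f' where f': "diff_class e (d + 7) (real d * L * N) f'"
      "\<forall>x\<in>{0..R}. (f has_real_derivative f' x) (at x within {0..R})" by blast
  have "diff_class e (d + 7) (real d * L * (\<bar>c\<bar> * N)) (\<lambda>x. c * f' x)"
    using diff_class.cmult[OF f'(1), of c] by (simp add: mult_ac)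
  then show ?case using f'(2) by (intro exI[of _ "\<lambda>x. c * f' x"]) (auto intro!: DERIV_cmult)
next
  case (weaken d N f d' N')
  then obtain f' where f': "diff_class e (d + 7) (real d * L * N) f'"
      "\<forall>x\<in>{0..R}. (f has_real_derivative f' x) (at x within {0..R})" by blast
  have "real d * L * N \<le> real d' * L * N'"
    using weaken.hyps diff_class_nonneg[OF weaken.hyps(1)] by (intro mult_mono) (auto simp: L)
  then have "diff_class e (d' + 7) (real d' * L * N') f'"
    using weaken.hyps(2) by (intro diff_class.weaken[OF f'(1)]) auto
  then show ?case using f'(2) by blast
next
  case (mean d N f k)
  then obtain f' where f': "diff_class e (d + 7) (real d * L * N) f'"
      "\<forall>x\<in>{0..R}. (f has_real_derivative f' x) (at x within {0..R})" by blast
  have ec: "continuous_on {0..R} e" using e by (rule DERIV_continuous_on)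
  have "(mean_op k f has_real_derivative mean_op (Suc k) f' x) (at x within {0..R})" if "x \<in> {0..R}" for x
    using f'(2) that by (intro mean_op_has_derivative diff_class_continuous[OF f'(1) ec]) auto
  then show ?case using diff_class.mean[OF f'(1), of "Suc k"] by blast
qed

theorem diff_class_analytic:
  assumes f: "diff_class e d N f"
    and e: "\<And>x. x \<in> {0..R} \<Longrightarrow> (e has_real_derivative x * mean_op 6 (source c1 c2 e) x) (at x within {0..R})"
  shows "real_analytic_on f {0..R}"
proof -
  define L where "L = 1 + \<bar>c1\<bar> + \<bar>c2\<bar>"
  have L: "L \<ge> 1" by (simp add: L_def)
  have ec: "continuous_on {0..R} e" using e by (rule DERIV_continuous_on)
  then have "bounded (e ` {0..R})" using compact_continuous_image compact_imp_bounded by blast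
  then obtain B0 where B0: "\<And>x. x \<in> {0..R} \<Longrightarrow> \<bar>e x\<bar> \<le> B0" by (force simp: bounded_iff)
  define B where "B = max 1 (max R B0)"
  have B: "B \<ge> 1" "B \<ge> R" by (simp_all add: B_def)
  have eB: "\<bar>e x\<bar> \<le> B" if "x \<in> {0..R}" for x
    using B0[OF that] by (simp add: B_def)
  let ?P = "\<lambda>n g. \<exists>N'. N' \<le> N * (real (d + 7) * L) ^ n * fact n \<and> diff_class e (d + 7 * n) N' g"
  have "\<exists>F. F 0 = f \<and> (\<forall>n. ?P n (F n) \<and> (\<forall>x\<in>{0..R}. (F n has_real_derivative F (Suc n) x) (at x within {0..R})))"
    proof -
      have step: "\<exists>g'. ?P (Suc n) g' \<and> (\<forall>x\<in>{0..R}. (g has_real_derivative g' x) (at x within {0..R}))"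
        if Pg: "?P n g" for n g
      proof -
        obtain N' where N': "N' \<le> N * (real (d + 7) * L) ^ n * fact n" "diff_class e (d + 7 * n) N' g"
          using Pg by blast
        have "\<exists>g'. diff_class e (d + 7 * n + 7) (real (d + 7 * n) * L * N') g' \<and>
            (\<forall>x\<in>{0..R}. (g has_real_derivative g' x) (at x within {0..R}))"
          by (rule diff_class_derivative[OF N'(2) e L_def])
        then obtain g' where g': "diff_class e (d + 7 * n + 7) (real (d + 7 * n) * L * N') g'"
          "\<forall>x\<in>{0..R}. (g has_real_derivative g' x) (at x within {0..R})"
          by blast
        \<comment> \<open>The factor \<open>Suc n\<close> here, multiplied over all steps, is what
          builds the factorial.\<close>
        have "real (d + 7 * n) \<le> real (d + 7) * real (Suc n)"
          by (simp add: algebra_simps)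
        then have "real (d + 7 * n) * L * N' \<le> (real (d + 7) * real (Suc n)) * L * (N * (real (d + 7) * L) ^ n * fact n)"
          using N'(1) L diff_class_nonneg[OF N'(2)] by (intro mult_mono) auto
        also have "\<dots> = N * (real (d + 7) * L) ^ Suc n * fact (Suc n)" by simp
        finally show ?thesis using g' by (intro exI[of _ g'] conjI exI[of _ "real (d + 7 * n) * L * N'"]) (auto simp: add_ac)
      qed
      have P0: "?P 0 f" using f by auto
      \<comment> \<open>All derivatives are chosen by one recursion, so that each is the derivative
        of the one actually chosen before it and carries its bound.\<close>
      define F where "F = rec_nat f (\<lambda>n g. SOME g'. ?P (Suc n) g' \<and> (\<forall>x\<in>{0..R}. (g has_real_derivative g' x) (at x within {0..R})))"
      have FS: "F (Suc n) = (SOME g'. ?P (Suc n) g' \<and> (\<forall>x\<in>{0..R}. (F n has_real_derivative g' x) (at x within {0..R})))" for n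
        by (simp add: F_def)
      have PF: "?P n (F n)" for n
      proof (induction n)
        case 0
        show ?case using P0 by (simp add: F_def)
      next
        case (Suc n)
        show ?case using someI_ex[OF step[OF Suc]] unfolding FS by blast
      qed
      have "\<forall>x\<in>{0..R}. (F n has_real_derivative F (Suc n) x) (at x within {0..R})" for n
        using someI_ex[OF step[OF PF[of n]]] unfolding FS by blast
      moreover have "F 0 = f" by (simp add: F_def)
      ultimately show ?thesis using PF by blast
    qed
  then obtain F where F0: "F 0 = f" and F': "\<forall>n. ?P n (F n) \<and> (\<forall>x\<in>{0..R}. (F n has_real_derivative F (Suc n) x) (at x within {0..R}))"
    by blast
  have F: "?P n (F n)" "x \<in> {0..R} \<Longrightarrow> (F n has_real_derivative F (Suc n) x) (at x within {0..R})" for n x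
    using F' by blast+
  \<comment> \<open>The reciprocal serves as radius of convergence at every point;
    \<open>B ^ 7\<close> pays for the growth of the degree.\<close>
  define K where "K = real (d + 7) * L * B ^ 7"
  have K: "K > 0" using L B(1) by (simp add: K_def)
  have bound: "\<bar>F n x\<bar> \<le> (N * B ^ d) * K ^ n * fact n" if x: "x \<in> {0..R}" for n x
  proof -
    obtain N' where N': "N' \<le> N * (real (d + 7) * L) ^ n * fact n" "diff_class e (d + 7 * n) N' (F n)" using F(1) by blast
    have "\<bar>F n x\<bar> \<le> N' * B ^ (d + 7 * n)" by (rule diff_class_bound[OF N'(2) ec eB B x])
    also have "\<dots> \<le> (N * (real (d + 7) * L) ^ n * fact n) * B ^ (d + 7 * n)"
      using N'(1) B(1) by (intro mult_right_mono) auto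
    also have "B ^ (d + 7 * n) = B ^ d * (B ^ 7) ^ n"
      by (simp only: power_add power_mult)
    also have "(N * (real (d + 7) * L) ^ n * fact n) * (B ^ d * (B ^ 7) ^ n) = (N * B ^ d) * K ^ n * fact n"
      unfolding K_def power_mult_distrib by (simp only: mult_ac)
    finally show ?thesis .
  qed
  show ?thesis unfolding real_analytic_on_def
  proof (intro ballI)
    fix x0 assume x0: "x0 \<in> {0..R}"
    show "\<exists>a. \<exists>\<delta>>0. \<forall>x\<in>{0..R}. \<bar>x - x0\<bar> < \<delta> \<longrightarrow> (\<lambda>n. a n * (x - x0) ^ n) sums f x"
    proof (intro exI[of _ "\<lambda>n. F n x0 / fact n"] exI[of _ "1 / K"] conjI ballI impI)
      fix x assume x: "x \<in> {0..R}" "\<bar>x - x0\<bar> < 1 / K"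
      show "(\<lambda>n. F n x0 / fact n * (x - x0) ^ n) sums f x"
        using Taylor_sums[OF convex_real_interval(5) F(2) bound K x0 x] F0 by simp
    qed (use K in simp)
  qed
qed

text \<open>The source contains \<open>x\<close> only in even powers, and \<open>e'\<close> is
  divisible by \<open>x\<close>; so the derivative of the source is divisible by \<open>x\<close>,
  and the average passes this factor on to the derivative of \<open>e1\<close>. This evenness is
  what smoothness of a radial function at the origin demands.\<close>

lemma profile_second_derivative:
  assumes e: "\<And>x. x \<in> {0..R} \<Longrightarrow> (e has_real_derivative x * mean_op 6 (source c1 c2 e) x) (at x within {0..R})"
  defines "e1 \<equiv> mean_op 6 (source c1 c2 e)"
  shows "\<exists>e2. continuous_on {0..R} e2 \<and> (\<forall>x\<in>{0..R}. (e1 has_real_derivative x * e2 x) (at x within {0..R}) \<and>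
     7 * e1 x + x\<^sup>2 * e2 x = source c1 c2 e x)"
proof -
  have ec: "continuous_on {0..R} e" using e by (rule DERIV_continuous_on)
  have Pc: "continuous_on {0..R} (source c1 c2 e)" unfolding source_def[abs_def] by (intro continuous_intros ec)
  have e1c: "continuous_on {0..R} e1" unfolding e1_def by (rule mean_op_continuous[OF Pc])
  define P1 where "P1 = (\<lambda>x. - e1 x - c1 * (2 * (e x)\<^sup>2 + 2 * x\<^sup>2 * e x * e1 x)
      + c2 * (4 * x\<^sup>2 * e x ^ 3 + 3 * x ^ 4 * (e x)\<^sup>2 * e1 x))"
  have P1c: "continuous_on {0..R} P1" unfolding P1_def by (intro continuous_intros ec e1c)
  have Pd: "(source c1 c2 e has_real_derivative x * P1 x) (at x within {0..R})" if x: "x \<in> {0..R}" for x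
    unfolding source_def[abs_def] P1_def
    by (rule derivative_eq_intros e[OF x, folded e1_def] refl | simp add: algebra_simps eval_nat_numeral)+
  have c: "continuous_on {0..R} (\<lambda>x. x * P1 x)" by (intro continuous_intros P1c)
  define e2 where "e2 = mean_op 8 P1"
  have mt: "mean_op (Suc 6) (\<lambda>x. x * P1 x) x = x * e2 x" for x
    unfolding mean_op_times e2_def by simp
  have "(e1 has_real_derivative x * e2 x) (at x within {0..R})" "7 * e1 x + x\<^sup>2 * e2 x = source c1 c2 e x"
    if x: "x \<in> {0..R}" for x
    using mean_op_has_derivative[OF Pd c x, of 6] mean_op_parts[OF Pd c x, of 6]
    unfolding mt e1_def by (simp_all add: power2_eq_square mult.assoc)
  moreover have "continuous_on {0..R} e2" unfolding e2_def by (rule mean_op_continuous[OF P1c])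
  ultimately show ?thesis by blast
qed

section \<open>The hedgehog\<close>

text \<open>The factor \<open>r\<close> in the derivative of \<open>f\<close> cancels the
  denominator in the gradient of the norm. At the origin the derivative of \<open>f\<close>
  vanishes, so the same formula holds there.\<close>

lemma radial_has_derivative:
  fixes x :: "'a::euclidean_space"
  assumes d: "\<And>r. r \<in> {0..R} \<Longrightarrow> (f has_real_derivative r * f1 r) (at r within {0..R})" and x: "norm x < R"
  shows "((\<lambda>y. f (norm y)) has_derivative (\<lambda>v. f1 (norm x) * (x \<bullet> v))) (at x)"
proof (cases "x = 0")
  case False
  then have "(f has_real_derivative norm x * f1 (norm x)) (at (norm x))"
    using d[of "norm x"] x by (simp add: at_within_Icc_at)
  then have "(f has_derivative (\<lambda>v. (norm x * f1 (norm x)) * v)) (at (norm x))"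
    by (simp add: has_field_derivative_def)
  from diff_chain_at[OF has_derivative_norm[OF False] this]
  have "((\<lambda>y. f (norm y)) has_derivative (\<lambda>v. (norm x * f1 (norm x)) * (sgn x \<bullet> v))) (at x)"
    by (simp add: o_def inner_commute)
  moreover have "(\<lambda>v. (norm x * f1 (norm x)) * (sgn x \<bullet> v)) = (\<lambda>v. f1 (norm x) * (x \<bullet> v))"
    using False by (simp add: sgn_div_norm fun_eq_iff)
  ultimately show ?thesis by simp
next
  case True
  have R: "R > 0" using x True by simp
  have "(*) (0::real) = (\<lambda>v. 0)" by auto
  then have "(f has_derivative (\<lambda>v. 0)) (at 0 within {0..R})"
    using d[of 0] R by (simp add: has_field_derivative_def del: lambda_zero)
  then have f0: "\<forall>e>0. \<exists>d>0. \<forall>y\<in>{0..R}. norm (y - 0) < d \<longrightarrow> norm (f y - f 0 - 0) \<le> e * norm (y - 0)"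
    unfolding has_derivative_within_alt by blast
  have "((\<lambda>y::'a. f (norm y)) has_derivative (\<lambda>v. 0)) (at 0)"
    unfolding has_derivative_at_alt
  proof (intro conjI allI impI)
    fix \<epsilon> :: real assume "0 < \<epsilon>"
    then obtain \<delta> where \<delta>: "\<delta> > 0" "\<forall>y\<in>{0..R}. norm (y - 0) < \<delta> \<longrightarrow> norm (f y - f 0 - 0) \<le> \<epsilon> * norm (y - 0)"
      using f0 by blast
    show "\<exists>d>0. \<forall>y::'a. norm (y - 0) < d \<longrightarrow> norm (f (norm y) - f (norm (0::'a)) - 0) \<le> \<epsilon> * norm (y - 0)"
    proof (intro exI[of _ "min \<delta> R"] conjI allI impI)
      fix y :: 'a assume "norm (y - 0) < min \<delta> R"
      then show "norm (f (norm y) - f (norm (0::'a)) - 0) \<le> \<epsilon> * norm (y - 0)"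
        using \<delta>(2)[rule_format, of "norm y"] by simp
    qed (use \<delta>(1) R in simp)
  qed simp
  then show ?thesis using True by simp
qed

lemma has_derivative_vec_nth [derivative_intros]:
  "((\<lambda>x::real^'n. x $ i) has_derivative (\<lambda>v. v $ i)) F"
  by (rule bounded_linear_imp_has_derivative) (rule bounded_linear_vec_nth)

lemma frechet_derivativeI: "(f has_derivative f') (at x) \<Longrightarrow> frechet_derivative f (at x) = f'"
  by (rule frechet_derivative_at[symmetric])

text \<open>Here \<open>e1\<close> stands for \<open>e' / r\<close> and \<open>e2\<close> for
  \<open>e1' / r\<close>, so that every formula is free of division. In these terms
  \<open>e'' + 6 e' / r\<close> is \<open>7 * e1 + r\<^sup>2 * e2\<close>. Minimality is left out:
  criticality of the hedgehog uses only the equation.\<close>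

locale radial_profile =
  fixes t R :: real and h e e1 e2 :: "real \<Rightarrow> real"
  assumes t: "t > 1" and R: "R > 0"
    and he: "\<And>r. r \<in> {0..R} \<Longrightarrow> h r = r\<^sup>2 * e r"
    and e': "\<And>r. r \<in> {0..R} \<Longrightarrow> (e has_real_derivative r * e1 r) (at r within {0..R})"
    and e1': "\<And>r. r \<in> {0..R} \<Longrightarrow> (e1 has_real_derivative r * e2 r) (at r within {0..R})"
    and e2c: "continuous_on {0..R} e2"
    and profile_eq: "\<And>r. r \<in> {0..R} \<Longrightarrow> 7 * e1 r + r\<^sup>2 * e2 r =
      source (3 * (h_plus t / t)) (4 * ((h_plus t)\<^sup>2 / (2 * t))) e r"
begin

lemma ec: "continuous_on {0..R} e" using e' by (rule DERIV_continuous_on)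
lemma e1c: "continuous_on {0..R} e1" using e1' by (rule DERIV_continuous_on)

definition kd :: "3 \<Rightarrow> 3 \<Rightarrow> real" where "kd i j = (if i = j then 1/3 else 0)"

definition dp :: "3 \<Rightarrow> 3 \<Rightarrow> real^3 \<Rightarrow> real^3 \<Rightarrow> real" where
  "dp i j x v = v $ i * x $ j + x $ i * v $ j - 2 * kd i j * (x \<bullet> v)"

text \<open>A homogeneous harmonic polynomial of degree two. The hedgehog is such a polynomial times
  the radial factor \<open>e\<close>, which removes the apparent singularity of its direction field
  at the origin.\<close>

definition pol :: "3 \<Rightarrow> 3 \<Rightarrow> real^3 \<Rightarrow> real" where
  "pol i j x = x $ i * x $ j - kd i j * (x \<bullet> x)"

definition Q :: "3 \<Rightarrow> 3 \<Rightarrow> real^3 \<Rightarrow> real" where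
  "Q i j x = sqrt (3/2) * (e (norm x) * pol i j x)"

definition dQ :: "3 \<Rightarrow> 3 \<Rightarrow> real^3 \<Rightarrow> real^3 \<Rightarrow> real" where
  "dQ i j x v = sqrt (3/2) * (e (norm x) * dp i j x v + e1 (norm x) * (x \<bullet> v) * pol i j x)"

text \<open>The derivative of \<open>dQ\<close> with \<open>v\<close> held fixed, taken in direction
  \<open>w\<close>; the terms are grouped as the product rule produces them.\<close>

definition ddQ :: "3 \<Rightarrow> 3 \<Rightarrow> real^3 \<Rightarrow> real^3 \<Rightarrow> real^3 \<Rightarrow> real" where
  "ddQ i j x v w = sqrt (3/2) * ((e (norm x) * dp i j w v + e1 (norm x) * (x \<bullet> w) * dp i j x v) +
     (e1 (norm x) * (x \<bullet> v) * dp i j x w + (e1 (norm x) * (w \<bullet> v) + e2 (norm x) * (x \<bullet> w) * (x \<bullet> v)) * pol i j x))"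

lemma hedgehog_eq:
  assumes "norm x \<le> R"
  shows "hedgehog h x $ i $ j = Q i j x"
proof (cases "x = 0")
  case True
  then show ?thesis using he[of 0] R by (simp add: hedgehog_def Q_def pol_def)
next
  case False
  then have n: "norm x \<noteq> 0" by simp
  have "hedgehog h x $ i $ j = sqrt (3/2) * h (norm x) * (x $ i * x $ j / (norm x)\<^sup>2 - kd i j)"
    by (simp add: hedgehog_def mat_def kd_def)
  also have "\<dots> = sqrt (3/2) * ((norm x)\<^sup>2 * e (norm x)) * (x $ i * x $ j / (norm x)\<^sup>2 - kd i j)"
    using he[of "norm x"] assms by simp
  also have "\<dots> = sqrt (3/2) * (e (norm x) * (x $ i * x $ j - kd i j * (norm x)\<^sup>2))"
    using n by (simp add: field_simps)
  finally show ?thesis by (simp add: Q_def pol_def power2_norm_eq_inner)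
qed

lemma pol_has_derivative: "(pol i j has_derivative dp i j x) (at x)"
  unfolding pol_def[abs_def] dp_def[abs_def]
  by (auto intro!: derivative_eq_intros simp: algebra_simps inner_commute)

lemma dp_has_derivative: "((\<lambda>x. dp i j x v) has_derivative (\<lambda>w. dp i j w v)) (at x)"
  unfolding dp_def[abs_def]
  by (auto intro!: derivative_eq_intros simp: algebra_simps inner_commute)

lemma Q_has_derivative:
  assumes "norm x < R"
  shows "(Q i j has_derivative dQ i j x) (at x)"
  unfolding Q_def[abs_def] dQ_def[abs_def]
  by (intro has_derivative_mult_right has_derivative_mult radial_has_derivative[OF e' assms] pol_has_derivative)

lemma dQ_has_derivative:
  assumes "norm x < R"
  shows "((\<lambda>x. dQ i j x v) has_derivative (\<lambda>w. ddQ i j x v w)) (at x)"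
proof -
  have A: "((\<lambda>x. e (norm x) * dp i j x v) has_derivative
      (\<lambda>w. e (norm x) * dp i j w v + e1 (norm x) * (x \<bullet> w) * dp i j x v)) (at x)"
    by (rule has_derivative_mult[OF radial_has_derivative[OF e' assms] dp_has_derivative])
  have I: "((\<lambda>x. x \<bullet> v) has_derivative (\<lambda>w. w \<bullet> v)) (at x)"
    by (auto intro!: derivative_eq_intros)
  have B: "((\<lambda>x. e1 (norm x) * (x \<bullet> v)) has_derivative (\<lambda>w. e1 (norm x) * (w \<bullet> v) + e2 (norm x) * (x \<bullet> w) * (x \<bullet> v))) (at x)"
    by (rule has_derivative_mult[OF radial_has_derivative[OF e1' assms] I])
  show ?thesis
    unfolding dQ_def[abs_def] ddQ_def[abs_def]
    by (rule has_derivative_mult_right[OF has_derivative_add[OF A has_derivative_mult[OF B pol_has_derivative]]])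
qed

lemma radial_continuous:
  assumes "continuous_on {0..R} f"
  shows "continuous_on (cball 0 R) (\<lambda>x::real^3. f (norm x))"
  by (rule continuous_on_compose2[OF assms]) (auto intro: continuous_intros)

lemma Q_continuous: "continuous_on (cball 0 R) (Q i j)"
  unfolding Q_def[abs_def] pol_def by (intro continuous_intros radial_continuous ec)

lemma dQ_continuous: "continuous_on (cball 0 R) (\<lambda>x. dQ i j x v)"
  unfolding dQ_def pol_def dp_def by (intro continuous_intros radial_continuous ec e1c)

lemma ddQ_continuous: "continuous_on (cball 0 R) (\<lambda>x. ddQ i j x v w)"
  unfolding ddQ_def pol_def dp_def by (intro continuous_intros radial_continuous ec e1c e2c)

lemma hedgehog_has_derivative:
  assumes "norm x < R"
  shows "((\<lambda>y. hedgehog h y $ i $ j) has_derivative dQ i j x) (at x)"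
  by (rule has_derivative_transform_within_open[OF Q_has_derivative[OF assms], of "ball 0 R"])
    (use assms hedgehog_eq in auto)

lemma Ck_hedgehog: "Ck_on 2 (ball 0 R) (\<lambda>x. hedgehog h x $ i $ j)"
proof -
  have 1: "Ck_on (Suc 0) (ball 0 R) (\<lambda>x. dQ i j x v)" for v
    unfolding Ck_on.simps
    by (intro exI[of _ "\<lambda>x w. ddQ i j x v w"] conjI ballI allI dQ_has_derivative continuous_on_subset[OF ddQ_continuous]) auto
  have "Ck_on (Suc (Suc 0)) (ball 0 R) (\<lambda>x. hedgehog h x $ i $ j)"
    unfolding Ck_on.simps(2)[of "Suc 0"]
    by (intro exI[of _ "\<lambda>x. dQ i j x"] conjI ballI allI hedgehog_has_derivative 1) auto
  then show ?thesis by (simp add: numeral_2_eq_2)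
qed

lemma laplacian_hedgehog:
  assumes x: "norm x < R"
  shows "laplacian (\<lambda>y. hedgehog h y $ i $ j) x = (\<Sum>k\<in>UNIV. ddQ i j x (axis k 1) (axis k 1))"
  unfolding laplacian_def
proof (rule sum.cong[OF refl])
  fix k :: 3
  have "partial_deriv k (\<lambda>y. hedgehog h y $ i $ j) y = dQ i j y (axis k 1)" if "y \<in> ball 0 R" for y
    unfolding partial_deriv_def using frechet_derivativeI[OF hedgehog_has_derivative[of y i j]] that by simp
  then have "(partial_deriv k (\<lambda>y. hedgehog h y $ i $ j) has_derivative (\<lambda>w. ddQ i j x (axis k 1) w)) (at x)"
    by (intro has_derivative_transform_within_open[OF dQ_has_derivative[OF x, of i j "axis k 1"], of "ball 0 R"])
      (use x in auto)
  from frechet_derivativeI[OF this]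
  show "partial_deriv k (partial_deriv k (\<lambda>y. hedgehog h y $ i $ j)) x = ddQ i j x (axis k 1) (axis k 1)"
    by (simp add: partial_deriv_def)
qed

text \<open>Since \<open>pol\<close> is harmonic and homogeneous of degree two, the Laplacian of
  \<open>e * pol\<close> is \<open>pol\<close> times \<open>e'' + (2 + 4) e' / r\<close>, where 2
  comes from the dimension and 4 from the cross term. The computation itself is done in
  coordinates.\<close>

lemma laplacian_Q:
  assumes "norm x \<le> R"
  shows "(\<Sum>k\<in>UNIV. ddQ i j x (axis k 1) (axis k 1)) =
    sqrt (3/2) * (source (3 * (h_plus t / t)) (4 * ((h_plus t)\<^sup>2 / (2 * t))) e (norm x) * pol i j x)"
proof -
  have n: "(norm x)\<^sup>2 = x$1 * x$1 + x$2 * x$2 + x$3 * x$3"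
    by (simp add: power2_norm_eq_inner inner_vec_def sum_3)
  have "(\<Sum>k\<in>UNIV. ddQ i j x (axis k 1) (axis k 1)) = sqrt (3/2) * ((7 * e1 (norm x) + (norm x)\<^sup>2 * e2 (norm x)) * pol i j x)"
    unfolding n sum_3 ddQ_def dp_def pol_def kd_def inner_vec_def
    using exhaust_3[of i] exhaust_3[of j]
    by (auto simp: axis_def sum_3 algebra_simps)
  then show ?thesis using profile_eq[of "norm x"] assms by simp
qed

section \<open>Algebra of the hedgehog matrix\<close>

definition Qm :: "real^3 \<Rightarrow> real^3^3" where "Qm x = (\<chi> i j. Q i j x)"

lemma hedgehog_Qm: "norm x \<le> R \<Longrightarrow> hedgehog h x = Qm x"
  by (simp add: vec_eq_iff Qm_def hedgehog_eq)

text \<open>The matrix of all \<open>pol i j x\<close> has eigenvalues 2/3, -1/3, -1/3 times the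
  squared norm, which explains the traces 2/3 and 6/27.\<close>

lemma pol_algebra:
  shows "(\<Sum>k\<in>UNIV. pol i k x * pol k j x) = (norm x)\<^sup>2 / 3 * (x $ i * x $ j) + kd i j * ((norm x)\<^sup>2)\<^sup>2 / 3"
    and "(\<Sum>i\<in>UNIV. \<Sum>k\<in>UNIV. pol i k x * pol k i x) = 2 / 3 * ((norm x)\<^sup>2)\<^sup>2"
    and "(\<Sum>i\<in>UNIV. \<Sum>k\<in>UNIV. (\<Sum>l\<in>UNIV. pol i l x * pol l k x) * pol k i x) = 2 / 9 * ((norm x)\<^sup>2) ^ 3"
proof -
  have n: "(norm x)\<^sup>2 = x$1 * x$1 + x$2 * x$2 + x$3 * x$3" "x \<bullet> x = x$1 * x$1 + x$2 * x$2 + x$3 * x$3"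
    by (simp_all add: power2_norm_eq_inner inner_vec_def sum_3)
  show "(\<Sum>k\<in>UNIV. pol i k x * pol k j x) = (norm x)\<^sup>2 / 3 * (x $ i * x $ j) + kd i j * ((norm x)\<^sup>2)\<^sup>2 / 3"
    unfolding n sum_3 pol_def kd_def
    using exhaust_3[of i] exhaust_3[of j]
    by (auto simp: field_simps power2_eq_square)
  show "(\<Sum>i\<in>UNIV. \<Sum>k\<in>UNIV. pol i k x * pol k i x) = 2 / 3 * ((norm x)\<^sup>2)\<^sup>2"
    unfolding n sum_3 pol_def kd_def by (simp add: field_simps power2_eq_square)
  show "(\<Sum>i\<in>UNIV. \<Sum>k\<in>UNIV. (\<Sum>l\<in>UNIV. pol i l x * pol l k x) * pol k i x) = 2 / 9 * ((norm x)\<^sup>2) ^ 3"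
    unfolding n sum_3 pol_def kd_def by (simp add: field_simps power2_eq_square power3_eq_cube)
qed

text \<open>The normalization \<open>sqrt (3/2)\<close> is made for this: with
  \<open>h = r\<^sup>2 * e\<close> the trace of the square is \<open>h\<^sup>2\<close>, and
  \<open>sqrt 6\<close> times that of the cube is \<open>h ^ 3\<close>. The bulk energy of the
  matrix thus becomes the scalar potential.\<close>

lemma Q_algebra:
  shows "(\<Sum>k\<in>UNIV. Q i k x * Q k j x) = 3/2 * (e (norm x))\<^sup>2 * ((norm x)\<^sup>2 / 3 * (x $ i * x $ j) + kd i j * ((norm x)\<^sup>2)\<^sup>2 / 3)"
    and "trace (Qm x ** Qm x) = (e (norm x))\<^sup>2 * ((norm x)\<^sup>2)\<^sup>2"
    and "sqrt 6 * trace (Qm x ** Qm x ** Qm x) = (e (norm x)) ^ 3 * ((norm x)\<^sup>2) ^ 3"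
proof -
  define c where "c = sqrt (3/2) * e (norm x)"
  have c2: "c\<^sup>2 = 3/2 * (e (norm x))\<^sup>2" by (simp add: c_def power_mult_distrib)
  have s6: "sqrt 6 = 2 * sqrt (3/2)"
    using real_sqrt_mult[of 4 "3/2"] by simp
  have c3: "sqrt 6 * c ^ 3 = 9/2 * (e (norm x)) ^ 3"
  proof -
    have "sqrt 6 * c ^ 3 = 2 * ((sqrt (3/2))\<^sup>2)\<^sup>2 * (e (norm x)) ^ 3"
      by (simp only: s6 c_def) algebra
    then show ?thesis by (simp add: power2_eq_square)
  qed
  have Qc: "Q i j x = c * pol i j x" for i j by (simp add: Q_def c_def mult.assoc)
  have 1: "(\<Sum>k\<in>UNIV. Q i k x * Q k j x) = c\<^sup>2 * (\<Sum>k\<in>UNIV. pol i k x * pol k j x)" for i j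
    unfolding sum_distrib_left by (rule sum.cong) (auto simp: Qc power2_eq_square mult_ac)
  show "(\<Sum>k\<in>UNIV. Q i k x * Q k j x) = 3/2 * (e (norm x))\<^sup>2 * ((norm x)\<^sup>2 / 3 * (x $ i * x $ j) + kd i j * ((norm x)\<^sup>2)\<^sup>2 / 3)"
    unfolding 1 pol_algebra(1) c2 ..
  have "trace (Qm x ** Qm x) = c\<^sup>2 * (\<Sum>i\<in>UNIV. \<Sum>k\<in>UNIV. pol i k x * pol k i x)"
  proof -
    have "trace (Qm x ** Qm x) = (\<Sum>i\<in>UNIV. \<Sum>k\<in>UNIV. Q i k x * Q k i x)"
      by (simp add: trace_def matrix_matrix_mult_def Qm_def)
    then show ?thesis unfolding 1 by (simp only: sum_distrib_left)
  qed
  then show "trace (Qm x ** Qm x) = (e (norm x))\<^sup>2 * ((norm x)\<^sup>2)\<^sup>2"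
    unfolding pol_algebra(2) c2 by simp
  have "trace (Qm x ** Qm x ** Qm x) = (\<Sum>i\<in>UNIV. \<Sum>k\<in>UNIV. (\<Sum>l\<in>UNIV. Q i l x * Q l k x) * Q k i x)"
    by (simp add: trace_def matrix_matrix_mult_def Qm_def)
  also have "\<dots> = c ^ 3 * (\<Sum>i\<in>UNIV. \<Sum>k\<in>UNIV. (\<Sum>l\<in>UNIV. pol i l x * pol l k x) * pol k i x)"
    unfolding 1 sum_distrib_left[of "c ^ 3"] by (intro sum.cong refl) (simp add: Qc power3_eq_cube power2_eq_square mult_ac)
  finally have "sqrt 6 * trace (Qm x ** Qm x ** Qm x) = (sqrt 6 * c ^ 3) * (2 / 9 * ((norm x)\<^sup>2) ^ 3)"
    unfolding pol_algebra(3) by simp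
  then show "sqrt 6 * trace (Qm x ** Qm x ** Qm x) = (e (norm x)) ^ 3 * ((norm x)\<^sup>2) ^ 3"
    unfolding c3 by simp
qed

text \<open>The traceless part of the squared matrix is a multiple of the matrix itself. So all
  entries of the system share one scalar factor, and that factor is the source of the profile
  equation.\<close>

lemma EL_Q:
  assumes "norm x \<le> R"
  shows "(\<Sum>k\<in>UNIV. ddQ i j x (axis k 1) (axis k 1)) = - Q i j x
    - 3 * sqrt 6 * h_plus t / t * ((\<Sum>k\<in>UNIV. Q i k x * Q k j x) - kd i j * trace (Qm x ** Qm x))
    + 2 * (h_plus t)\<^sup>2 / t * Q i j x * trace (Qm x ** Qm x)"
proof -
  define s where "s = sqrt (3/2)"
  have s6: "sqrt 6 = 2 * s" unfolding s_def using real_sqrt_mult[of 4 "3/2"] by simp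
  have t0: "t \<noteq> 0" using t by simp
  have p: "x $ i * x $ j = pol i j x + kd i j * (norm x)\<^sup>2"
    by (simp add: pol_def power2_norm_eq_inner)
  show ?thesis
    unfolding laplacian_Q[OF assms] Q_algebra
    unfolding source_def Q_def p s_def[symmetric] s6
    using t0 by (simp add: field_simps eval_nat_numeral)
qed

lemma EL_solution: "LdG_EL_solution t R (hedgehog h)"
  unfolding LdG_EL_solution_def
proof (intro conjI allI ballI)
  fix i j show "Ck_on 2 (ball 0 R) (\<lambda>x. hedgehog h x $ i $ j)" by (rule Ck_hedgehog)
next
  fix x :: "real^3" and i j :: 3 assume "x \<in> ball 0 R"
  then have x: "norm x < R" by simp
  show "laplacian (\<lambda>y. hedgehog h y $ i $ j) x = - hedgehog h x $ i $ j -
     3 * sqrt 6 * h_plus t / t * ((\<Sum>k\<in>UNIV. hedgehog h x $ i $ k * hedgehog h x $ k $ j) -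
      (if i = j then 1 else 0) / 3 * trace (hedgehog h x ** hedgehog h x)) +
     2 * (h_plus t)\<^sup>2 / t * hedgehog h x $ i $ j * trace (hedgehog h x ** hedgehog h x)"
    using EL_Q[of x i j] x unfolding laplacian_hedgehog[OF x]
    by (simp add: hedgehog_Qm Qm_def kd_def)
qed

section \<open>Sobolev regularity on the ball\<close>

lemma L2_ball:
  fixes g :: "real^3 \<Rightarrow> real"
  assumes c: "continuous_on (cball 0 R) g"
  shows "g \<in> L2_on (ball 0 R)" "integrable (lebesgue_on (cball 0 R)) g"
proof -
  have i: "integrable (lebesgue_on (cball 0 R)) f" if "continuous_on (cball 0 R) f" for f :: "real^3 \<Rightarrow> real"
  proof -
    have "integrable lborel (\<lambda>x. indicator (cball 0 R) x *\<^sub>R f x)"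
      using that by (intro borel_integrable_compact) auto
    then have "integrable lebesgue (\<lambda>x. indicator (cball 0 R) x *\<^sub>R f x)"
      by (subst integrable_completion) auto
    then show ?thesis by (simp add: integrable_restrict_space)
  qed
  show "integrable (lebesgue_on (cball 0 R)) g" by (rule i[OF c])
  have "integrable (lebesgue_on (ball 0 R)) (\<lambda>x. (g x)\<^sup>2)"
  proof -
    have "integrable (lebesgue_on (cball 0 R)) (\<lambda>x. (g x)\<^sup>2)" by (intro i continuous_intros c)
    then have 1: "integrable lebesgue (\<lambda>x. indicator (cball 0 R) x *\<^sub>R (g x)\<^sup>2)"
      by (simp add: integrable_restrict_space)
    have "integrable lebesgue (\<lambda>x. indicator (ball 0 R) x *\<^sub>R (indicator (cball 0 R) x *\<^sub>R (g x)\<^sup>2))"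
      by (rule integrable_mult_indicator[OF _ 1]) auto
    moreover have "(\<lambda>x. indicator (ball 0 R) x *\<^sub>R (indicator (cball 0 R) x *\<^sub>R (g x)\<^sup>2)) = (\<lambda>x. indicator (ball 0 R) x *\<^sub>R (g x)\<^sup>2)"
      by (auto simp: fun_eq_iff indicator_def)
    ultimately show ?thesis by (simp add: integrable_restrict_space)
  qed
  moreover have "g \<in> borel_measurable (lebesgue_on (ball 0 R))"
    using c by (intro continuous_imp_measurable_on_sets_lebesgue) (auto intro: continuous_on_subset)
  ultimately show "g \<in> L2_on (ball 0 R)" by (simp add: L2_on_def)
qed

text \<open>Continuity up to the boundary is placed on the extension \<open>g\<close> and on
  \<open>u'\<close>; it gives square integrability by compactness, while \<open>u\<close> is
  controlled in the open ball alone.\<close>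

lemma W12_C1_ball:
  fixes u :: "real^3 \<Rightarrow> real"
  assumes d: "\<And>x. x \<in> ball 0 R \<Longrightarrow> (u has_derivative u' x) (at x)"
    and u: "\<And>x. x \<in> ball 0 R \<Longrightarrow> u x = g x" "continuous_on (cball 0 R) g" and c: "\<And>v. continuous_on (cball 0 R) (\<lambda>x. u' x v)"
  shows "has_weak_deriv (ball 0 R) u v (\<lambda>x. u' x v)" "u \<in> W12 (ball 0 R)"
proof -
  have w: "has_weak_deriv (ball 0 R) u v (\<lambda>x. u' x v)" for v
    by (rule has_weak_deriv_classical[OF open_ball d continuous_on_subset[OF c]]) auto
  show "has_weak_deriv (ball 0 R) u v (\<lambda>x. u' x v)" by (rule w)
  have g2: "g \<in> L2_on (ball 0 R)" by (rule L2_ball[OF u(2)])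
  have "u \<in> L2_on (ball 0 R)"
  proof -
    have "u \<in> borel_measurable (lebesgue_on (ball 0 R)) \<longleftrightarrow> g \<in> borel_measurable (lebesgue_on (ball 0 R))"
      by (rule measurable_lebesgue_cong) (rule u)
    moreover have "integrable (lebesgue_on (ball 0 R)) (\<lambda>x. (u x)\<^sup>2) \<longleftrightarrow> integrable (lebesgue_on (ball 0 R)) (\<lambda>x. (g x)\<^sup>2)"
      by (rule Bochner_Integration.integrable_cong) (auto simp: u(1))
    ultimately show ?thesis using g2 by (simp add: L2_on_def)
  qed
  then show "u \<in> W12 (ball 0 R)"
    unfolding W12_def using w L2_ball(1)[OF c] by blast
qed

lemma hedgehog_W12: "hedgehog h \<in> W12_S_bar (ball 0 R)"
  unfolding W12_S_bar_def mem_Collect_eq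
proof (intro conjI ballI allI)
  fix x :: "real^3" assume "x \<in> ball 0 R"
  then have x: "hedgehog h x = Qm x" by (simp add: hedgehog_Qm)
  have n: "(norm x)\<^sup>2 = x$1 * x$1 + x$2 * x$2 + x$3 * x$3" "x \<bullet> x = x$1 * x$1 + x$2 * x$2 + x$3 * x$3"
    by (simp_all add: power2_norm_eq_inner inner_vec_def sum_3)
  show "hedgehog h x \<in> S_bar"
    unfolding S_bar_def x
    by (auto simp: vec_eq_iff transpose_def Qm_def Q_def pol_def kd_def trace_def sum_3 n algebra_simps)
next
  fix i j :: 3
  show "(\<lambda>x. hedgehog h x $ i $ j) \<in> W12 (ball 0 R)"
    by (rule W12_C1_ball(2)[OF hedgehog_has_derivative hedgehog_eq Q_continuous dQ_continuous]) auto
qed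

end

section \<open>The Landau-de Gennes energy of the hedgehog\<close>

text \<open>Completeness supplies the measurability of \<open>f\<close>. This matters because the
  integrands in the energies contain chosen weak derivatives.\<close>

lemma lebesgue_integral_cong_AE:
  fixes f g :: "'a::euclidean_space \<Rightarrow> real"
  assumes S: "S \<in> sets lebesgue" and g: "g \<in> borel_measurable (lebesgue_on S)"
    and ae: "AE x in lebesgue_on S. f x = g x"
  shows "(LINT x|lebesgue_on S. f x) = (LINT x|lebesgue_on S. g x)"
proof -
  have gm: "(\<lambda>x. indicator S x *\<^sub>R g x) \<in> borel_measurable lebesgue"
    using g S by (simp add: borel_measurable_restrict_space_iff)
  have "AE x in lebesgue. x \<in> S \<longrightarrow> f x = g x"
    using ae S by (subst (asm) AE_restrict_space_iff) auto
  then have ae': "AE x in lebesgue. indicator S x *\<^sub>R f x = indicator S x *\<^sub>R g x"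
    by eventually_elim (auto simp: indicator_def)
  have "(\<lambda>x. indicator S x *\<^sub>R f x) \<in> borel_measurable lebesgue"
    by (rule measurable_AE_lebesgue[OF gm ae'])
  then have "(\<integral>x. indicator S x *\<^sub>R f x \<partial>lebesgue) = (\<integral>x. indicator S x *\<^sub>R g x \<partial>lebesgue)"
    using gm ae' by (intro integral_cong_AE)
  then show ?thesis using S by (simp add: integral_restrict_space)
qed

lemma AE_cball_of_ball:
  fixes c :: "'a::euclidean_space"
  assumes "AE x in lebesgue_on (ball c R). P x"
  shows "AE x in lebesgue_on (cball c R). P x"
proof -
  have "AE x in lebesgue. x \<in> ball c R \<longrightarrow> P x"
    using assms by (subst (asm) AE_restrict_space_iff) auto
  moreover have "AE x in lebesgue. x \<notin> sphere c R"
    using negligible_sphere[of c R] unfolding negligible_iff_null_sets by (rule AE_not_in)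
  ultimately have "AE x in lebesgue. x \<in> cball c R \<longrightarrow> P x"
    by eventually_elim (auto simp: sphere_def)
  then show ?thesis by (subst AE_restrict_space_iff) auto
qed

lemma integral_cball_eq_ball:
  fixes g :: "'a::euclidean_space \<Rightarrow> real"
  assumes "g \<in> borel_measurable (lebesgue_on (cball c R))"
  shows "(LINT x|lebesgue_on (cball c R). g x) = (LINT x|lebesgue_on (ball c R). g x)"
proof -
  have "(LINT x|lebesgue_on (cball c R). indicator (ball c R) x * g x) = (LINT x|lebesgue_on (cball c R). g x)"
  proof (rule lebesgue_integral_cong_AE[OF _ assms])
    show "AE x in lebesgue_on (cball c R). indicator (ball c R) x * g x = g x"
      by (intro AE_cball_of_ball AE_I2) simp
  qed simp
  moreover have "(\<lambda>x. indicator (cball c R) x * (indicator (ball c R) x * g x)) = (\<lambda>x. indicator (ball c R) x * g x)"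
    by (auto simp: indicator_def fun_eq_iff)
  ultimately show ?thesis by (simp add: integral_restrict_space)
qed

text \<open>Polar coordinates as a push-forward under the norm. Two measures on the line with equal
  finite values on upper half-lines coincide, and these values are differences of ball volumes,
  whose derivative in the radius is the density.\<close>

lemma norm_distribution_R3:
  assumes R: "R > 0"
  shows "distr (restrict_space lborel (cball (0::real^3) R)) borel norm =
    density lborel (\<lambda>r. ennreal (indicator {0..R} r * (4 * pi * r\<^sup>2)))" (is "?N = ?D")
proof (rule measure_eqI_lessThan)
  let ?V = "\<lambda>r::real. 4 / 3 * pi * r ^ 3"
  have cb: "emeasure lborel (cball (0::real^3) r) = ennreal (?V r)" if "r \<ge> 0" for r
    using that by (simp add: emeasure_cball eval_unit_ball_vol)
  have nm [measurable]: "norm \<in> measurable (restrict_space lborel (cball (0::real^3) R)) borel"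
    by (intro measurable_restrict_space1) simp
  have N: "emeasure ?N {a<..} = emeasure lborel {x \<in> cball (0::real^3) R. a < norm x}" for a
  proof -
    have "emeasure ?N {a<..} = emeasure (restrict_space lborel (cball (0::real^3) R)) (norm -` {a<..} \<inter> cball 0 R)"
      by (subst emeasure_distr[OF nm]) (auto simp: space_restrict_space)
    also have "\<dots> = emeasure lborel (norm -` {a<..} \<inter> cball (0::real^3) R)"
      by (rule emeasure_restrict_space) auto
    also have "norm -` {a<..} \<inter> cball (0::real^3) R = {x \<in> cball 0 R. a < norm x}" by auto
    finally show ?thesis .
  qed
  have D: "emeasure ?D {a<..} = (\<integral>\<^sup>+r. ennreal (4 * pi * r\<^sup>2) * indicator {max a 0..R} r \<partial>lborel)" for a
  proof -
    have "AE r in lborel. r \<noteq> a" by (rule AE_lborel_singleton)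
    then have "AE r in lborel. ennreal (indicator {0..R} r * (4 * pi * r\<^sup>2)) * indicator {a<..} r =
        ennreal (4 * pi * r\<^sup>2) * indicator {max a 0..R} r"
      by eventually_elim (auto simp: indicator_def)
    then show ?thesis by (subst emeasure_density) (auto intro: nn_integral_cong_AE)
  qed
  have Dv: "emeasure ?D {a<..} = ennreal (?V R - ?V (max a 0))" if "a \<le> R" for a
    unfolding D
    by (rule nn_integral_FTC_Icc) (use that R in \<open>auto intro!: derivative_eq_intros simp: power2_eq_square\<close>)
  show "emeasure ?N {a<..} = emeasure ?D {a<..}" for a
  proof -
    consider "a < 0" | "0 \<le> a" "a \<le> R" | "R < a" by linarith
    then show ?thesis
    proof cases
      case 1
      then have "{x \<in> cball (0::real^3) R. a < norm x} = cball 0 R"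
        by (auto intro: less_le_trans)
      then show ?thesis using 1 Dv[of a] cb[of R] R unfolding N by simp
    next
      case 2
      have "{x \<in> cball (0::real^3) R. a < norm x} = cball 0 R - cball 0 a" by auto
      moreover have "emeasure lborel (cball (0::real^3) R - cball 0 a) = emeasure lborel (cball (0::real^3) R) - emeasure lborel (cball (0::real^3) a)"
        using 2 by (intro emeasure_Diff) (auto simp: cb)
      moreover have "\<dots> = ennreal (?V R - ?V a)"
        using 2 R by (simp add: cb ennreal_minus)
      ultimately show ?thesis using Dv[of a] 2 unfolding N by simp
    next
      case 3
      then have "{x \<in> cball (0::real^3) R. a < norm x} = {}" by auto
      moreover have "emeasure ?D {a<..} = 0" unfolding D using 3 R by simp
      ultimately show ?thesis unfolding N by (simp only: emeasure_empty)
    qed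
  qed
  show "emeasure ?N {a<..} < \<infinity>" for a
  proof -
    have "emeasure ?N {a<..} \<le> emeasure lborel (cball (0::real^3) R)"
      unfolding N by (rule emeasure_mono) auto
    then show ?thesis using cb[of R] R by (auto intro: order_le_less_trans)
  qed
qed auto

lemma radial_integral_R3:
  fixes F :: "real \<Rightarrow> real"
  assumes R: "R > 0" and F: "continuous_on {0..R} F"
  shows "(LINT x|lebesgue_on (cball (0::real^3) R). F (norm x)) = 4 * pi * (LINT r|lebesgue_on {0..R}. r\<^sup>2 * F r)"
proof -
  let ?B = "cball (0::real^3) R"
  \<comment> \<open>Cutting \<open>F\<close> off outside the interval makes it Borel on the whole
    line, as the transformation formula requires.\<close>
  define g where "g = (\<lambda>r. indicator {0..R} r * F r)"
  have gm [measurable]: "g \<in> borel_measurable borel"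
    using borel_measurable_continuous_on_indicator[OF _ F] by (simp add: g_def)
  have nm: "norm \<in> measurable (restrict_space lborel ?B) borel"
    by (intro measurable_restrict_space1) simp
  have "(\<lambda>x. indicator ?B x *\<^sub>R F (norm x)) = (\<lambda>x. indicator ?B x *\<^sub>R g (norm x))"
    by (auto simp: g_def indicator_def fun_eq_iff)
  then have "(LINT x|lebesgue_on ?B. F (norm x)) = (\<integral>x. indicator ?B x *\<^sub>R g (norm x) \<partial>lebesgue)"
    by (simp add: integral_restrict_space)
  also have "\<dots> = (\<integral>x. indicator ?B x *\<^sub>R g (norm x) \<partial>lborel)"
  proof (rule integral_completion)
    have [measurable]: "?B \<in> sets borel" by simp
    show "(\<lambda>x. indicator ?B x *\<^sub>R g (norm x)) \<in> borel_measurable lborel" by measurable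
  qed
  also have "\<dots> = (\<integral>x. g (norm x) \<partial>restrict_space lborel ?B)"
    by (subst integral_restrict_space) auto
  also have "\<dots> = (\<integral>r. g r \<partial>distr (restrict_space lborel ?B) borel norm)"
    by (rule integral_distr[OF nm gm, symmetric])
  also have "\<dots> = (\<integral>r. (indicator {0..R} r * (4 * pi * r\<^sup>2)) *\<^sub>R g r \<partial>lborel)"
    unfolding norm_distribution_R3[OF R] by (rule integral_density) auto
  also have "\<dots> = (\<integral>r. 4 * pi * (indicator {0..R} r * (r\<^sup>2 * F r)) \<partial>lborel)"
    by (rule Bochner_Integration.integral_cong) (auto simp: g_def indicator_def)
  also have "\<dots> = 4 * pi * (\<integral>r. indicator {0..R} r * (r\<^sup>2 * F r) \<partial>lborel)" by simp
  also have "(\<integral>r. indicator {0..R} r * (r\<^sup>2 * F r) \<partial>lborel) = (\<integral>r. indicator {0..R} r * (r\<^sup>2 * F r) \<partial>lebesgue)"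
  proof (rule integral_completion[symmetric])
    have "continuous_on {0..R} (\<lambda>r. r\<^sup>2 * F r)" by (intro continuous_intros F)
    from borel_measurable_continuous_on_indicator[OF _ this]
    show "(\<lambda>r. indicator {0..R} r * (r\<^sup>2 * F r)) \<in> borel_measurable lborel" by simp
  qed
  also have "\<dots> = (LINT r|lebesgue_on {0..R}. r\<^sup>2 * F r)" by (simp add: integral_restrict_space)
  finally show ?thesis .
qed

text \<open>The traces of products, with each factor as a separate argument. As multilinear forms
  they expand in powers of \<open>\<epsilon>\<close> by linearity alone.\<close>

definition tr2 :: "real^3^3 \<Rightarrow> real^3^3 \<Rightarrow> real" where
  "tr2 A B = (\<Sum>i\<in>UNIV. \<Sum>k\<in>UNIV. A $ i $ k * B $ k $ i)"

definition tr3 :: "real^3^3 \<Rightarrow> real^3^3 \<Rightarrow> real^3^3 \<Rightarrow> real" where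
  "tr3 A B C = (\<Sum>i\<in>UNIV. \<Sum>k\<in>UNIV. (\<Sum>l\<in>UNIV. A $ i $ l * B $ l $ k) * C $ k $ i)"

lemma trace_tr2: "trace (A ** B) = tr2 A B"
  and trace_tr3: "trace (A ** B ** C) = tr3 A B C"
  by (simp_all add: trace_def matrix_matrix_mult_def tr2_def tr3_def)

lemma tr2_expand: "tr2 (A + \<epsilon> *\<^sub>R B) (A + \<epsilon> *\<^sub>R B) = tr2 A A + \<epsilon> * (tr2 A B + tr2 B A) + \<epsilon>\<^sup>2 * tr2 B B"
  by (simp add: tr2_def sum.distrib sum_distrib_left algebra_simps power2_eq_square)

lemma tr3_linear:
  "tr3 (A + \<epsilon> *\<^sub>R A') B C = tr3 A B C + \<epsilon> * tr3 A' B C"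
  "tr3 A (B + \<epsilon> *\<^sub>R B') C = tr3 A B C + \<epsilon> * tr3 A B' C"
  "tr3 A B (C + \<epsilon> *\<^sub>R C') = tr3 A B C + \<epsilon> * tr3 A B C'"
  by (simp_all add: tr3_def sum.distrib sum_distrib_left sum_distrib_right algebra_simps)

lemma tr3_expand: "tr3 (A + \<epsilon> *\<^sub>R B) (A + \<epsilon> *\<^sub>R B) (A + \<epsilon> *\<^sub>R B) = tr3 A A A
    + \<epsilon> * (tr3 A A B + tr3 A B A + tr3 B A A) + \<epsilon>\<^sup>2 * (tr3 A B B + tr3 B A B + tr3 B B A) + \<epsilon> ^ 3 * tr3 B B B"
  unfolding tr3_linear by (simp add: algebra_simps power2_eq_square power3_eq_cube)

lemma tr_cyclic: "tr2 B A = tr2 A B" "tr3 A B A = tr3 A A B" "tr3 B A A = tr3 A A B"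
  by (simp_all add: tr2_def tr3_def sum_3 algebra_simps)

lemma continuous_on_tr2:
  fixes A B :: "real^3 \<Rightarrow> real^3^3"
  assumes "\<And>i j. continuous_on S (\<lambda>x. A x $ i $ j)" "\<And>i j. continuous_on S (\<lambda>x. B x $ i $ j)"
  shows "continuous_on S (\<lambda>x. tr2 (A x) (B x))"
  unfolding tr2_def by (intro continuous_on_sum continuous_on_mult assms)

lemma continuous_on_tr3:
  fixes A B C :: "real^3 \<Rightarrow> real^3^3"
  assumes "\<And>i j. continuous_on S (\<lambda>x. A x $ i $ j)" "\<And>i j. continuous_on S (\<lambda>x. B x $ i $ j)"
    "\<And>i j. continuous_on S (\<lambda>x. C x $ i $ j)"
  shows "continuous_on S (\<lambda>x. tr3 (A x) (B x) (C x))"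
  unfolding tr3_def by (intro continuous_on_sum continuous_on_mult assms)

context radial_profile
begin

definition bulk_density :: "real^3^3 \<Rightarrow> real" where
  "bulk_density A = - 1 / 2 * tr2 A A - sqrt 6 * h_plus t / t * tr3 A A A
     + (h_plus t)\<^sup>2 / (2 * t) * (tr2 A A)\<^sup>2 + C_const t"

text \<open>The passage from weak to classical derivatives in the energy, for the hedgehog and all
  its variations at once. The weak derivatives live on the open ball, and its boundary sphere is
  null.\<close>

lemma perturbed_energy:
  fixes P :: "real^3 \<Rightarrow> real^3^3"
  assumes P: "\<And>i j. (\<lambda>x. P x $ i $ j) \<in> test_functions (ball 0 R)"
  defines "p \<equiv> (\<lambda>i j k x. frechet_derivative (\<lambda>x. P x $ i $ j) (at x) (axis k 1))"
  shows "LdG_energy t R (\<lambda>x. hedgehog h x + \<epsilon> *\<^sub>R P x) =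
    (LINT x|lebesgue_on (cball 0 R). 1/2 * (\<Sum>i\<in>UNIV. \<Sum>j\<in>UNIV. \<Sum>k\<in>UNIV. (dQ i j x (axis k 1) + \<epsilon> * p i j k x)\<^sup>2)
      + bulk_density (Qm x + \<epsilon> *\<^sub>R P x))"
proof -
  let ?U = "ball (0::real^3) R"
  have Pd: "((\<lambda>x. P x $ i $ j) has_derivative frechet_derivative (\<lambda>x. P x $ i $ j) (at x)) (at x)" for i j x
    by (rule test_function_derivative(1)[OF P])
  have Pc: "continuous_on S (\<lambda>x. P x $ i $ j)" for S i j
    using test_function_continuous[OF P] by (rule continuous_on_subset) simp
  have pc: "continuous_on S (\<lambda>x. frechet_derivative (\<lambda>x. P x $ i $ j) (at x) v)" for S i j v
    using test_function_continuous[OF test_function_derivative(2)[OF P]] by (rule continuous_on_subset) simp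
  have wd: "has_weak_deriv ?U (\<lambda>y. (hedgehog h y + \<epsilon> *\<^sub>R P y) $ i $ j) (axis k 1) (\<lambda>x. dQ i j x (axis k 1) + \<epsilon> * p i j k x)" for i j k
    unfolding p_def
  proof (rule W12_C1_ball(1))
    show "((\<lambda>y. (hedgehog h y + \<epsilon> *\<^sub>R P y) $ i $ j) has_derivative
        (\<lambda>v. dQ i j x v + \<epsilon> * frechet_derivative (\<lambda>x. P x $ i $ j) (at x) v)) (at x)" if "x \<in> ?U" for x
      using has_derivative_add[OF hedgehog_has_derivative has_derivative_mult_right[OF Pd], of x i j \<epsilon> i j] that by simp
    show "(hedgehog h x + \<epsilon> *\<^sub>R P x) $ i $ j = Q i j x + \<epsilon> * P x $ i $ j" if "x \<in> ?U" for x
      using hedgehog_eq[of x i j] that by simp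
  qed (intro continuous_intros Q_continuous dQ_continuous Pc pc)+
  have "AE x in lebesgue_on ?U. weak_deriv ?U (\<lambda>y. (hedgehog h y + \<epsilon> *\<^sub>R P y) $ i $ j) (axis k 1) x = dQ i j x (axis k 1) + \<epsilon> * p i j k x" for i j k
    by (rule AE_weak_deriv(1)[OF open_ball wd])
  then have "AE x in lebesgue_on ?U. \<forall>i j k. weak_deriv ?U (\<lambda>y. (hedgehog h y + \<epsilon> *\<^sub>R P y) $ i $ j) (axis k 1) x = dQ i j x (axis k 1) + \<epsilon> * p i j k x"
    by (simp add: AE_all_countable)
  then have ae: "AE x in lebesgue_on (cball 0 R). \<forall>i j k. weak_deriv ?U (\<lambda>y. (hedgehog h y + \<epsilon> *\<^sub>R P y) $ i $ j) (axis k 1) x = dQ i j x (axis k 1) + \<epsilon> * p i j k x"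
    by (rule AE_cball_of_ball)
  have Ac: "continuous_on (cball 0 R) (\<lambda>x. (Qm x + \<epsilon> *\<^sub>R P x) $ i $ j)" for i j
    by (simp add: Qm_def) (intro continuous_intros Q_continuous Pc)
  show ?thesis
    unfolding LdG_energy_def
  proof (rule lebesgue_integral_cong_AE)
    have "continuous_on (cball 0 R) (\<lambda>x. 1/2 * (\<Sum>i\<in>UNIV. \<Sum>j\<in>UNIV. \<Sum>k\<in>UNIV. (dQ i j x (axis k 1) + \<epsilon> * p i j k x)\<^sup>2)
      + bulk_density (Qm x + \<epsilon> *\<^sub>R P x))"
      unfolding bulk_density_def p_def
      by (intro continuous_on_add continuous_on_diff continuous_on_mult continuous_on_const continuous_on_sum
        continuous_on_power dQ_continuous pc continuous_on_tr2[OF Ac Ac] continuous_on_tr3[OF Ac Ac Ac])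
    then show "(\<lambda>x. 1/2 * (\<Sum>i\<in>UNIV. \<Sum>j\<in>UNIV. \<Sum>k\<in>UNIV. (dQ i j x (axis k 1) + \<epsilon> * p i j k x)\<^sup>2)
      + bulk_density (Qm x + \<epsilon> *\<^sub>R P x)) \<in> borel_measurable (lebesgue_on (cball 0 R))"
      by (rule continuous_imp_measurable_on_sets_lebesgue) simp
    have "AE x in lebesgue_on (cball (0::real^3) R). x \<in> cball 0 R" by (rule AE_I2) simp
    with ae show "AE x in lebesgue_on (cball 0 R). 1 / 2 * (\<Sum>i\<in>UNIV. \<Sum>j\<in>UNIV. \<Sum>k\<in>UNIV.
         (weak_deriv ?U (\<lambda>y. (hedgehog h y + \<epsilon> *\<^sub>R P y) $ i $ j) (axis k 1) x)\<^sup>2) -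
         1 / 2 * trace ((hedgehog h x + \<epsilon> *\<^sub>R P x) ** (hedgehog h x + \<epsilon> *\<^sub>R P x)) -
         sqrt 6 * h_plus t / t * trace ((hedgehog h x + \<epsilon> *\<^sub>R P x) ** (hedgehog h x + \<epsilon> *\<^sub>R P x) ** (hedgehog h x + \<epsilon> *\<^sub>R P x)) +
         (h_plus t)\<^sup>2 / (2 * t) * (trace ((hedgehog h x + \<epsilon> *\<^sub>R P x) ** (hedgehog h x + \<epsilon> *\<^sub>R P x)))\<^sup>2 + C_const t =
        1/2 * (\<Sum>i\<in>UNIV. \<Sum>j\<in>UNIV. \<Sum>k\<in>UNIV. (dQ i j x (axis k 1) + \<epsilon> * p i j k x)\<^sup>2) + bulk_density (Qm x + \<epsilon> *\<^sub>R P x)"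
    proof eventually_elim
      case (elim x)
      then have q: "hedgehog h x = Qm x" by (intro hedgehog_Qm) simp
      show ?case using elim(1) unfolding q trace_tr3 unfolding trace_tr2 bulk_density_def by simp
    qed
  qed simp
qed

text \<open>With \<open>h = r\<^sup>2 * e\<close> this is
  \<open>h'\<^sup>2 + 6 * h\<^sup>2 / r\<^sup>2\<close>, written without division; half of it is the
  gradient part of the radial integrand.\<close>

lemma gradient_sq:
  "(\<Sum>i\<in>UNIV. \<Sum>j\<in>UNIV. \<Sum>k\<in>UNIV. (dQ i j x (axis k 1))\<^sup>2) =
    10 * (e (norm x))\<^sup>2 * (norm x)\<^sup>2 + 4 * e (norm x) * e1 (norm x) * ((norm x)\<^sup>2)\<^sup>2 + (e1 (norm x))\<^sup>2 * ((norm x)\<^sup>2) ^ 3"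
proof -
  have n: "(norm x)\<^sup>2 = x$1 * x$1 + x$2 * x$2 + x$3 * x$3" "x \<bullet> x = x$1 * x$1 + x$2 * x$2 + x$3 * x$3"
    by (simp_all add: power2_norm_eq_inner inner_vec_def sum_3)
  have sq: "(dQ i j x v)\<^sup>2 = 3/2 * (e (norm x) * dp i j x v + e1 (norm x) * (x \<bullet> v) * pol i j x)\<^sup>2" for i j v
    by (simp add: dQ_def power_mult_distrib)
  define E E1 where "E = e (norm x)" and "E1 = e1 (norm x)"
  show ?thesis
    unfolding sq E_def[symmetric] E1_def[symmetric] n sum_3 dp_def pol_def kd_def
    by (simp add: axis_def inner_vec_def sum_3 field_simps power2_eq_square power3_eq_cube)
qed

text \<open>The integrand of the radial functional without its weight, in terms of \<open>e\<close>.
  It is continuous at 0, as the polar formula needs.\<close>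

definition radial_energy_density :: "real \<Rightarrow> real" where
  "radial_energy_density r = 1/2 * (2 * r * e r + r ^ 3 * e1 r)\<^sup>2 + 3 * r\<^sup>2 * (e r)\<^sup>2 + f_bulk t (r\<^sup>2 * e r)"

lemma hedgehog_energy:
  "LdG_energy t R (hedgehog h) = 4 * pi * (LINT r|lebesgue_on {0..R}. r\<^sup>2 * radial_energy_density r)"
proof -
  have z: "(\<lambda>x::real^3. (0::real^3^3) $ i $ j) \<in> test_functions (ball 0 R)" for i j
    unfolding test_functions_def by (auto intro!: exI[of _ "{}"] Ck_on_const)
  have "LdG_energy t R (hedgehog h) = (LINT x|lebesgue_on (cball 0 R). 1/2 * (\<Sum>i\<in>UNIV. \<Sum>j\<in>UNIV. \<Sum>k\<in>UNIV. (dQ i j x (axis k 1))\<^sup>2)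
      + bulk_density (Qm x))"
    using perturbed_energy[OF z, of 0] by simp
  also have "\<dots> = (LINT x|lebesgue_on (cball (0::real^3) R). radial_energy_density (norm x))"
  proof (rule Bochner_Integration.integral_cong[OF refl])
    fix x :: "real^3"
    have s: "sqrt 6 * h_plus t / t * tr3 (Qm x) (Qm x) (Qm x) = h_plus t / t * ((e (norm x)) ^ 3 * ((norm x)\<^sup>2) ^ 3)"
      using Q_algebra(3)[of x] unfolding trace_tr3 by (metis mult.commute mult.left_commute times_divide_eq_left)
    show "1/2 * (\<Sum>i\<in>UNIV. \<Sum>j\<in>UNIV. \<Sum>k\<in>UNIV. (dQ i j x (axis k 1))\<^sup>2) + bulk_density (Qm x) = radial_energy_density (norm x)"
      unfolding gradient_sq bulk_density_def s Q_algebra(2)[unfolded trace_tr2] radial_energy_density_def f_bulk_expand(1)[OF t]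
      by (simp add: algebra_simps eval_nat_numeral)
  qed
  also have "\<dots> = 4 * pi * (LINT r|lebesgue_on {0..R}. r\<^sup>2 * radial_energy_density r)"
  proof (rule radial_integral_R3[OF R])
    show "continuous_on {0..R} radial_energy_density"
      unfolding radial_energy_density_def[abs_def]
      by (intro continuous_intros ec e1c continuous_on_compose2[OF f_bulk_continuous[of UNIV]]) auto
  qed
  finally show ?thesis .
qed

end

section \<open>Stationarity of the hedgehog\<close>

context radial_profile
begin

text \<open>Contraction with a traceless matrix removes the multiple of the identity, the multiplier
  of the trace constraint; symmetry turns the entrywise product into traces.\<close>

lemma EL_contracted:
  assumes x: "norm x \<le> R" and B: "B \<in> S_bar"
  shows "(\<Sum>i\<in>UNIV. \<Sum>j\<in>UNIV. (\<Sum>k\<in>UNIV. ddQ i j x (axis k 1) (axis k 1)) * B $ i $ j) =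
    - tr2 (Qm x) B - 3 * sqrt 6 * h_plus t / t * tr3 (Qm x) (Qm x) B
    + 2 * (h_plus t)\<^sup>2 / t * tr2 (Qm x) (Qm x) * tr2 (Qm x) B"
proof -
  define a where "a = 3 * sqrt 6 * h_plus t / t"
  define b where "b = 2 * (h_plus t)\<^sup>2 / t * tr2 (Qm x) (Qm x)"
  define T where "T = tr2 (Qm x) (Qm x)"
  have sym: "B $ i $ j = B $ j $ i" for i j
    using B by (simp add: S_bar_def transpose_def vec_eq_iff)
  have tr: "(\<Sum>i\<in>UNIV. B $ i $ i) = 0" using B by (simp add: S_bar_def trace_def)
  have E: "(\<Sum>k\<in>UNIV. ddQ i j x (axis k 1) (axis k 1)) =
     - Q i j x - a * ((\<Sum>k\<in>UNIV. Q i k x * Q k j x) - kd i j * T) + b * Q i j x" for i j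
    unfolding EL_Q[OF x] trace_tr2 a_def b_def T_def by (simp add: mult_ac)
  have 1: "(\<Sum>i\<in>UNIV. \<Sum>j\<in>UNIV. Q i j x * B $ i $ j) = tr2 (Qm x) B"
    unfolding tr2_def Qm_def vec_lambda_beta by (intro sum.cong refl arg_cong2[where f = "(*)"] sym)
  have 2: "(\<Sum>i\<in>UNIV. \<Sum>j\<in>UNIV. (\<Sum>k\<in>UNIV. Q i k x * Q k j x) * B $ i $ j) = tr3 (Qm x) (Qm x) B"
    unfolding tr3_def Qm_def vec_lambda_beta by (intro sum.cong refl arg_cong2[where f = "(*)"] sym)
  have 3: "(\<Sum>i\<in>UNIV. \<Sum>j\<in>UNIV. kd i j * B $ i $ j) = 0"
  proof -
    have "(\<Sum>j\<in>UNIV. kd i j * B $ i $ j) = B $ i $ i / 3" for i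
      by (simp add: kd_def if_distrib[of "\<lambda>y. y * _"] cong: if_cong)
    then show ?thesis by (simp only: sum_divide_distrib[symmetric] tr div_0)
  qed
  have "(\<Sum>i\<in>UNIV. \<Sum>j\<in>UNIV. (\<Sum>k\<in>UNIV. ddQ i j x (axis k 1) (axis k 1)) * B $ i $ j) =
     (\<Sum>i\<in>UNIV. \<Sum>j\<in>UNIV. (- 1 + b) * (Q i j x * B $ i $ j)
       + (- a) * ((\<Sum>k\<in>UNIV. Q i k x * Q k j x) * B $ i $ j) + a * T * (kd i j * B $ i $ j))"
    unfolding E by (intro sum.cong refl) (simp add: algebra_simps)
  also have "\<dots> = (- 1 + b) * tr2 (Qm x) B + (- a) * tr3 (Qm x) (Qm x) B + a * T * 0"
    unfolding sum.distrib sum_distrib_left[symmetric] 1 2 3 ..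
  finally show ?thesis unfolding a_def b_def by (simp add: algebra_simps)
qed

text \<open>The energy along \<open>Q + \<epsilon> P\<close> is a polynomial of degree four in
  \<open>\<epsilon>\<close> with coefficients the integrals of \<open>a0\<close> to
  \<open>a4\<close>, so only the integral of \<open>a1\<close> has to vanish.\<close>

theorem hedgehog_stationary: "LdG_stationary t R (hedgehog h)"
  unfolding LdG_stationary_def
proof (intro conjI allI impI hedgehog_W12)
  fix P :: "real^3 \<Rightarrow> real^3^3"
  assume "(\<forall>x. P x \<in> S_bar) \<and> (\<forall>i j. (\<lambda>x. P x $ i $ j) \<in> test_functions (ball 0 R))"
  then have PS: "P x \<in> S_bar" and P: "(\<lambda>x. P x $ i $ j) \<in> test_functions (ball 0 R)" for x i j by auto
  let ?U = "ball (0::real^3) R" and ?B = "cball (0::real^3) R"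
  define p where "p = (\<lambda>i j k x. frechet_derivative (\<lambda>x. P x $ i $ j) (at x) (axis k 1))"
  have Pc: "continuous_on S (\<lambda>x. P x $ i $ j)" for S i j
    using test_function_continuous[OF P] by (rule continuous_on_subset) simp
  have pc: "continuous_on S (p i j k)" for S i j k
    unfolding p_def using test_function_continuous[OF test_function_derivative(2)[OF P]] by (rule continuous_on_subset) simp
  have Qc: "continuous_on ?B (\<lambda>x. Qm x $ i $ j)" for i j
    using Q_continuous by (simp add: Qm_def)
  define S0 where "S0 = (\<lambda>x. \<Sum>i\<in>UNIV. \<Sum>j\<in>UNIV. \<Sum>k\<in>UNIV. (dQ i j x (axis k 1))\<^sup>2)"
  define S1 where "S1 = (\<lambda>x. \<Sum>i\<in>UNIV. \<Sum>j\<in>UNIV. \<Sum>k\<in>UNIV. dQ i j x (axis k 1) * p i j k x)"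
  define S2 where "S2 = (\<lambda>x. \<Sum>i\<in>UNIV. \<Sum>j\<in>UNIV. \<Sum>k\<in>UNIV. (p i j k x)\<^sup>2)"
  define c where "c = sqrt 6 * h_plus t / t"
  define b where "b = (h_plus t)\<^sup>2 / (2 * t)"
  define q0 q1 q2 where "q0 = (\<lambda>x. tr2 (Qm x) (Qm x))" and "q1 = (\<lambda>x. 2 * tr2 (Qm x) (P x))" and "q2 = (\<lambda>x. tr2 (P x) (P x))"
  define r0 r1 r2 r3 where "r0 = (\<lambda>x. tr3 (Qm x) (Qm x) (Qm x))" and "r1 = (\<lambda>x. 3 * tr3 (Qm x) (Qm x) (P x))"
    and "r2 = (\<lambda>x. tr3 (Qm x) (P x) (P x) + tr3 (P x) (Qm x) (P x) + tr3 (P x) (P x) (Qm x))" and "r3 = (\<lambda>x. tr3 (P x) (P x) (P x))"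
  define a0 where "a0 = (\<lambda>x. 1/2 * S0 x + (- 1/2) * q0 x + (- c) * r0 x + b * (q0 x)\<^sup>2 + C_const t)"
  define a1 where "a1 = (\<lambda>x. S1 x + (- 1/2) * q1 x + (- c) * r1 x + b * (2 * (q0 x * q1 x)))"
  define a2 where "a2 = (\<lambda>x. 1/2 * S2 x + (- 1/2) * q2 x + (- c) * r2 x + b * ((q1 x)\<^sup>2 + 2 * (q0 x * q2 x)))"
  define a3 where "a3 = (\<lambda>x. (- c) * r3 x + b * (2 * (q1 x * q2 x)))"
  define a4 where "a4 = (\<lambda>x. b * (q2 x)\<^sup>2)"
  have Sc: "continuous_on ?B S0" "continuous_on ?B S1" "continuous_on ?B S2"
    unfolding S0_def S1_def S2_def
    by (intro continuous_on_sum continuous_on_mult continuous_on_power dQ_continuous pc)+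
  have qc: "continuous_on ?B q0" "continuous_on ?B q1" "continuous_on ?B q2"
    unfolding q0_def q1_def q2_def
    by (intro continuous_on_mult continuous_on_const continuous_on_tr2 Qc Pc)+
  have rc: "continuous_on ?B r0" "continuous_on ?B r1" "continuous_on ?B r2" "continuous_on ?B r3"
    unfolding r0_def r1_def r2_def r3_def
    by (intro continuous_on_mult continuous_on_add continuous_on_const continuous_on_tr3 Qc Pc)+
  have ac: "continuous_on ?B a0" "continuous_on ?B a1" "continuous_on ?B a2" "continuous_on ?B a3" "continuous_on ?B a4"
    unfolding a0_def a1_def a2_def a3_def a4_def
    by (intro continuous_on_mult continuous_on_add continuous_on_const continuous_on_power Sc qc rc)+
  note ai = ac[THEN L2_ball(2)]
  have expand: "1/2 * (\<Sum>i\<in>UNIV. \<Sum>j\<in>UNIV. \<Sum>k\<in>UNIV. (dQ i j x (axis k 1) + \<epsilon> * p i j k x)\<^sup>2)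
      + bulk_density (Qm x + \<epsilon> *\<^sub>R P x) = a0 x + \<epsilon> * a1 x + \<epsilon>\<^sup>2 * a2 x + \<epsilon> ^ 3 * a3 x + \<epsilon> ^ 4 * a4 x" for \<epsilon> x
  proof -
    have S: "(\<Sum>i\<in>UNIV. \<Sum>j\<in>UNIV. \<Sum>k\<in>UNIV. (dQ i j x (axis k 1) + \<epsilon> * p i j k x)\<^sup>2) = S0 x + 2 * \<epsilon> * S1 x + \<epsilon>\<^sup>2 * S2 x"
      unfolding S0_def S1_def S2_def sum_distrib_left sum.distrib[symmetric]
      by (intro sum.cong refl) (simp add: power2_eq_square algebra_simps)
    have q: "tr2 (Qm x + \<epsilon> *\<^sub>R P x) (Qm x + \<epsilon> *\<^sub>R P x) = q0 x + \<epsilon> * q1 x + \<epsilon>\<^sup>2 * q2 x"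
      unfolding tr2_expand q0_def q1_def q2_def tr_cyclic(1)[of "P x" "Qm x"] by simp
    have r: "tr3 (Qm x + \<epsilon> *\<^sub>R P x) (Qm x + \<epsilon> *\<^sub>R P x) (Qm x + \<epsilon> *\<^sub>R P x) = r0 x + \<epsilon> * r1 x + \<epsilon>\<^sup>2 * r2 x + \<epsilon> ^ 3 * r3 x"
      unfolding tr3_expand r0_def r1_def r2_def r3_def tr_cyclic(2)[of "Qm x" "P x"] tr_cyclic(3)[of "P x" "Qm x"] by simp
    show ?thesis
      unfolding S bulk_density_def q r a0_def a1_def a2_def a3_def a4_def c_def[symmetric] b_def[symmetric]
      by (simp add: algebra_simps power2_eq_square eval_nat_numeral)
  qed
  have E: "LdG_energy t R (\<lambda>x. hedgehog h x + \<epsilon> *\<^sub>R P x) =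
     integral\<^sup>L (lebesgue_on ?B) a0 + \<epsilon> * integral\<^sup>L (lebesgue_on ?B) a1 + \<epsilon>\<^sup>2 * integral\<^sup>L (lebesgue_on ?B) a2
     + \<epsilon> ^ 3 * integral\<^sup>L (lebesgue_on ?B) a3 + \<epsilon> ^ 4 * integral\<^sup>L (lebesgue_on ?B) a4" for \<epsilon>
  proof -
    have "LdG_energy t R (\<lambda>x. hedgehog h x + \<epsilon> *\<^sub>R P x) =
      (LINT x|lebesgue_on ?B. 1/2 * (\<Sum>i\<in>UNIV. \<Sum>j\<in>UNIV. \<Sum>k\<in>UNIV. (dQ i j x (axis k 1) + \<epsilon> * p i j k x)\<^sup>2)
        + bulk_density (Qm x + \<epsilon> *\<^sub>R P x))"
      unfolding p_def by (rule perturbed_energy[OF P])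
    then show ?thesis unfolding expand using ai by simp
  qed
  have "integral\<^sup>L (lebesgue_on ?B) a1 = 0"
  proof -
    \<comment> \<open>The Euler-Lagrange equation replaces the bulk part of the first variation by
      the Laplacian against \<open>P\<close>. Each summand is then the derivative in direction
      \<open>k\<close> of the product of a first derivative of \<open>Q\<close> with
      \<open>P\<close>.\<close>
    have a1: "a1 x = (\<Sum>i\<in>UNIV. \<Sum>j\<in>UNIV. \<Sum>k\<in>UNIV. dQ i j x (axis k 1) * p i j k x + ddQ i j x (axis k 1) (axis k 1) * P x $ i $ j)"
      if "norm x \<le> R" for x
    proof -
      have "(- 1/2) * q1 x + (- c) * r1 x + b * (2 * (q0 x * q1 x)) =
         (\<Sum>i\<in>UNIV. \<Sum>j\<in>UNIV. (\<Sum>k\<in>UNIV. ddQ i j x (axis k 1) (axis k 1)) * P x $ i $ j)"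
        unfolding EL_contracted[OF that PS] q1_def r1_def q0_def b_def c_def using t by (simp add: field_simps)
      then show ?thesis unfolding a1_def S1_def sum.distrib by (simp add: sum_distrib_right add.assoc)
    qed
    have int: "integrable (lebesgue_on ?U) g" if "continuous_on ?B g" for g :: "real^3 \<Rightarrow> real"
    proof -
      have 1: "integrable lebesgue (\<lambda>x. indicator ?B x *\<^sub>R g x)"
        using L2_ball(2)[OF that] by (simp add: integrable_restrict_space)
      have "integrable lebesgue (\<lambda>x. indicator ?U x *\<^sub>R (indicator ?B x *\<^sub>R g x))"
        by (rule integrable_mult_indicator[OF _ 1]) auto
      moreover have "(\<lambda>x. indicator ?U x *\<^sub>R (indicator ?B x *\<^sub>R g x)) = (\<lambda>x. indicator ?U x *\<^sub>R g x)"
        by (auto simp: fun_eq_iff indicator_def)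
      ultimately show ?thesis by (simp add: integrable_restrict_space)
    qed
    have i: "integrable (lebesgue_on ?U) (\<lambda>x. dQ i j x (axis k 1) * p i j k x)"
      "integrable (lebesgue_on ?U) (\<lambda>x. ddQ i j x (axis k 1) (axis k 1) * P x $ i $ j)" for i j k
      by (intro int continuous_on_mult dQ_continuous ddQ_continuous pc Pc)+
    have z: "(LINT x|lebesgue_on ?U. dQ i j x (axis k 1) * p i j k x + ddQ i j x (axis k 1) (axis k 1) * P x $ i $ j) = 0" for i j k
    proof -
      have "has_weak_deriv ?U (\<lambda>x. dQ i j x (axis k 1)) (axis k 1) (\<lambda>x. ddQ i j x (axis k 1) (axis k 1))"
        by (rule has_weak_deriv_classical[OF open_ball dQ_has_derivative continuous_on_subset[OF ddQ_continuous]]) auto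
      then have "(LINT x|lebesgue_on ?U. dQ i j x (axis k 1) * p i j k x) =
          - (LINT x|lebesgue_on ?U. ddQ i j x (axis k 1) (axis k 1) * P x $ i $ j)"
        using P[of i j] unfolding has_weak_deriv_def p_def by blast
      then show ?thesis using i by simp
    qed
    have "integral\<^sup>L (lebesgue_on ?B) a1 = (LINT x|lebesgue_on ?U. a1 x)"
      by (rule integral_cball_eq_ball) (use ai(2) in auto)
    also have "\<dots> = (LINT x|lebesgue_on ?U. (\<Sum>i\<in>UNIV. \<Sum>j\<in>UNIV. \<Sum>k\<in>UNIV. dQ i j x (axis k 1) * p i j k x + ddQ i j x (axis k 1) (axis k 1) * P x $ i $ j))"
      by (rule Bochner_Integration.integral_cong) (auto simp: a1)
    also have "\<dots> = (\<Sum>i\<in>UNIV. \<Sum>j\<in>UNIV. \<Sum>k\<in>UNIV. (LINT x|lebesgue_on ?U. dQ i j x (axis k 1) * p i j k x + ddQ i j x (axis k 1) (axis k 1) * P x $ i $ j))"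
      using i by (simp add: Bochner_Integration.integral_sum)
    also have "\<dots> = 0" by (simp only: z sum.neutral_const)
    finally show ?thesis .
  qed
  then show "((\<lambda>\<epsilon>. LdG_energy t R (\<lambda>x. hedgehog h x + \<epsilon> *\<^sub>R P x)) has_real_derivative 0) (at 0)"
    unfolding E by (auto intro!: derivative_eq_intros)
qed

end

section \<open>Minimizers in the Sobolev class\<close>

definition energy_integrand :: "real \<Rightarrow> (real \<Rightarrow> real) \<Rightarrow> (real \<Rightarrow> real) \<Rightarrow> real \<Rightarrow> real" where
  "energy_integrand t h w r = r\<^sup>2 * (1 / 2 * (w r)\<^sup>2 + 3 * (h r)\<^sup>2 / r\<^sup>2 + f_bulk t (h r))"

text \<open>The density \<open>v\<close> of \<open>r * h\<close> satisfies
  \<open>v\<^sup>2 = (r * h')\<^sup>2 + (r * h\<^sup>2)'\<close>, and the exact derivative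
  integrates to \<open>R\<close> because \<open>h R = 1\<close>. The factor 1 in \<open>v\<close>
  matches the shape of \<open>L2_product_integrable\<close>.\<close>

lemma A_h_to_radial_class:
  assumes t: "t > 1" and R: "R > 0" and h: "h \<in> A_h R"
  defines "v \<equiv> \<lambda>r. h r + 1 * (r * weak_deriv {0<..<R} h 1 r)"
  shows "v \<in> radial_class R" "\<And>x. x \<in> {0..R} \<Longrightarrow> prim v x = x * h x"
    "J_radial t R v = I_radial t R h + R / 2"
proof -
  let ?M = "lebesgue_on {0..R}"
  define w where "w = weak_deriv {0<..<R} h 1"
  have v: "v = (\<lambda>r. h r + 1 * (r * w r))" by (simp add: v_def w_def)
  note wd = A_h_weak_deriv[OF h R, folded w_def]
  have hc: "continuous_on {0..R} h" and hR: "h R = 1" using h by (auto simp: A_h_def)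
  have hm: "h \<in> borel_measurable ?M" and idm: "(\<lambda>r. r) \<in> borel_measurable ?M"
    using hc by (auto intro!: continuous_imp_measurable_on_sets_lebesgue continuous_intros)
  have h2: "integrable ?M (\<lambda>r. (h r)\<^sup>2)" by (intro continuous_imp_integrable_real continuous_intros hc)
  have rm: "(\<lambda>r. r * w r) \<in> borel_measurable ?M" using idm wd(3) by (rule borel_measurable_times)
  have "integrable ?M (\<lambda>r. r\<^sup>2 * (w r)\<^sup>2)"
    by (rule integrable_continuous_times[OF _ wd(2)]) (intro continuous_intros)
  then have rw2: "integrable ?M (\<lambda>r. (r * w r)\<^sup>2)" by (simp add: power_mult_distrib)
  have vm: "v \<in> borel_measurable ?M" unfolding v by (intro borel_measurable_add borel_measurable_times borel_measurable_const hm idm wd(3))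
  have v2: "integrable ?M (\<lambda>r. (v r)\<^sup>2)" unfolding v by (rule L2_product_integrable(2)[OF hm rm h2 rw2])
  have pid: "primitive R (\<lambda>x. x) (\<lambda>x. 1)" by (rule primitive_C1) (auto intro!: derivative_eq_intros)
  have pv: "primitive R (\<lambda>x. x * h x) v"
  proof -
    have "(\<lambda>x. 1 * h x + w x * x) = v" by (auto simp: v mult.commute)
    then show ?thesis using primitive_mult[OF pid wd(1)] by simp
  qed
  show prv: "prim v x = x * h x" if "x \<in> {0..R}" for x using primitive_eq[OF pv that] by simp
  have pc: "continuous_on {0..R} (prim v)"
    by (rule primitive_continuous[OF primitive_integral[OF primitive_integrable[OF pv]]])
  have "bounded (h ` {0..R})" using hc compact_continuous_image compact_imp_bounded by blast
  then obtain K where K: "\<And>x. x \<in> {0..R} \<Longrightarrow> \<bar>h x\<bar> \<le> K" by (force simp: bounded_iff)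
  have v3: "integrable ?M (\<lambda>x. (prim v x / x)\<^sup>2)"
  proof (rule integrable_bounded_ivl[OF measurable_scaled_bulk(2)[OF pc], of "K\<^sup>2"])
    fix x assume x: "0 < x" "x \<le> R"
    have "\<bar>h x\<bar>\<^sup>2 \<le> K\<^sup>2" using K[of x] x by (intro power_mono) auto
    then show "\<bar>(prim v x / x)\<^sup>2\<bar> \<le> K\<^sup>2" using prv[of x] x by simp
  qed
  show vX: "v \<in> radial_class R"
    unfolding radial_class_def mem_Collect_eq using vm v2 v3 prv[of R] hR R by simp
  have pp: "primitive R (\<lambda>x. (x * h x) * h x) (\<lambda>x. v x * h x + w x * (x * h x))"
    by (rule primitive_mult[OF pv wd(1)])
  have pI: "(LINT x|?M. v x * h x + w x * (x * h x)) = R"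
    using primitive_eq[OF pp, of R] integral_lebesgue_on_ivl[OF primitive_integrable[OF pp]] hR R by simp
  have "I_radial t R h = (LINT r|?M. radial_density t v r - 1/2 * (v r * h r + w r * (r * h r)))"
    unfolding I_radial_def w_def[symmetric]
  proof (rule Bochner_Integration.integral_cong[OF refl])
    fix r assume "r \<in> space ?M"
    then have r: "r \<in> {0..R}" by simp
    show "r\<^sup>2 * (1 / 2 * (w r)\<^sup>2 + 3 * (h r)\<^sup>2 / r\<^sup>2 + f_bulk t (h r)) = radial_density t v r - 1/2 * (v r * h r + w r * (r * h r))"
    \<comment> \<open>At 0 division by zero gives 0, so both quotients drop out and
      \<open>v 0 = h 0\<close> makes the two sides agree.\<close>
    proof (cases "r = 0")
      case True
      then show ?thesis by (simp add: radial_density_def v power2_eq_square)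
    next
      case False
      then have s: "prim v r / r = h r" using prv[OF r] by simp
      have "r\<^sup>2 * (3 * (h r)\<^sup>2 / r\<^sup>2) = 3 * (h r)\<^sup>2" using False by simp
      then have "r\<^sup>2 * (1 / 2 * (w r)\<^sup>2 + 3 * (h r)\<^sup>2 / r\<^sup>2 + f_bulk t (h r)) =
          1 / 2 * (r * w r)\<^sup>2 + 3 * (h r)\<^sup>2 + r\<^sup>2 * f_bulk t (h r)"
        by (simp only: distrib_left power_mult_distrib mult.left_commute)
      moreover have "1 / 2 * (r * w r)\<^sup>2 = 1 / 2 * (v r)\<^sup>2 - 1/2 * (v r * h r + w r * (r * h r))"
        unfolding v by algebra
      ultimately show ?thesis unfolding radial_density_def s by simp
    qed
  qed
  also have "\<dots> = J_radial t R v - 1/2 * R"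
    unfolding J_radial_def
    by (subst Bochner_Integration.integral_diff)
      (use radial_density_integrable[OF t R vX] primitive_integrable[OF pp] pI in simp_all)
  finally show "J_radial t R v = I_radial t R h + R / 2" by simp
qed

lemma C1_in_A_h:
  assumes R: "R > 0" and d: "\<And>r. r \<in> {0..R} \<Longrightarrow> (h has_real_derivative h' r) (at r within {0..R})"
    and c: "continuous_on {0..R} h'" and hR: "h R = 1"
  shows "h \<in> A_h R" "I_radial t R h = (LINT r|lebesgue_on {0..R}. energy_integrand t h h' r)"
proof -
  let ?M = "lebesgue_on {0..R}"
  have hc: "continuous_on {0..R} h" using d by (rule DERIV_continuous_on)
  have p: "primitive R h h'" by (rule primitive_C1[OF d c])
  note wd = has_weak_deriv_primitive[OF p]
  have L2: "f \<in> L2_on {0<..<R}" if "continuous_on {0..R} f" for f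
    unfolding L2_on_def mem_Collect_eq borel_measurable_ivl_open_iff[symmetric] integrable_ivl_open_iff[symmetric]
    using that by (intro conjI continuous_imp_measurable_on_sets_lebesgue continuous_imp_integrable_real continuous_intros) auto
  show "h \<in> A_h R" unfolding A_h_def W12_def using hc hR L2[OF hc] L2[OF c] wd by auto
  have "AE r in lebesgue_on {0<..<R}. weak_deriv {0<..<R} h 1 r = h' r"
    by (rule AE_weak_deriv(1)[OF _ wd]) simp
  then have "AE r in lebesgue. r \<in> {0<..<R} \<longrightarrow> weak_deriv {0<..<R} h 1 r = h' r"
    by (subst (asm) AE_restrict_space_iff) auto
  moreover have "AE x in lebesgue. x \<noteq> 0" "AE x in lebesgue. x \<noteq> R"
    by (auto intro: AE_completion AE_lborel_singleton)
  ultimately have "AE r in lebesgue. r \<in> {0..R} \<longrightarrow> weak_deriv {0<..<R} h 1 r = h' r"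
    by eventually_elim auto
  then have ae: "AE r in ?M. weak_deriv {0<..<R} h 1 r = h' r" by (subst AE_restrict_space_iff) auto
  show "I_radial t R h = (LINT r|?M. energy_integrand t h h' r)"
    unfolding I_radial_def
  proof (rule lebesgue_integral_cong_AE)
    have [measurable]: "h \<in> borel_measurable ?M" "h' \<in> borel_measurable ?M" "(\<lambda>r. r) \<in> borel_measurable ?M"
      using hc c by (auto intro!: continuous_imp_measurable_on_sets_lebesgue continuous_intros)
    have [measurable]: "f_bulk t \<in> borel_measurable borel"
      by (rule borel_measurable_continuous_onI[OF f_bulk_continuous])
    show "energy_integrand t h h' \<in> borel_measurable ?M"
      unfolding energy_integrand_def[abs_def] by measurable
    show "AE r in ?M. r\<^sup>2 * (1 / 2 * (weak_deriv {0<..<R} h 1 r)\<^sup>2 + 3 * (h r)\<^sup>2 / r\<^sup>2 + f_bulk t (h r)) = energy_integrand t h h' r"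
      using ae by eventually_elim (simp add: energy_integrand_def)
  qed simp
qed

text \<open>For the constant profile only the angular term survives, since the bulk potential
  vanishes at 1. This competitor is the source of the bound on the energy of the hedgehog.\<close>

lemma I_radial_one:
  assumes t: "t > 1" and R: "R > 0"
  shows "(\<lambda>_. 1) \<in> A_h R" "I_radial t R (\<lambda>_. 1) = 3 * R"
proof -
  note C = C1_in_A_h[OF R, of "\<lambda>_. 1" "\<lambda>_. 0"]
  show "(\<lambda>_. 1) \<in> A_h R" by (rule C(1)) auto
  have "I_radial t R (\<lambda>_. 1) = (LINT r|lebesgue_on {0..R}. energy_integrand t (\<lambda>_. 1) (\<lambda>_. 0) r)"
    by (rule C(2)) auto
  also have "\<dots> = (LINT r|lebesgue_on {0..R}. 3)"
  proof (rule lebesgue_integral_cong_AE)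
    have "AE r in lebesgue. r \<noteq> (0::real)" by (auto intro: AE_completion AE_lborel_singleton)
    then have "AE r in lebesgue_on {0..R}. r \<noteq> 0" by (subst AE_restrict_space_iff) auto
    then show "AE r in lebesgue_on {0..R}. energy_integrand t (\<lambda>_. 1) (\<lambda>_. 0) r = 3"
      by eventually_elim (simp add: energy_integrand_def C_const_eq(3)[OF t])
  qed auto
  also have "\<dots> = 3 * R"
    using integral_lebesgue_on_ivl[of 0 R "\<lambda>_. 3"] continuous_imp_integrable_real[of 0 R "\<lambda>_. 3::real"] R by simp
  finally show "I_radial t R (\<lambda>_. 1) = 3 * R" .
qed

text \<open>Formulated for an arbitrary minimizer of \<open>J\<close>, because it is applied both to
  the one that is constructed and to the lift of any given minimizer of \<open>I\<close>.\<close>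

lemma profile_exists:
  assumes t: "t > 1" and R: "R > 0" and w: "w \<in> radial_class R"
    and min: "\<And>v. v \<in> radial_class R \<Longrightarrow> J_radial t R w \<le> J_radial t R v"
  obtains e e1 e2 where "radial_profile t R (\<lambda>r. r\<^sup>2 * e r) e e1 e2"
    "\<forall>x\<in>{0..R}. prim w x = x ^ 3 * e x"
    "real_analytic_on (\<lambda>r. r\<^sup>2 * e r) {0..R}"
proof -
  let ?c1 = "3 * (h_plus t / t)" and ?c2 = "4 * ((h_plus t)\<^sup>2 / (2 * t))"
  from J_minimizer_regular[OF assms] obtain e where
    e: "\<forall>x\<in>{0..R}. (e has_real_derivative x * mean_op 6 (source ?c1 ?c2 e) x) (at x within {0..R})"
    and we: "\<forall>x\<in>{0..R}. prim w x = x ^ 3 * e x" by blast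
  have "\<exists>e2. continuous_on {0..R} e2 \<and> (\<forall>x\<in>{0..R}. (mean_op 6 (source ?c1 ?c2 e) has_real_derivative x * e2 x) (at x within {0..R}) \<and>
     7 * mean_op 6 (source ?c1 ?c2 e) x + x\<^sup>2 * e2 x = source ?c1 ?c2 e x)"
    by (rule profile_second_derivative) (use e in blast)
  then obtain e2 where e2: "continuous_on {0..R} e2"
    "\<forall>x\<in>{0..R}. (mean_op 6 (source ?c1 ?c2 e) has_real_derivative x * e2 x) (at x within {0..R}) \<and>
     7 * mean_op 6 (source ?c1 ?c2 e) x + x\<^sup>2 * e2 x = source ?c1 ?c2 e x" by blast
  have "diff_class e ((1 + 1) + 1) ((1 * 1) * 1) (\<lambda>x. (x * x) * e x)"
    by (intro diff_class.mult diff_class.ident diff_class.base)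
  then have "real_analytic_on (\<lambda>x. (x * x) * e x) {0..R}"
    by (rule diff_class_analytic) (use e in blast)
  then have an: "real_analytic_on (\<lambda>x. x\<^sup>2 * e x) {0..R}" by (simp add: power2_eq_square)
  have "radial_profile t R (\<lambda>r. r\<^sup>2 * e r) e (mean_op 6 (source ?c1 ?c2 e)) e2"
    by (rule radial_profile.intro) (use t R e e2 in auto)
  then show ?thesis using we an that by blast
qed

section \<open>The profile equation and the upper bound\<close>

context radial_profile
begin

lemma h_derivative:
  assumes "r \<in> {0..R}"
  shows "((\<lambda>r. r\<^sup>2 * e r) has_real_derivative 2 * r * e r + r ^ 3 * e1 r) (at r within {0..R})"
  by (rule derivative_eq_intros e'[OF assms] refl | simp add: power2_eq_square power3_eq_cube algebra_simps)+

lemma h_second_derivative: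
  assumes "r \<in> {0..R}"
  shows "((\<lambda>r. 2 * r * e r + r ^ 3 * e1 r) has_real_derivative
    2 * e r + 5 * r\<^sup>2 * e1 r + r ^ 4 * e2 r) (at r within {0..R})"
  by (rule derivative_eq_intros e'[OF assms] e1'[OF assms] refl | simp add: eval_nat_numeral algebra_simps)+

lemma h_DERIV:
  assumes r: "r \<in> {0<..<R}"
  shows "(h has_real_derivative 2 * r * e r + r ^ 3 * e1 r) (at r)" (is ?A)
    and "(deriv h has_real_derivative 2 * e r + 5 * r\<^sup>2 * e1 r + r ^ 4 * e2 r) (at r)" (is ?B)
proof -
  have D: "(h has_real_derivative 2 * r * e r + r ^ 3 * e1 r) (at r)" if r: "r \<in> {0<..<R}" for r
  proof -
    have "((\<lambda>r. r\<^sup>2 * e r) has_real_derivative 2 * r * e r + r ^ 3 * e1 r) (at r)"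
      using h_derivative[of r] r by (simp add: at_within_Icc_at)
    then show ?thesis
      by (rule has_field_derivative_transform_within_open[of _ _ _ "{0<..<R}"]) (use r he in auto)
  qed
  show ?A by (rule D[OF r])
  have "((\<lambda>r. 2 * r * e r + r ^ 3 * e1 r) has_real_derivative 2 * e r + 5 * r\<^sup>2 * e1 r + r ^ 4 * e2 r) (at r)"
    using h_second_derivative[of r] r by (simp add: at_within_Icc_at)
  then show ?B
    by (rule has_field_derivative_transform_within_open[of _ _ _ "{0<..<R}"])
      (use r DERIV_imp_deriv[OF D, symmetric] in auto)
qed

lemma h_ODE:
  assumes r: "r \<in> {0<..<R}"
  shows "2 * e r + 5 * r\<^sup>2 * e1 r + r ^ 4 * e2 r + 2 / r * (2 * r * e r + r ^ 3 * e1 r) - 6 * h r / r\<^sup>2 =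
    - h r + h r ^ 3 + 3 * h_plus t / t * (h r ^ 3 - (h r)\<^sup>2)"
proof -
  define c1 where "c1 = 3 * (h_plus t / t)"
  \<comment> \<open>Criticality of the value 1 splits the cubic coefficient into
    \<open>1 + c1\<close>, which separates \<open>h ^ 3\<close> from the multiple of
    \<open>h ^ 3 - h\<^sup>2\<close>.\<close>
  have c2: "4 * ((h_plus t)\<^sup>2 / (2 * t)) = 1 + c1" using f_bulk_expand(4)[OF t] by (simp add: c1_def)
  have hr: "h r = r\<^sup>2 * e r" using he[of r] r by simp
  have P: "7 * e1 r + r\<^sup>2 * e2 r = - e r - c1 * r\<^sup>2 * (e r)\<^sup>2 + (1 + c1) * r ^ 4 * e r ^ 3"
    using profile_eq[of r] r unfolding c2 c1_def[symmetric] source_def by simp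
  have "2 * e r + 5 * r\<^sup>2 * e1 r + r ^ 4 * e2 r + 2 / r * (2 * r * e r + r ^ 3 * e1 r) - 6 * h r / r\<^sup>2 =
      r\<^sup>2 * (7 * e1 r + r\<^sup>2 * e2 r)"
    unfolding hr using r by (simp add: field_simps eval_nat_numeral)
  also have "\<dots> = - h r + h r ^ 3 + c1 * (h r ^ 3 - (h r)\<^sup>2)"
    unfolding P hr by (simp add: algebra_simps eval_nat_numeral)
  finally show ?thesis by (simp add: c1_def)
qed

lemma radial_ODE: "radial_ODE_solution t R h"
  unfolding radial_ODE_solution_def
proof (intro ballI conjI)
  fix r assume r: "r \<in> {0<..<R}"
  show "h field_differentiable at r" "deriv h field_differentiable at r"
    using h_DERIV[OF r] by (auto simp: field_differentiable_def)
  show "deriv (deriv h) r + 2 / r * deriv h r - 6 * h r / r\<^sup>2 =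
      - h r + h r ^ 3 + 3 * h_plus t / t * (h r ^ 3 - (h r)\<^sup>2)"
    using h_ODE[OF r] h_DERIV[OF r] by (simp add: DERIV_imp_deriv)
qed

lemma h_continuous: "continuous_on {0..R} h"
proof -
  have "continuous_on {0..R} (\<lambda>r. r\<^sup>2 * e r)" by (intro continuous_intros ec)
  then show ?thesis by (rule continuous_on_eq) (simp add: he)
qed

lemma h_zero: "h 0 = 0" using he[of 0] R by simp

text \<open>The boundary values 0 and 1 force a maximum above 1 into the interior. There the first
  derivative vanishes, and the equation makes the second one a sum of positive terms.\<close>

lemma h_le_1:
  assumes hR: "h R = 1" and r: "r \<in> {0..R}"
  shows "h r \<le> 1"
proof (rule ccontr)
  assume "\<not> h r \<le> 1"
  obtain x where x: "x \<in> {0..R}" "\<And>y. y \<in> {0..R} \<Longrightarrow> h y \<le> h x"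
    using continuous_attains_sup[OF compact_Icc _ h_continuous] r by auto
  have hx: "h x > 1" using x(2)[OF r] \<open>\<not> h r \<le> 1\<close> by linarith
  then have xi: "x \<in> {0<..<R}" using x(1) hR h_zero by (cases "x = 0"; cases "x = R") auto
  define d where "d = 2 * e x + 5 * x\<^sup>2 * e1 x + x ^ 4 * e2 x"
  have z: "2 * x * e x + x ^ 3 * e1 x = 0"
  proof (rule DERIV_local_max[OF h_DERIV(1)[OF xi]])
    show "0 < min x (R - x)" using xi by simp
    show "\<forall>y. \<bar>x - y\<bar> < min x (R - x) \<longrightarrow> h y \<le> h x"
      using x(2) by (auto simp: abs_if split: if_splits)
  qed
  have "d > 0"
  proof -
    have "d = 6 * h x / x\<^sup>2 + (- h x + h x ^ 3 + 3 * h_plus t / t * (h x ^ 3 - (h x)\<^sup>2))"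
      using h_ODE[OF xi] unfolding z d_def by simp
    moreover have "6 * h x / x\<^sup>2 > 0" using hx xi by simp
    moreover have "h x ^ 3 > h x" "h x ^ 3 > (h x)\<^sup>2"
      using hx power_strict_increasing[of 1 3 "h x"] power_strict_increasing[of 2 3 "h x"] by auto
    moreover have "3 * h_plus t / t * (h x ^ 3 - (h x)\<^sup>2) > 0"
      using h_plus_root(2)[OF t] t \<open>h x ^ 3 > (h x)\<^sup>2\<close> by (intro mult_pos_pos divide_pos_pos) auto
    ultimately show ?thesis by linarith
  qed
  have dd: "(deriv h has_real_derivative d) (at x)" unfolding d_def by (rule h_DERIV(2)[OF xi])
  have d0: "deriv h x = 0" using h_DERIV(1)[OF xi] z by (simp add: DERIV_imp_deriv)
  \<comment> \<open>A positive second derivative makes the first one positive just to the right of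
    \<open>x\<close>, so by the mean value theorem \<open>h\<close> would exceed its
    maximum.\<close>
  obtain \<delta> where \<delta>: "\<delta> > 0" "\<And>s. 0 < s \<Longrightarrow> s < \<delta> \<Longrightarrow> deriv h x < deriv h (x + s)"
    using DERIV_pos_inc_right[OF dd \<open>d > 0\<close>] by blast
  define s where "s = min \<delta> (R - x) / 2"
  have s: "0 < s" "s < \<delta>" "x + s < R" using \<delta>(1) xi by (auto simp: s_def min_def field_simps)
  have "\<exists>z>x. z < x + s \<and> h (x + s) - h x = (x + s - x) * deriv h z"
  proof (rule MVT2)
    fix y assume y: "x \<le> y" "y \<le> x + s"
    then have "y \<in> {0<..<R}" using xi s by auto
    from h_DERIV(1)[OF this] show "(h has_real_derivative deriv h y) (at y)" by (simp add: DERIV_imp_deriv)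
  qed (use s in simp)
  then obtain y where y: "x < y" "y < x + s" "h (x + s) - h x = s * deriv h y" by auto
  have "deriv h y > 0" using \<delta>(2)[of "y - x"] y s d0 by simp
  then have "h (x + s) > h x" using y(3) mult_pos_pos[OF s(1), of "deriv h y"] by simp
  moreover have "h (x + s) \<le> h x" using x(2)[of "x + s"] xi s by simp
  ultimately show False by simp
qed

lemma hedgehog_energy_I:
  assumes hR: "h R = 1"
  shows "LdG_energy t R (hedgehog h) = 4 * pi * I_radial t R h"
proof -
  have "I_radial t R h = (LINT r|lebesgue_on {0..R}. energy_integrand t h (\<lambda>r. 2 * r * e r + r ^ 3 * e1 r) r)"
  proof (rule C1_in_A_h(2)[where h = h and h' = "\<lambda>r. 2 * r * e r + r ^ 3 * e1 r" and t = t, OF R])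
    fix r assume r: "r \<in> {0..R}"
    show "(h has_real_derivative 2 * r * e r + r ^ 3 * e1 r) (at r within {0..R})"
      by (rule has_field_derivative_transform_within[OF h_derivative[OF r] zero_less_one r]) (simp add: he)
  next
    show "continuous_on {0..R} (\<lambda>r. 2 * r * e r + r ^ 3 * e1 r)" by (intro continuous_intros ec e1c)
  qed (rule hR)
  also have "\<dots> = (LINT r|lebesgue_on {0..R}. r\<^sup>2 * radial_energy_density r)"
  proof (rule Bochner_Integration.integral_cong[OF refl])
    fix r assume "r \<in> space (lebesgue_on {0..R})"
    then show "energy_integrand t h (\<lambda>r. 2 * r * e r + r ^ 3 * e1 r) r = r\<^sup>2 * radial_energy_density r"
      using he[of r] by (cases "r = 0") (simp_all add: energy_integrand_def radial_energy_density_def power_mult_distrib field_simps eval_nat_numeral)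
  qed
  finally show ?thesis using hedgehog_energy by simp
qed

end

section \<open>Nonnegativity of the profile\<close>

lemma zeros_around_negative:
  fixes h :: "real \<Rightarrow> real"
  assumes c: "continuous_on {0..R} h" and h0: "h 0 = 0" and hR: "h R > 0" and x0: "x0 \<in> {0..R}" "h x0 < 0"
  obtains a b where "0 \<le> a" "a < b" "b < R" "h a = 0" "h b = 0" "\<And>x. a < x \<Longrightarrow> x < b \<Longrightarrow> h x < 0"
proof -
  have x0': "0 < x0" "x0 < R" using x0 h0 hR by (cases "x0 = 0"; cases "x0 = R"; auto)+
  define A where "A = {x \<in> {0..x0}. h x = 0}"
  define B where "B = {x \<in> {x0..R}. h x = 0}"
  have cA: "continuous_on {0..x0} h" "continuous_on {x0..R} h"
    using x0' by (auto intro: continuous_on_subset[OF c])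
  have "closed A" "closed B"
    unfolding A_def B_def using continuous_closed_preimage_constant[OF cA(1), of 0] continuous_closed_preimage_constant[OF cA(2), of 0]
    by simp_all
  moreover have "bounded A" "bounded B"
    by (rule bounded_subset[of "{0..R}"]; use x0' in \<open>auto simp: A_def B_def\<close>)+
  ultimately have cAB: "compact A" "compact B" by (simp_all add: compact_eq_bounded_closed)
  have "0 \<in> A" using h0 x0' by (simp add: A_def)
  then have "A \<noteq> {}" by blast
  from compact_attains_sup[OF cAB(1) this] obtain a where a: "a \<in> A" "\<And>x. x \<in> A \<Longrightarrow> x \<le> a" by blast
  have "\<exists>x. x0 \<le> x \<and> x \<le> R \<and> h x = 0"
    by (rule IVT'[OF _ _ _ cA(2)]) (use x0 x0' hR in auto)
  then have "B \<noteq> {}" by (auto simp: B_def)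
  from compact_attains_inf[OF cAB(2) this] obtain b where b: "b \<in> B" "\<And>x. x \<in> B \<Longrightarrow> b \<le> x" by blast
  have ab: "0 \<le> a" "a < x0" "x0 < b" "b < R" "h a = 0" "h b = 0"
    using a(1) b(1) x0 hR by (auto simp: A_def B_def less_le)
  have neg: "h x < 0" if x: "a < x" "x < b" for x
  proof (rule ccontr)
    assume "\<not> h x < 0"
    then have hx: "h x \<ge> 0" by simp
    show False
    proof (cases "x \<le> x0")
      case True
      have "\<exists>y. x \<le> y \<and> y \<le> x0 \<and> h y = 0"
        by (rule IVT2'[OF _ _ True continuous_on_subset[OF cA(1)]]) (use hx x0 x ab in auto)
      then obtain y where "x \<le> y" "y \<le> x0" "h y = 0" by blast
      then have "y \<in> A" using x ab by (simp add: A_def)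
      then show False using a(2)[of y] x \<open>x \<le> y\<close> by simp
    next
      case False
      have "\<exists>y. x0 \<le> y \<and> y \<le> x \<and> h y = 0"
        by (rule IVT'[OF _ _ _ continuous_on_subset[OF cA(2)]]) (use hx x0 x ab False in auto)
      then obtain y where "x0 \<le> y" "y \<le> x" "h y = 0" by blast
      then have "y \<in> B" using x ab by (simp add: B_def)
      then show False using b(2)[of y] x \<open>y \<le> x\<close> by simp
    qed
  qed
  show ?thesis by (rule that[OF ab(1) _ ab(4,5,6) neg]) (use ab in auto)
qed

text \<open>Changing the sign of the density \<open>v\<close> between two zeros of its primitive
  changes the sign of the primitive exactly there. All even terms of the energy are unchanged, while
  the cubic term drops strictly wherever \<open>h\<close> was negative.\<close>

lemma J_minimizer_nonneg:
  assumes t: "t > 1" and R: "R > 0" and v: "v \<in> radial_class R"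
    and min: "\<And>y. y \<in> radial_class R \<Longrightarrow> J_radial t R v \<le> J_radial t R y"
    and vh: "\<And>x. x \<in> {0..R} \<Longrightarrow> prim v x = x * h x" and hc: "continuous_on {0..R} h"
    and h0: "h 0 = 0" and hR: "h R = 1" and r: "r \<in> {0..R}"
  shows "0 \<le> h r"
proof (rule ccontr)
  assume "\<not> 0 \<le> h r"
  then have "h r < 0" by simp
  then obtain a b where ab: "0 \<le> a" "a < b" "b < R" "h a = 0" "h b = 0" "\<And>x. a < x \<Longrightarrow> x < b \<Longrightarrow> h x < 0"
    using zeros_around_negative[OF hc h0 _ r] hR by auto
  let ?M = "lebesgue_on {0..R}"
  note vi = radial_class_integrable[OF v]
  \<comment> \<open>The integral of \<open>g\<close> equals \<open>prim v\<close> on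
    \<open>[a, b]\<close> and zero elsewhere because \<open>prim v\<close> vanishes at both ends;
    subtracting it twice reflects the primitive.\<close>
  define g where "g = (\<lambda>x. if x \<in> {a..b} then v x else 0)"
  define y where "y = (\<lambda>x. v x - 2 * g x)"
  define \<sigma> where "\<sigma> = (\<lambda>x. if x \<in> {a..b} then - 1 else 1 :: real)"
  have gm: "g \<in> borel_measurable ?M"
    unfolding g_def using vi(1)
    by (intro measurable_If_set) (auto simp: sets_restrict_space_iff)
  have ym: "y \<in> borel_measurable ?M" unfolding y_def using vi(1) gm by simp
  have ysq: "(y x)\<^sup>2 = (v x)\<^sup>2" for x by (simp add: y_def g_def power2_eq_square)
  have gi: "integrable ?M g"
    by (rule Bochner_Integration.integrable_bound[OF vi(4) gm]) (auto simp: g_def)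
  have pry: "prim y x = \<sigma> x * prim v x" if x: "x \<in> {0..R}" for x
  proof -
    have i: "v integrable_on {0..x}" "g integrable_on {0..x}"
      using integrable_lebesgue_on_subset_ivl[OF vi(4), of 0 x] integrable_lebesgue_on_subset_ivl[OF gi, of 0 x] x
      by (auto intro: integrable_on_of_lebesgue_ivl)
    have 1: "prim y x = prim v x - 2 * prim g x"
      unfolding y_def using i by (simp add: Henstock_Kurzweil_Integration.integral_diff integrable_on_mult_right)
    have 2: "prim g x = integral ({a..b} \<inter> {0..x}) v"
      unfolding g_def by (rule Henstock_Kurzweil_Integration.integral_restrict_Int)
    have va: "prim v a = 0" "prim v b = 0" using vh[of a] vh[of b] ab by auto
    consider "x < a" | "a \<le> x" "x \<le> b" | "b < x" by linarith
    then show ?thesis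
    proof cases
      case 1
      then have "{a..b} \<inter> {0..x} = {}" by auto
      then show ?thesis using \<open>prim y x = _\<close> 2 1 by (simp add: \<sigma>_def)
    next
      case 2
      then have "{a..b} \<inter> {0..x} = {a..x}" using ab by auto
      then have "prim g x = prim v x - prim v a"
        using \<open>prim g x = _\<close> primitive_increment[OF vi(6), of a x] 2 ab x by simp
      then show ?thesis using 1 va 2 by (simp add: \<sigma>_def)
    next
      case 3
      then have "{a..b} \<inter> {0..x} = {a..b}" using ab by auto
      then have "prim g x = prim v b - prim v a"
        using 2 primitive_increment[OF vi(6), of a b] ab by simp
      then show ?thesis using 1 va 3 by (simp add: \<sigma>_def)
    qed
  qed
  have s2: "(prim y x / x)\<^sup>2 = (prim v x / x)\<^sup>2" if "x \<in> {0..R}" for x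
    using pry[OF that] by (simp add: \<sigma>_def)
  have yX: "y \<in> radial_class R"
    unfolding radial_class_def mem_Collect_eq
  proof (intro conjI ym)
    show "integrable ?M (\<lambda>x. (y x)\<^sup>2)" unfolding ysq by (rule vi)
    show "integrable ?M (\<lambda>x. (prim y x / x)\<^sup>2)"
      using vi(3) s2 Bochner_Integration.integrable_cong[OF refl, of ?M "\<lambda>x. (prim y x / x)\<^sup>2" "\<lambda>x. (prim v x / x)\<^sup>2"] by simp
    show "prim y R = R" using pry[of R] vi(5) ab R by (simp add: \<sigma>_def)
  qed
  define c where "c = h_plus t / t"
  have c: "c > 0" unfolding c_def by (rule f_bulk_expand(2)[OF t])
  define D where "D = (\<lambda>x. radial_density t v x - radial_density t y x)"
  have Dx: "D x = (if x \<in> {a..b} then x\<^sup>2 * (- 2 * c * (prim v x / x) ^ 3) else 0)" if x: "x \<in> {0..R}" for x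
  proof -
    have "D x = x\<^sup>2 * (f_bulk t (prim v x / x) - f_bulk t (prim y x / x))"
      unfolding D_def radial_density_def ysq s2[OF x] by (simp add: algebra_simps)
    moreover have "f_bulk t s - f_bulk t (- s) = - 2 * c * s ^ 3" for s
      unfolding f_bulk_expand(1)[OF t] c_def by simp
    ultimately show ?thesis using pry[OF x] by (auto simp: \<sigma>_def)
  qed
  have Dpos: "0 \<le> D x" "a < x \<Longrightarrow> x < b \<Longrightarrow> 0 < D x" if x: "x \<in> {0..R}" for x
  proof -
    have q: "prim v x / x = h x" if "x \<noteq> 0" using vh[OF x] that by simp
    have neg: "0 < x\<^sup>2 * (- 2 * c * (h x) ^ 3)" if "a < x" "x < b"
    proof -
      have "(h x) ^ 3 < 0" using ab(6)[OF that] by (simp add: power_less_zero_eq)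
      then have "- 2 * c * (h x) ^ 3 > 0" using c by (simp add: mult_pos_neg)
      then show ?thesis using that ab(1) mult_pos_pos[of "x\<^sup>2" "- 2 * c * (h x) ^ 3"] by simp
    qed
    show "0 < D x" if "a < x" "x < b"
      using neg[OF that] q that ab(1) Dx[OF x] by simp
    show "0 \<le> D x"
    proof (cases "a < x \<and> x < b")
      case True
      then show ?thesis using neg q ab(1) Dx[OF x] by simp
    next
      case False
      then have "x \<in> {a..b} \<Longrightarrow> h x = 0" using ab by (cases "x = a"; cases "x = b") auto
      then show ?thesis using Dx[OF x] q by (cases "x = 0") auto
    qed
  qed
  have di: "integrable ?M (radial_density t v)" "integrable ?M (radial_density t y)"
    by (rule radial_density_integrable[OF t R v], rule radial_density_integrable[OF t R yX])
  have Di: "integrable ?M D" unfolding D_def using di by simp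
  have "integral\<^sup>L ?M D = J_radial t R v - J_radial t R y"
    unfolding D_def J_radial_def using di by simp
  then have "integral\<^sup>L ?M D \<le> 0" using min[OF yX] by simp
  moreover have "0 \<le> integral\<^sup>L ?M D" by (rule Bochner_Integration.integral_nonneg) (simp add: Dpos)
  ultimately have "integral\<^sup>L ?M D = 0" by simp
  then have "AE x in ?M. D x = 0"
    using integral_nonneg_eq_0_iff_AE[OF Di] AE_I2[of ?M "\<lambda>x. 0 \<le> D x"] Dpos(1) by simp
  then have "AE x in lebesgue. x \<in> {0..R} \<longrightarrow> D x = 0" by (subst (asm) AE_restrict_space_iff) auto
  then have "AE x in lebesgue. x \<notin> box a b"
  proof eventually_elim
    case (elim x)
    then show ?case using Dpos(2)[of x] ab by (auto simp: box_real)
  qed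
  then have "box a b \<in> null_sets lebesgue" by (subst AE_iff_null_sets) auto
  then have "box a b = {}" using open_not_negligible[OF open_box, of a b] unfolding negligible_iff_null_sets by blast
  then show False using ab(2) by (simp add: box_real)
qed

theorem proposition2p1:
  fixes t R :: real
  assumes "t > 1" and "R > 0"
  shows "(\<exists>h. global_minimizer t R h) \<and>
    (\<forall>h. global_minimizer t R h \<longrightarrow>
       (radial_ODE_solution t R h \<and> h 0 = 0 \<and> h R = 1 \<and> real_analytic_on h {0..R}) \<and>
       (LdG_EL_solution t R (hedgehog h) \<and> LdG_stationary t R (hedgehog h) \<and>
        LdG_energy t R (hedgehog h) \<le> 12 * pi * R) \<and>
       (\<forall>r\<in>{0..R}. 0 \<le> h r \<and> h r \<le> 1))"
proof -
  note t = assms(1) and R = assms(2)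
  let ?M = "lebesgue_on {0..R}"
  obtain w where w: "w \<in> radial_class R" "\<And>v. v \<in> radial_class R \<Longrightarrow> J_radial t R w \<le> J_radial t R v"
    using exists_J_minimizer[OF t R] by blast
  obtain e e1 e2 where prof: "radial_profile t R (\<lambda>r. r\<^sup>2 * e r) e e1 e2"
    and we: "\<forall>x\<in>{0..R}. prim w x = x ^ 3 * e x"
    and "real_analytic_on (\<lambda>r. r\<^sup>2 * e r) {0..R}"
    by (rule profile_exists[OF t R w])
  define k where "k = (\<lambda>r. r\<^sup>2 * e r)"
  interpret k: radial_profile t R "\<lambda>r. r\<^sup>2 * e r" e e1 e2 by (rule prof)
  have "R ^ 3 * e R = R" using bspec[OF we, of R] radial_class_integrable(5)[OF w(1)] R by simp
  then have kR: "k R = 1" using R by (simp add: k_def power3_eq_cube power2_eq_square)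
  have kA: "k \<in> A_h R"
    unfolding k_def
  proof (rule C1_in_A_h(1)[OF R k.h_derivative])
    show "continuous_on {0..R} (\<lambda>r. 2 * r * e r + r ^ 3 * e1 r)" by (intro continuous_intros k.ec k.e1c)
  qed (use kR in \<open>auto simp: k_def\<close>)
  define lift where "lift = (\<lambda>h r. h r + 1 * (r * weak_deriv {0<..<R} h 1 r))"
  have lift: "lift h \<in> radial_class R" "\<And>x. x \<in> {0..R} \<Longrightarrow> prim (lift h) x = x * h x"
    "J_radial t R (lift h) = I_radial t R h + R / 2" if "h \<in> A_h R" for h
    unfolding lift_def using A_h_to_radial_class[OF t R that] by blast+
  \<comment> \<open>The lift of \<open>k\<close> and \<open>w\<close> have the same primitive, so
    they agree almost everywhere and have equal energy.\<close>
  have Jk: "J_radial t R (lift k) = J_radial t R w"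
  proof -
    note li = radial_class_integrable[OF lift(1)[OF kA]] and wi = radial_class_integrable[OF w(1)]
    have pe: "prim (lift k) x = prim w x" if "x \<in> {0..R}" for x
      using lift(2)[OF kA that] bspec[OF we that] by (simp add: k_def power3_eq_cube power2_eq_square)
    have "AE x in ?M. lift k x - w x = 0"
    proof (rule AE_zero_of_primitive_zero)
      show "integrable ?M (\<lambda>x. lift k x - w x)" using li(4) wi(4) by simp
      fix x assume x: "x \<in> {0..R}"
      have "lift k integrable_on {0..x}" "w integrable_on {0..x}"
        using integrable_lebesgue_on_subset_ivl[OF li(4), of 0 x] integrable_lebesgue_on_subset_ivl[OF wi(4), of 0 x] x
        by (auto intro: integrable_on_of_lebesgue_ivl)
      then show "prim (\<lambda>x. lift k x - w x) x = 0"
        using pe[OF x] by (simp add: Henstock_Kurzweil_Integration.integral_diff)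
    qed
    moreover have "AE x in ?M. x \<in> {0..R}" by (rule AE_I2) simp
    ultimately have "AE x in ?M. radial_density t (lift k) x = radial_density t w x"
      by eventually_elim (simp add: radial_density_def pe)
    then show ?thesis unfolding J_radial_def
      by (intro lebesgue_integral_cong_AE borel_measurable_integrable radial_density_integrable[OF t R w(1)]) auto
  qed
  have gk: "global_minimizer t R k"
    unfolding global_minimizer_def
  proof (intro conjI ballI kA)
    fix g assume g: "g \<in> A_h R"
    show "I_radial t R k \<le> I_radial t R g"
      using w(2)[OF lift(1)[OF g]] lift(3)[OF g] lift(3)[OF kA] Jk by linarith
  qed
  have "(radial_ODE_solution t R h \<and> h 0 = 0 \<and> h R = 1 \<and> real_analytic_on h {0..R}) \<and>
       (LdG_EL_solution t R (hedgehog h) \<and> LdG_stationary t R (hedgehog h) \<and>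
        LdG_energy t R (hedgehog h) \<le> 12 * pi * R) \<and>
       (\<forall>r\<in>{0..R}. 0 \<le> h r \<and> h r \<le> 1)" if gm: "global_minimizer t R h" for h
  proof -
    have hA: "h \<in> A_h R" and hmin: "\<And>g. g \<in> A_h R \<Longrightarrow> I_radial t R h \<le> I_radial t R g"
      using gm by (auto simp: global_minimizer_def)
    have hR: "h R = 1" and hc: "continuous_on {0..R} h" using hA by (auto simp: A_h_def)
    \<comment> \<open>As the minimum of \<open>J\<close> over the larger class is attained by the
      lift of \<open>k\<close> in \<open>A_h\<close>, a minimizer of \<open>I\<close> within
      \<open>A_h\<close> also minimizes \<open>J\<close> over the larger class.\<close>
    have Jmin: "J_radial t R (lift h) \<le> J_radial t R v" if "v \<in> radial_class R" for v
      using hmin[OF kA] lift(3)[OF hA] lift(3)[OF kA] Jk w(2)[OF that] by linarith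
    obtain f f1 f2 where pf: "radial_profile t R (\<lambda>r. r\<^sup>2 * f r) f f1 f2"
      and lf: "\<forall>x\<in>{0..R}. prim (lift h) x = x ^ 3 * f x"
      and an: "real_analytic_on (\<lambda>r. r\<^sup>2 * f r) {0..R}"
      by (rule profile_exists[OF t R lift(1)[OF hA] Jmin])
    interpret f: radial_profile t R "\<lambda>r. r\<^sup>2 * f r" f f1 f2 by (rule pf)
    have pos: "h x - x\<^sup>2 * f x = 0" if x: "x \<in> {0<..<R}" for x
    proof -
      have "x * h x = x * (x\<^sup>2 * f x)"
        using lift(2)[OF hA, of x] bspec[OF lf, of x] x by (simp add: power3_eq_cube power2_eq_square)
      then show ?thesis using x by simp
    qed
    \<comment> \<open>The primitives determine only \<open>r * h r\<close>, so the identity at 0 has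
      to come from continuity.\<close>
    have hf: "h r = r\<^sup>2 * f r" if r: "r \<in> {0..R}" for r
    proof -
      have "(\<lambda>r. h r - r\<^sup>2 * f r) r = 0"
      proof (rule continuous_constant_on_closure[where S = "{0<..<R}" and f = "\<lambda>r. h r - r\<^sup>2 * f r" and x = r])
        show "continuous_on (closure {0<..<R}) (\<lambda>r. h r - r\<^sup>2 * f r)"
          using R by (simp, intro continuous_intros hc f.ec)
      qed (use pos r R in auto)
      then show ?thesis by simp
    qed
    interpret h: radial_profile t R h f f1 f2
      using pf hf by (simp add: radial_profile_def)
    have "real_analytic_on h {0..R}"
      using an hf unfolding real_analytic_on_def by simp
    moreover have "LdG_energy t R (hedgehog h) \<le> 12 * pi * R"
    proof -
      have "I_radial t R h \<le> 3 * R" using hmin[OF I_radial_one(1)[OF t R]] I_radial_one(2)[OF t R] by simp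
      then have "4 * pi * I_radial t R h \<le> 4 * pi * (3 * R)" by (intro mult_left_mono) auto
      then show ?thesis using h.hedgehog_energy_I[OF hR] by simp
    qed
    ultimately show ?thesis
      using h.radial_ODE h.h_zero hR h.EL_solution h.hedgehog_stationary h.h_le_1[OF hR]
        J_minimizer_nonneg[OF t R lift(1)[OF hA] Jmin lift(2)[OF hA] hc h.h_zero hR] by blast
  qed
  then show ?thesis using gk by blast
qed

end
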